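(* Let $k\ge 1$ and let $F(n)=\prod_{j=1}^k (a_j n+b_j)$ be a product of $k$ linear forms with integer coefficients $a_j\neq 0$, $b_j$, having non-zero discriminant $\Delta=\prod_{1\le i<j\le k}(a_ib_j-a_jb_i)\neq 0$, and satisfying the non-degeneracy condition $\gamma(q)>0$ for all integers $q\ge 1$. Let $N\ge 2$ be an integer and suppose $|a_i|,|b_i|\le N$ for all $i$. Define \[ h(\theta)=h_{N;F}(\theta):=\sum_{\substack{n\le N\\ n\in X(F)}} e(n\theta). \] Then for every real $2<p<\infty$, \[ \|h\|_{L^p(\mathbb{T})}=\Big(\int_0^1|h(\theta)|^p\,d\theta\Big)^{1/p}\le C_{p,k}\,\mathfrak{S}_F\, N^{1-1/p}(\log N)^{-k}, \] where the constant $C_{p,k}$ depends only on $p$ and $k$ (and is otherwise independent of $F$ and $N$).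
   Context: $e(\theta):=e^{2\pi i\theta}$, $\mathbb{T}=\mathbb{R}/\mathbb{Z}$. For $q\ge1$, $\gamma(q)=\gamma(q,F):=q^{-1}\,|\{n\in\mathbb{Z}/q\mathbb{Z}:\gcd(q,F(n))=1\}|$. $X(F):=\{n\in\mathbb{Z}^+: F(n)\text{ is the product of } k \text{ primes}\}$ (e.g. for $F(n)=n(n+2)$ this is the set of twin primes $n$). The singular series is $\mathfrak{S}_F:=\prod_p \gamma(p)(1-1/p)^{-k}$, the product over all primes $p$. *)

theory Defs
  imports "HOL-Analysis.Analysis" "HOL-Computational_Algebra.Primes" "HOL-Library.Multiset"
begin

definition linear_prod :: "nat \<Rightarrow> (nat \<Rightarrow> int) \<Rightarrow> (nat \<Rightarrow> int) \<Rightarrow> int \<Rightarrow> int" where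
  "linear_prod k a b n = (\<Prod>j=1..k. a j * n + b j)"

definition discriminant :: "nat \<Rightarrow> (nat \<Rightarrow> int) \<Rightarrow> (nat \<Rightarrow> int) \<Rightarrow> int" where
  "discriminant k a b = (\<Prod>(i, j) \<in> {(i, j). 1 \<le> i \<and> i < j \<and> j \<le> k}. a i * b j - a j * b i)"

(* Z/qZ is represented by {0..<q}; for an integer polynomial F, gcd(q, F(n)) depends only on
   n modulo q. *)
definition local_density :: "(int \<Rightarrow> int) \<Rightarrow> nat \<Rightarrow> real" where
  "local_density F q = real (card {n \<in> {0..<int q}. gcd (int q) (F n) = 1}) / real q"

(* The k primes are positive and need not be distinct. *)
definition prime_product_points :: "nat \<Rightarrow> (int \<Rightarrow> int) \<Rightarrow> nat set" where
  "prime_product_points k F =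
     {n. n > 0 \<and> (\<exists>P :: int multiset. size P = k \<and> (\<forall>p \<in># P. prime p) \<and> F (int n) = prod_mset P)}"

definition singular_series :: "nat \<Rightarrow> (int \<Rightarrow> int) \<Rightarrow> real" where
  "singular_series k F =
     (\<Prod>p. if prime p then local_density F p * (1 - 1 / real p) powi (- int k) else 1)"

definition e :: "real \<Rightarrow> complex" where
  "e \<theta> = exp (2 * of_real pi * \<i> * of_real \<theta>)"

definition exp_sum :: "nat \<Rightarrow> nat \<Rightarrow> (int \<Rightarrow> int) \<Rightarrow> real \<Rightarrow> complex" where
  "exp_sum k N F \<theta> = (\<Sum>n \<in> {n \<in> prime_product_points k F. n \<le> N}. e (real n * \<theta>))"

(* Functions on R/Z are 1-periodic functions on the real line. *)
definition Lp_norm_circle :: "real \<Rightarrow> (real \<Rightarrow> complex) \<Rightarrow> real" where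
  "Lp_norm_circle p f = (LINT \<theta>:{0..1}|lborel. norm (f \<theta>) powr p) powr (1 / p)"

end

(*
  With \<omega>(p) the roots of F mod p and \<gamma>(p) = 1 - |\<omega>(p)|/p, let h_p(n) be -1 when n mod p lies in \<omega>(p) and
  g(p) = 1/\<gamma>(p) - 1 otherwise, a function of mean zero mod p. Selberg's weight is \<psi> = L^(-1) sum_q h_q with
  h_q = prod_(p | q) h_p, L = sum_q g(q), over squarefree q <= Q composed of primes in (z, D]; it equals 1 on
  integers n for which F(n) has no such prime factor. The frequencies a/m of L \<psi>^2 - 1 have m > 1, are
  Q^(-4)-separated and carry coefficients at most z^(-1/2), so that, for D and Q small powers of N, the sum of
  (L \<psi>(n)^2 - 1) e(n\<theta>) over n <= N is O(N z^(-1/2)) uniformly in \<theta>. By Bessel's inequality, if f is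
  supported on a set E of measure m and bounded by 1, the squares of its Fourier coefficients at the sifted
  integers sum to at most L^(-1) (m + O(N m^2 z^(-1/2))).

  This is applied to a level set E = {|h| >= t} with z of order (1 + N m)^2, which makes the second term harmless.
  Ignoring the primes below z costs only a factor z^\<epsilon>, hence t^2 N m <= C M^2 (1 + N m)^\<epsilon> where
  M = N prod_(p <= D) \<gamma>(p). This is a weak-type bound for every exponent q > 2, and integrating it over t
  bounds the p-th power integral by a multiple of M^p / N. Finally M is at most a multiple of
  S_F N (log N)^(-k), and n can fail to be sifted only if some |a_j n + b_j| <= D.
*)
theory Submission
  imports Defs
begin

section \<open>Elementary estimates for primes\<close>

text \<open>All constants must be uniform in \<open>F\<close>, so \<open>F\<close> enters the sieve
  only through two facts: at most \<open>k\<close> residues are removed modulo each prime, and never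
  all of them. The singular series is needed only from below, against its partial product over p
  \<le> D. This comparison is uniform because the Euler factor at p > k is at least 1 - k^2/p^2
  whether or not p divides the discriminant. The kernel bound, uniform in \<theta>, takes the place
  of a division into major and minor arcs. The obstacle is the small primes: coefficients at
  denominators made of them need not be small, and they would let the term quadratic in m swamp the
  linear one once N m is large. Tying z to the measure of the set under study repairs this, but puts
  N m on both sides of the inequality; solving for it gives a power of M / t strictly above 2, and
  this is where p > 2 enters. Tiny powers of N are affordable as D and Q, since log D is still a
  fixed multiple of log N. The integers that escape the sieve are O(D) in number, negligible against
  N^(1/2), because S_F is bounded below in terms of k alone.\<close>

lemma power_dvd_fact_mult:
  assumes "p > 0"
  shows "p ^ m dvd (fact (p * m) :: nat)"
proof -
  have False: "p \<noteq> 0" using assms by simp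
  show ?thesis
  proof (induction m)
    case (Suc m)
    have "fact (p * Suc m) = (p * Suc m) * (fact (p * Suc m - 1) :: nat)"
      using False by (subst fact_reduce) auto
    moreover have "(fact (p * m) :: nat) dvd fact (p * Suc m - 1)"
      using False by (intro fact_dvd) auto
    then have "p ^ m dvd (fact (p * Suc m - 1) :: nat)"
      using Suc.IH dvd_trans by blast
    ultimately show ?case
      by (auto intro!: mult_dvd_mono)
  qed simp
qed

text \<open>The exponent \<open>n div p\<close> keeps only the first term of Legendre's formula.
  Powers of distinct primes are coprime, so their product divides as soon as each one does.\<close>

lemma prod_prime_power_dvd_fact:
  assumes "finite P" "\<And>p. p \<in> P \<Longrightarrow> prime p"
  shows "(\<Prod>p\<in>P. p ^ (n div p)) dvd (fact n :: nat)"
  using assms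
proof (induction P rule: finite_induct)
  case (insert q P)
  have "q ^ (n div q) dvd (fact (q * (n div q)) :: nat)"
    using insert by (intro power_dvd_fact_mult) (auto simp: prime_gt_0_nat)
  moreover have "(fact (q * (n div q)) :: nat) dvd fact n"
    by (intro fact_dvd) auto
  ultimately have "q ^ (n div q) dvd (fact n :: nat)"
    using dvd_trans by blast
  moreover have "(\<Prod>p\<in>P. p ^ (n div p)) dvd (fact n :: nat)"
    using insert by auto
  moreover have "coprime (q ^ (n div q)) (\<Prod>p\<in>P. p ^ (n div p))"
    using insert by (intro prod_coprime_right coprime_power_left_iff[THEN iffD2] disjI1) (auto intro!: primes_coprime simp: coprime_power_right_iff)
  ultimately show ?case
    using insert by (auto intro: divides_mult)
qed auto

lemma finite_primes_real_le [simp]: "finite {p::nat. prime p \<and> real p \<le> x}"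
  by (rule finite_subset[of _ "{..nat \<lfloor>x\<rfloor>}"]) (auto simp: le_nat_floor)

text \<open>Chebyshev's comparison of \<open>fact n\<close> with \<open>n ^ n\<close>, after taking
  logarithms; replacing \<open>n div p\<close> by \<open>n / (2 * p)\<close>, allowed since
  \<open>p \<le> n\<close>, costs the factor 2. This upper half of Mertens' first theorem later
  controls the mean of \<open>ln (\<Prod>A)\<close> in the truncated Selberg sum.\<close>

lemma sum_ln_prime_div_le:
  assumes "x \<ge> 1"
  shows "(\<Sum>p | prime p \<and> real p \<le> x. ln (real p) / real p) \<le> 2 * ln x"
proof -
  define n where "n = nat \<lfloor>x\<rfloor>"
  have n: "n \<ge> 1" "real n \<le> x" "real n > 0"
    using assms by (auto simp: n_def le_nat_floor)
  have P: "{p. prime p \<and> real p \<le> x} = {p. prime p \<and> p \<le> n}" (is "?P = _")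
    using assms by (auto simp: n_def le_nat_iff le_floor_iff)
  have pos: "p > 0" "p \<le> n" if "p \<in> ?P" for p
    using that P by (auto simp: prime_gt_0_nat)
  have "(\<Prod>p\<in>?P. p ^ (n div p)) \<le> (fact n :: nat)"
    by (intro dvd_imp_le prod_prime_power_dvd_fact) auto
  also have "\<dots> \<le> n ^ n"
    using fact_le_power[of n, where 'a=nat] by simp
  finally have "real (\<Prod>p\<in>?P. p ^ (n div p)) \<le> real (n ^ n)"
    by (rule of_nat_mono)
  then have le: "(\<Prod>p\<in>?P. real p ^ (n div p)) \<le> real n ^ n"
    by simp
  have "(\<Sum>p\<in>?P. real (n div p) * ln (real p)) = (\<Sum>p\<in>?P. ln (real p ^ (n div p)))"
    using pos by (intro sum.cong) (auto simp: ln_realpow)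
  also have "\<dots> = ln (\<Prod>p\<in>?P. real p ^ (n div p))"
    using pos by (subst ln_prod) auto
  also have "\<dots> \<le> ln (real n ^ n)"
    using le pos n by (subst ln_le_cancel_iff) (auto intro!: prod_pos)
  finally have 1: "(\<Sum>p\<in>?P. real (n div p) * ln (real p)) \<le> real n * ln (real n)"
    using n by (simp add: ln_realpow)
  have 2: "real n / 2 * (ln (real p) / real p) \<le> real (n div p) * ln (real p)" if "p \<in> ?P" for p
  proof -
    have "n < p * (n div p) + p"
      using pos[OF that] by (metis div_mult_mod_eq mod_less_divisor mult.commute nat_add_left_cancel_less)
    moreover have "n div p \<ge> 1"
      using pos[OF that] by (simp add: Suc_leI div_greater_zero_iff)
    then have "p \<le> p * (n div p)"
      using pos[OF that] by auto
    ultimately have "n \<le> 2 * (p * (n div p))"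
      by linarith
    then have "real n \<le> real (2 * (p * (n div p)))"
      by (rule of_nat_mono)
    then have "real n / (2 * real p) \<le> real (n div p)"
      using pos[OF that] by (simp add: field_simps)
    moreover have "ln (real p) \<ge> 0"
      using pos[OF that] by auto
    ultimately have "real n / (2 * real p) * ln (real p) \<le> real (n div p) * ln (real p)"
      by (rule mult_right_mono)
    then show ?thesis by (simp add: mult_ac)
  qed
  have "real n / 2 * (\<Sum>p\<in>?P. ln (real p) / real p) \<le> real n * ln (real n)"
    unfolding sum_distrib_left using 1 2 by (meson order_trans sum_mono)
  then have "(\<Sum>p\<in>?P. ln (real p) / real p) \<le> 2 * ln (real n)"
    using n by (simp add: field_simps)
  also have "\<dots> \<le> 2 * ln x"
    using n assms by auto
  finally show ?thesis .
qed

text \<open>Above \<open>T\<close> each \<open>1 / p\<close> is at most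
  \<open>ln p / (p * ln T)\<close>, and the integers up to \<open>T\<close> are counted trivially.
  The true size is \<open>ln (ln x)\<close>, but with \<open>T\<close> free the coefficient of
  \<open>ln x\<close> can be made arbitrarily small, which is how a factor
  \<open>z powr \<epsilon>\<close> arises.\<close>

lemma sum_inverse_prime_le:
  assumes "x \<ge> 1" "T > 1"
  shows "(\<Sum>p | prime p \<and> real p \<le> x. 1 / real p) \<le> T + 2 * ln x / ln T"
proof -
  let ?P = "{p. prime p \<and> real p \<le> x}"
  have "(\<Sum>p\<in>?P. 1 / real p) \<le> (\<Sum>p\<in>?P. (if real p \<le> T then 1 / real p else 0) + ln (real p) / real p / ln T)"
  proof (intro sum_mono)
    fix p assume p: "p \<in> ?P"
    then have p2: "real p \<ge> 2" using prime_ge_2_nat by force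
    show "1 / real p \<le> (if real p \<le> T then 1 / real p else 0) + ln (real p) / real p / ln T"
    proof (cases "real p \<le> T")
      case False
      then have "ln T \<le> ln (real p)" using assms p2 by auto
      then show ?thesis using False assms p2 by (auto simp: field_simps)
    qed (use assms p2 in auto)
  qed
  also have "\<dots> = (\<Sum>p\<in>?P. if real p \<le> T then 1 / real p else 0) + (\<Sum>p\<in>?P. ln (real p) / real p) / ln T"
    by (simp add: sum.distrib sum_divide_distrib)
  also have "(\<Sum>p\<in>?P. if real p \<le> T then 1 / real p else 0) = (\<Sum>p\<in>{p\<in>?P. real p \<le> T}. 1 / real p)"
    by (subst sum.inter_filter) auto
  also have "\<dots> \<le> (\<Sum>p\<in>{1..nat \<lfloor>T\<rfloor>}. 1 / real p)"
    using prime_ge_1_nat by (intro sum_mono2) (auto simp: le_nat_floor)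
  also have "\<dots> \<le> (\<Sum>p\<in>{1..nat \<lfloor>T\<rfloor>}. 1)"
    by (intro sum_mono) auto
  also have "\<dots> \<le> T" using assms by simp
  also have "(\<Sum>p\<in>?P. ln (real p) / real p) / ln T \<le> 2 * ln x / ln T"
    using sum_ln_prime_div_le[OF assms(1)] assms(2) by (intro divide_right_mono) auto
  finally show ?thesis by simp
qed

text \<open>Induction on the set of primes. A number counted for \<open>insert q P\<close> is either
  counted for \<open>P\<close> or is \<open>q\<close> times another number counted for
  \<open>insert q P\<close>, so the new sum satisfies \<open>s' \<le> s + s' / q\<close>. Solving
  for \<open>s'\<close> produces the Euler factor without a geometric series over powers of
  \<open>q\<close>.\<close>

lemma sum_inverse_smooth_le:
  assumes "finite P" "\<And>p. p \<in> P \<Longrightarrow> prime p"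
  shows "(\<Sum>m | m \<in> {1..n} \<and> (\<forall>p. prime p \<longrightarrow> p dvd m \<longrightarrow> p \<in> P). 1 / real m)
           \<le> (\<Prod>p\<in>P. inverse (1 - 1 / real p))"
  using assms
proof (induction P rule: finite_induct)
  case empty
  have "{m. m \<in> {1..n} \<and> (\<forall>p. prime p \<longrightarrow> p dvd m \<longrightarrow> p \<in> {})} \<subseteq> {1}"
    using prime_factor_nat by auto
  then have "(\<Sum>m | m \<in> {1..n} \<and> (\<forall>p. prime p \<longrightarrow> p dvd m \<longrightarrow> p \<in> {}). 1 / real m) \<le> (\<Sum>m\<in>{1}. 1 / real m)"
    by (intro sum_mono2) auto
  then show ?case by simp
next
  case (insert q P)
  define S where "S = (\<lambda>P. {m. m \<in> {1..n} \<and> (\<forall>p. prime p \<longrightarrow> p dvd m \<longrightarrow> p \<in> P)})"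
  define s where "s P = (\<Sum>m\<in>S P. 1 / real m)" for P
  have fin: "finite (S A)" for A unfolding S_def by auto
  have q: "prime q" "real q \<ge> 2" using insert prime_ge_2_nat by force+
  have "S (insert q P) \<subseteq> S P \<union> (*) q ` S (insert q P)"
  proof
    fix m assume m: "m \<in> S (insert q P)"
    show "m \<in> S P \<union> (*) q ` S (insert q P)"
    proof (cases "q dvd m")
      case True
      then obtain m' where m': "m = q * m'" by auto
      have "m' \<in> S (insert q P)"
        using m q unfolding S_def m' by (auto simp: Suc_le_eq intro: order_trans[rotated])
      then show ?thesis using m' by auto
    next
      case False
      then have "m \<in> S P" using m unfolding S_def by auto
      then show ?thesis by auto
    qed
  qed
  then have "s (insert q P) \<le> (\<Sum>m\<in>S P \<union> (*) q ` S (insert q P). 1 / real m)"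
    unfolding s_def using fin by (intro sum_mono2) auto
  also have "\<dots> \<le> s P + (\<Sum>m\<in>(*) q ` S (insert q P). 1 / real m)"
    unfolding s_def using fin by (subst sum_Un) (auto intro!: sum_nonneg)
  also have "(\<Sum>m\<in>(*) q ` S (insert q P). 1 / real m) = (\<Sum>m\<in>S (insert q P). 1 / real (q * m))"
    using q by (subst sum.reindex) (auto intro!: inj_onI)
  also have "\<dots> = s (insert q P) / real q"
    unfolding s_def by (simp add: sum_divide_distrib mult.commute)
  finally have "s (insert q P) * (1 - 1 / real q) \<le> s P"
    by (simp add: algebra_simps)
  then have "s (insert q P) \<le> inverse (1 - 1 / real q) * s P"
    using q by (simp add: field_simps)
  also have "\<dots> \<le> inverse (1 - 1 / real q) * (\<Prod>p\<in>P. inverse (1 - 1 / real p))"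
    using insert q unfolding s_def S_def by (intro mult_left_mono) (auto simp: field_simps)
  finally show ?case
    using insert unfolding s_def S_def by simp
qed

text \<open>Every integer up to \<open>x\<close> has only prime factors up to \<open>x\<close>, so
  the harmonic sum lies below the Euler product. The \<open>k\<close>-th power of this inequality is
  the source of the logarithms in the final bound.\<close>

lemma ln_le_prod_primes:
  assumes "x \<ge> 1"
  shows "ln x \<le> (\<Prod>p | prime p \<and> real p \<le> x. inverse (1 - 1 / real p))"
proof -
  define n where "n = nat \<lfloor>x\<rfloor>"
  have "x \<le> real n + 1" unfolding n_def using assms by linarith
  then have "ln x \<le> ln (real n + 1)" using assms by auto
  also have "\<dots> \<le> harm n" by (rule harm_ge_ln)
  also have "\<dots> = (\<Sum>m\<in>{1..n}. 1 / real m)" by (simp add: harm_def field_simps)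
  also have "{1..n} = {m. m \<in> {1..n} \<and> (\<forall>p. prime p \<longrightarrow> p dvd m \<longrightarrow> p \<in> {p. prime p \<and> real p \<le> x})}"
  proof -
    have "real p \<le> x" if "m \<in> {1..n}" "p dvd m" for p m
    proof -
      have "p \<le> n" using that dvd_imp_le[of p m] by auto
      then have "real p \<le> real n" by simp
      also have "\<dots> \<le> x" unfolding n_def using assms by simp
      finally show ?thesis .
    qed
    then show ?thesis by auto
  qed
  also have "(\<Sum>m | m \<in> {1..n} \<and> (\<forall>p. prime p \<longrightarrow> p dvd m \<longrightarrow> p \<in> {p. prime p \<and> real p \<le> x}). 1 / real m)
     \<le> (\<Prod>p\<in>{p. prime p \<and> real p \<le> x}. inverse (1 - 1 / real p))"
    by (rule sum_inverse_smooth_le) auto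
  finally show ?thesis .
qed

section \<open>Selberg weights\<close>

lemma sieve_square_expansion:
  fixes g :: "nat \<Rightarrow> real"
  assumes P: "finite P" and QQ: "QQ \<subseteq> Pow P"
    and down: "\<And>A B. A \<in> QQ \<Longrightarrow> B \<subseteq> A \<Longrightarrow> B \<in> QQ"
    and g: "\<And>p. p \<in> P \<Longrightarrow> 0 \<le> g p \<and> g p \<le> 1"
  obtains W where "W {} = (\<Sum>A\<in>QQ. \<Prod>p\<in>A. g p)"
    and "\<And>m. \<bar>W m\<bar> \<le> 4 ^ card m * (\<Sum>A\<in>QQ. \<Prod>p\<in>A. g p)"
    and "\<And>h. (\<And>p. p \<in> P \<Longrightarrow> (h p)\<^sup>2 = g p + (g p - 1) * h p) \<Longrightarrow>
           (\<Sum>A\<in>QQ. \<Prod>p\<in>A. h p)\<^sup>2 =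
           (\<Sum>m | m \<subseteq> P \<and> (\<exists>A\<in>QQ. \<exists>B\<in>QQ. m \<subseteq> A \<union> B). W m * (\<Prod>p\<in>m. h p))"
proof -
  text \<open>By \<open>h\<^sup>2 = g + (g - 1) h\<close>, the product of the terms of \<open>A\<close> and \<open>B\<close> expands over the set
    \<open>F \<subseteq> A \<inter> B\<close> of primes at which \<open>(g - 1) h\<close> is chosen, giving a multiple of the term of
    \<open>m = (A - B) \<union> (B - A) \<union> F\<close>. Given \<open>m\<close>, the triple \<open>(A, B, F)\<close> is determined by
    \<open>A \<inter> m\<close>, \<open>B \<inter> m\<close> and \<open>A \<inter> B - F \<in> QQ\<close>.\<close>
  define T where "T = (SIGMA AB:QQ \<times> QQ. Pow (fst AB \<inter> snd AB))"
  define key where "key = (\<lambda>((A, B), F). (A - B) \<union> (B - A) \<union> (F :: nat set))"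
  define w where "w = (\<lambda>((A, B), F). (\<Prod>p\<in>F. g p - 1) * (\<Prod>p\<in>A \<inter> B - F. g p))"
  define G where "G A = (\<Prod>p\<in>A. g p)" for A
  define W where "W m = (\<Sum>t\<in>{t\<in>T. key t = m}. w t)" for m
  define U where "U = {m. m \<subseteq> P \<and> (\<exists>A\<in>QQ. \<exists>B\<in>QQ. m \<subseteq> A \<union> B)}"
  have finQQ: "finite QQ" using P QQ by (meson finite_Pow_iff finite_subset)
  have finA: "finite A" if "A \<in> QQ" for A using that P QQ by (auto intro: finite_subset)
  have finT: "finite T" unfolding T_def using finQQ finA by (intro finite_SigmaI) auto
  have G0: "G A \<ge> 0" if "A \<subseteq> P" for A unfolding G_def using that g by (intro prod_nonneg) auto
  have empty: "W {} = (\<Sum>A\<in>QQ. G A)"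
  proof -
    \<comment> \<open>An empty key forces \<open>A = B\<close> and \<open>F = {}\<close>, so the
      constant coefficient is the diagonal, that is the full mass.\<close>
    have "{t\<in>T. key t = {}} = (\<lambda>A. ((A, A), {})) ` QQ"
    proof (intro equalityI subsetI)
      fix t assume t: "t \<in> {t\<in>T. key t = {}}"
      obtain A B F where 1: "t = ((A, B), F)" by (metis prod.exhaust)
      have "A = B" "F = {}" "A \<in> QQ" using t unfolding 1 T_def key_def by auto
      then show "t \<in> (\<lambda>A. ((A, A), {})) ` QQ" unfolding 1 by auto
    qed (auto simp: T_def key_def)
    then have "W {} = (\<Sum>t\<in>(\<lambda>A. ((A, A), {})) ` QQ. w t)" unfolding W_def by simp
    also have "\<dots> = (\<Sum>A\<in>QQ. w ((A, A), {}))"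
      by (subst sum.reindex) (auto intro!: inj_onI)
    also have "\<dots> = (\<Sum>A\<in>QQ. G A)"
      by (simp add: w_def G_def)
    finally show ?thesis .
  qed
  have bound: "\<bar>W m\<bar> \<le> 4 ^ card m * (\<Sum>A\<in>QQ. G A)" for m
  proof (cases "m \<subseteq> P")
    case False
    have "key t \<noteq> m" if t: "t \<in> T" for t
    proof -
      obtain A B F where 1: "t = ((A, B), F)" by (metis prod.exhaust)
      have "A \<subseteq> P" "B \<subseteq> P" "F \<subseteq> P" using t QQ unfolding 1 T_def by auto
      then have "key t \<subseteq> P" unfolding 1 key_def by auto
      then show ?thesis using False by auto
    qed
    then have "{t\<in>T. key t = m} = {}" by blast
    then have "W m = 0" unfolding W_def by (simp only: sum.empty)
    then show ?thesis using G0 QQ by (auto intro!: mult_nonneg_nonneg sum_nonneg)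
  next
    case True
    have finm: "finite m" using True P finite_subset by auto
    define r where "r = (\<lambda>((A, B), F). ((A \<inter> m, B \<inter> m), A \<inter> B - (F :: nat set)))"
    define Tm where "Tm = {t\<in>T. key t = m}"
    have inj: "inj_on r Tm"
    proof (rule inj_onI)
      fix t t' assume t: "t \<in> Tm" "t' \<in> Tm" "r t = r t'"
      obtain A B F where 1: "t = ((A, B), F)" by (metis prod.exhaust)
      obtain A' B' F' where 2: "t' = ((A', B'), F')" by (metis prod.exhaust)
      have "A = (A \<inter> m) \<union> (A \<inter> B - F)" "B = (B \<inter> m) \<union> (A \<inter> B - F)" "F = A \<inter> B \<inter> m"
        using t(1) unfolding 1 Tm_def T_def key_def by auto
      moreover have "A' = (A' \<inter> m) \<union> (A' \<inter> B' - F')" "B' = (B' \<inter> m) \<union> (A' \<inter> B' - F')" "F' = A' \<inter> B' \<inter> m"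
        using t(2) unfolding 2 Tm_def T_def key_def by auto
      moreover have "A \<inter> m = A' \<inter> m" "B \<inter> m = B' \<inter> m" "A \<inter> B - F = A' \<inter> B' - F'"
        using t(3) unfolding 1 2 r_def by auto
      ultimately show "t = t'" unfolding 1 2 by metis
    qed
    have im: "r ` Tm \<subseteq> (Pow m \<times> Pow m) \<times> QQ"
    proof -
      have "A \<inter> B - F \<in> QQ" if "A \<in> QQ" for A B F
        by (rule down[OF that]) auto
      then show ?thesis unfolding Tm_def T_def r_def by auto
    qed
    have "\<bar>W m\<bar> \<le> (\<Sum>t\<in>Tm. \<bar>w t\<bar>)" unfolding W_def Tm_def by (rule sum_abs)
    also have "\<dots> \<le> (\<Sum>t\<in>Tm. G (snd (r t)))"
    proof (rule sum_mono)
      fix t assume t: "t \<in> Tm"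
      obtain A B F where 1: "t = ((A, B), F)" by (metis prod.exhaust)
      have sub: "A \<subseteq> P" "F \<subseteq> P" using t QQ unfolding 1 Tm_def T_def by auto
      have "\<bar>\<Prod>p\<in>F. g p - 1\<bar> \<le> 1"
        unfolding abs_prod using g sub by (intro prod_le_1) force
      moreover have "\<bar>G (A \<inter> B - F)\<bar> = G (A \<inter> B - F)"
        using sub by (intro abs_of_nonneg G0) auto
      ultimately show "\<bar>w t\<bar> \<le> G (snd (r t))"
        unfolding 1 w_def r_def using sub
        by (simp add: abs_mult G_def[symmetric] mult_left_le_one_le G0 le_infI1 Diff_subset subset_trans[OF Diff_subset])
    qed
    also have "\<dots> = (\<Sum>t\<in>r ` Tm. G (snd t))"
      using inj by (subst sum.reindex) auto
    also have "\<dots> \<le> (\<Sum>t\<in>(Pow m \<times> Pow m) \<times> QQ. G (snd t))"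
      using im finm finQQ QQ G0 by (intro sum_mono2) auto
    also have "\<dots> = (\<Sum>x\<in>Pow m \<times> Pow m. \<Sum>A\<in>QQ. G A)"
      by (subst sum.cartesian_product) (simp add: case_prod_unfold)
    also have "\<dots> = 4 ^ card m * (\<Sum>A\<in>QQ. G A)"
      using finm by (simp add: card_cartesian_product card_Pow power_mult_distrib[symmetric])
    finally show ?thesis .
  qed
  have expand: "(\<Sum>A\<in>QQ. \<Prod>p\<in>A. h p)\<^sup>2 = (\<Sum>m\<in>U. W m * (\<Prod>p\<in>m. h p))"
    if h: "\<And>p. p \<in> P \<Longrightarrow> (h p)\<^sup>2 = g p + (g p - 1) * h p" for h
  proof -
    have eq: "(\<Prod>p\<in>A. h p) * (\<Prod>p\<in>B. h p) = (\<Sum>F\<in>Pow (A \<inter> B). w ((A, B), F) * (\<Prod>p\<in>key ((A, B), F). h p))"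
      if "A \<in> QQ" "B \<in> QQ" for A B
    proof -
      have fin: "finite A" "finite B" using that finA by auto
      have AB: "A \<subseteq> P" "B \<subseteq> P" using that QQ by auto
      have "(\<Prod>p\<in>A. h p) = (\<Prod>p\<in>A - B. h p) * (\<Prod>p\<in>A \<inter> B. h p)"
        using fin prod.Int_Diff[of A h B] by (simp add: mult.commute)
      moreover have "(\<Prod>p\<in>B. h p) = (\<Prod>p\<in>B - A. h p) * (\<Prod>p\<in>A \<inter> B. h p)"
        using fin prod.Int_Diff[of B h A] by (simp add: mult.commute Int_commute)
      ultimately have "(\<Prod>p\<in>A. h p) * (\<Prod>p\<in>B. h p) =
          (\<Prod>p\<in>A - B. h p) * (\<Prod>p\<in>B - A. h p) * (\<Prod>p\<in>A \<inter> B. (h p)\<^sup>2)"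
        by (simp add: power2_eq_square prod.distrib)
      also have "(\<Prod>p\<in>A \<inter> B. (h p)\<^sup>2) = (\<Prod>p\<in>A \<inter> B. (g p - 1) * h p + g p)"
        using AB h by (intro prod.cong) auto
      also have "\<dots> = (\<Sum>F\<in>Pow (A \<inter> B). (\<Prod>p\<in>F. (g p - 1) * h p) * (\<Prod>p\<in>A \<inter> B - F. g p))"
        using fin by (subst prod_add) auto
      also have "(\<Prod>p\<in>A - B. h p) * (\<Prod>p\<in>B - A. h p) * \<dots> =
          (\<Sum>F\<in>Pow (A \<inter> B). w ((A, B), F) * (\<Prod>p\<in>key ((A, B), F). h p))"
        unfolding sum_distrib_left
      proof (intro sum.cong refl)
        fix F assume F: "F \<in> Pow (A \<inter> B)"
        have finF: "finite F" using F fin finite_subset[of F A] by auto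
        have "(\<Prod>p\<in>key ((A, B), F). h p) = (\<Prod>p\<in>(A - B) \<union> (B - A). h p) * (\<Prod>p\<in>F. h p)"
          unfolding key_def prod.case using fin finF F by (subst prod.union_disjoint) auto
        also have "(\<Prod>p\<in>(A - B) \<union> (B - A). h p) = (\<Prod>p\<in>A - B. h p) * (\<Prod>p\<in>B - A. h p)"
          using fin by (subst prod.union_disjoint) auto
        finally show "(\<Prod>p\<in>A - B. h p) * (\<Prod>p\<in>B - A. h p) * ((\<Prod>p\<in>F. (g p - 1) * h p) * (\<Prod>p\<in>A \<inter> B - F. g p))
            = w ((A, B), F) * (\<Prod>p\<in>key ((A, B), F). h p)"
          by (simp add: w_def prod.distrib)
      qed
      finally show ?thesis .
    qed
    have "(\<Sum>A\<in>QQ. \<Prod>p\<in>A. h p)\<^sup>2 = (\<Sum>x\<in>QQ \<times> QQ. (\<Prod>p\<in>fst x. h p) * (\<Prod>p\<in>snd x. h p))"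
      unfolding power2_eq_square sum_product sum.cartesian_product by (simp add: case_prod_unfold)
    also have "\<dots> = (\<Sum>x\<in>QQ \<times> QQ. \<Sum>F\<in>Pow (fst x \<inter> snd x). w (x, F) * (\<Prod>p\<in>key (x, F). h p))"
      by (intro sum.cong refl) (auto simp: eq)
    also have "\<dots> = (\<Sum>t\<in>T. w t * (\<Prod>p\<in>key t. h p))"
      unfolding T_def using finQQ finA by (subst sum.Sigma) (auto simp: case_prod_unfold)
    also have "\<dots> = (\<Sum>m\<in>U. \<Sum>t\<in>{t\<in>T. key t = m}. w t * (\<Prod>p\<in>key t. h p))"
    proof (rule sum.group[symmetric])
      show "finite U" unfolding U_def using P by auto
      show "key ` T \<subseteq> U" 
      proof
        fix m assume "m \<in> key ` T"
        then obtain t where t: "t \<in> T" "m = key t" by auto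
        obtain A B F where 1: "t = ((A, B), F)" by (metis prod.exhaust)
        have A: "A \<in> QQ" "B \<in> QQ" "F \<subseteq> A" using t unfolding 1 T_def by auto
        have "m \<subseteq> A \<union> B" using A unfolding t 1 key_def by auto
        then show "m \<in> U" unfolding U_def using A QQ by blast
      qed
    qed (rule finT)
    also have "\<dots> = (\<Sum>m\<in>U. W m * (\<Prod>p\<in>m. h p))"
      unfolding W_def sum_distrib_right by (intro sum.cong refl) auto
    finally show ?thesis .
  qed
  show ?thesis
    using that[of W] empty bound expand unfolding U_def G_def by blast
qed

text \<open>Markov's inequality for the measure \<open>A \<mapsto> prod g A\<close> and the function \<open>A \<mapsto> ln (\<Prod>A)\<close>.\<close>

lemma truncated_subset_sum_ge:
  fixes g :: "nat \<Rightarrow> real"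
  assumes P: "finite P" "\<And>p. p \<in> P \<Longrightarrow> p \<ge> 1" and Q: "Q > 1"
    and g: "\<And>p. p \<in> P \<Longrightarrow> 0 \<le> g p"
    and le: "(\<Sum>p\<in>P. g p / (1 + g p) * ln (real p)) \<le> ln Q / 2"
  shows "(\<Prod>p\<in>P. 1 + g p) / 2 \<le> (\<Sum>A | A \<subseteq> P \<and> real (\<Prod>A) \<le> Q. \<Prod>p\<in>A. g p)"
proof -
  define G where "G A = (\<Prod>p\<in>A. g p)" for A
  define QQ where "QQ = {A. A \<subseteq> P \<and> real (\<Prod>A) \<le> Q}"
  have G0: "G A \<ge> 0" if "A \<subseteq> P" for A unfolding G_def using that g by (intro prod_nonneg) auto
  have total: "(\<Sum>A\<in>Pow R. G A) = (\<Prod>p\<in>R. 1 + g p)" if "R \<subseteq> P" for R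
    using that P finite_subset[of R P] prod_add[of R g "\<lambda>_. 1"] by (simp add: G_def add.commute)
  \<comment> \<open>Under the product measure, of total mass \<open>\<Prod>p\<in>P. 1 + g p\<close>,
    the event \<open>p \<in> A\<close> has probability \<open>g p / (1 + g p)\<close>. Hypothesis
    \<open>le\<close> therefore says that the mean of \<open>ln (\<Prod>A)\<close> is at most half
    of \<open>ln Q\<close>, and at least half of the mass remains at products up to
    \<open>Q\<close>.\<close>
  have part: "(\<Sum>A | A \<in> Pow P \<and> p \<in> A. G A) = g p / (1 + g p) * (\<Prod>p\<in>P. 1 + g p)" if p: "p \<in> P" for p
  proof -
    have "{A. A \<in> Pow P \<and> p \<in> A} = insert p ` Pow (P - {p})"
    proof (intro equalityI subsetI)
      fix A assume "A \<in> {A. A \<in> Pow P \<and> p \<in> A}"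
      then have "A = insert p (A - {p})" "A - {p} \<in> Pow (P - {p})" by auto
      then show "A \<in> insert p ` Pow (P - {p})" by blast
    qed (use p in auto)
    moreover have inj: "inj_on (insert p) (Pow (P - {p}))"
      by (rule inj_onI) (metis Diff_insert_absorb PowD subset_Diff_insert)
    ultimately have "(\<Sum>A | A \<in> Pow P \<and> p \<in> A. G A) = (\<Sum>A\<in>Pow (P - {p}). G (insert p A))"
      using inj by (simp add: sum.reindex)
    also have "\<dots> = (\<Sum>A\<in>Pow (P - {p}). g p * G A)"
    proof (intro sum.cong refl)
      fix A assume "A \<in> Pow (P - {p})"
      then have "finite A" "p \<notin> A" using P finite_subset[of A P] by auto
      then show "G (insert p A) = g p * G A" by (simp add: G_def)
    qed
    also have "\<dots> = g p * (\<Prod>p\<in>P - {p}. 1 + g p)"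
      by (simp add: sum_distrib_left[symmetric] total)
    also have "\<dots> = g p / (1 + g p) * (\<Prod>p\<in>P. 1 + g p)"
      using prod.remove[OF P(1) p, of "\<lambda>p. 1 + g p"] g[OF p] by (simp add: field_simps add_nonneg_eq_0_iff)
    finally show ?thesis .
  qed
  have lnprod: "ln (real (\<Prod>A)) = (\<Sum>p\<in>A. ln (real p))" if "A \<subseteq> P" for A
  proof -
    have "finite A" using that P finite_subset by auto
    moreover have "real p > 0" if "p \<in> A" for p using P(2)[of p] that \<open>A \<subseteq> P\<close> by force
    ultimately have "ln (\<Prod>p\<in>A. real p) = (\<Sum>p\<in>A. ln (real p))" by (intro ln_prod) auto
    then show ?thesis by simp
  qed
  have lnn: "ln (real p) \<ge> 0" if "p \<in> P" for p using P(2)[OF that] by simp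
  have prod1: "(\<Prod>p\<in>P. 1 + g p) \<ge> 0" using g by (intro prod_nonneg) force
  have "ln Q * (\<Sum>A\<in>Pow P - QQ. G A) \<le> (\<Sum>A\<in>Pow P - QQ. (\<Sum>p\<in>A. ln (real p)) * G A)"
    unfolding sum_distrib_left
  proof (intro sum_mono mult_right_mono)
    fix A assume A: "A \<in> Pow P - QQ"
    then have "ln Q \<le> ln (real (\<Prod>A))"
      using Q unfolding QQ_def by (auto simp del: of_nat_prod)
    then show "ln Q \<le> (\<Sum>p\<in>A. ln (real p))" using A lnprod by auto
  qed (auto intro!: G0)
  also have "\<dots> \<le> (\<Sum>A\<in>Pow P. (\<Sum>p\<in>A. ln (real p)) * G A)"
    using P lnn G0 by (intro sum_mono2) (auto intro!: mult_nonneg_nonneg sum_nonneg)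
  also have "\<dots> = (\<Sum>A\<in>Pow P. \<Sum>p\<in>P. if p \<in> A then ln (real p) * G A else 0)"
  proof (intro sum.cong refl)
    fix A assume "A \<in> Pow P"
    then have A: "{p \<in> P. p \<in> A} = A" by auto
    show "(\<Sum>p\<in>A. ln (real p)) * G A = (\<Sum>p\<in>P. if p \<in> A then ln (real p) * G A else 0)"
      using P by (simp add: sum.inter_filter[symmetric] A sum_distrib_right)
  qed
  also have "\<dots> = (\<Sum>p\<in>P. \<Sum>A\<in>Pow P. if p \<in> A then ln (real p) * G A else 0)"
    by (rule sum.swap)
  also have "\<dots> = (\<Sum>p\<in>P. ln (real p) * (\<Sum>A | A \<in> Pow P \<and> p \<in> A. G A))"
    using P by (intro sum.cong refl) (simp add: sum.inter_filter[symmetric] sum_distrib_left)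
  also have "\<dots> = (\<Sum>p\<in>P. g p / (1 + g p) * ln (real p)) * (\<Prod>p\<in>P. 1 + g p)"
    unfolding sum_distrib_right by (intro sum.cong refl) (simp add: part[simplified])
  also have "\<dots> \<le> ln Q / 2 * (\<Prod>p\<in>P. 1 + g p)"
    using le prod1 by (rule mult_right_mono)
  finally have "(\<Sum>A\<in>Pow P - QQ. G A) \<le> (\<Prod>p\<in>P. 1 + g p) / 2"
    using Q by (simp add: field_simps)
  moreover have "(\<Sum>A\<in>Pow P. G A) = (\<Sum>A\<in>Pow P - QQ. G A) + (\<Sum>A\<in>QQ. G A)"
    using P by (intro sum.subset_diff) (auto simp: QQ_def)
  ultimately show ?thesis using total[of P] unfolding QQ_def G_def by simp
qed

section \<open>Exponential sums and the sieve kernel\<close>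

lemma e_add: "e (x + y) = e x * e y"
  by (simp add: e_def exp_add[symmetric] algebra_simps)

lemma e_diff: "e (x - y) = e x * e (- y)"
  using e_add[of x "- y"] by simp

lemma e_cis: "e x = cis (2 * pi * x)"
  by (simp add: e_def cis_conv_exp mult_ac)

lemma e_0 [simp]: "e 0 = 1" by (simp add: e_def)

lemma norm_e [simp]: "norm (e x) = 1" by (simp add: e_cis)

lemma cnj_e: "cnj (e x) = e (- x)" by (simp add: e_cis cis_cnj)

lemma e_of_int [simp]: "e (of_int k) = 1"
  by (simp add: e_cis cis_multiple_2pi)

lemma e_mult_nat: "e (real n * x) = e x ^ n"
  by (simp add: e_cis Complex.DeMoivre mult_ac)

lemma e_sum: "finite A \<Longrightarrow> e (\<Sum>x\<in>A. f x) = (\<Prod>x\<in>A. e (f x))"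
  by (induction A rule: finite_induct) (auto simp: e_add)

lemma continuous_on_e [continuous_intros]:
  "continuous_on A f \<Longrightarrow> continuous_on A (\<lambda>x. e (f x))"
  unfolding e_def by (intro continuous_intros)

lemma norm_e_minus_1: "norm (e x - 1) = 2 * \<bar>sin (pi * x)\<bar>"
  using dist_exp_i_1[of "2 * pi * x"] by (simp add: e_def mult_ac)

text \<open>The cubic error is at most \<open>2 * x / 3\<close> on this range. The range reaches 2
  so that \<open>pi < 4\<close> suffices to place \<open>pi * \<bar>t\<bar>\<close> in it when
  \<open>\<bar>t\<bar> \<le> 1 / 2\<close>.\<close>

lemma sin_ge_third:
  fixes x :: real
  assumes "0 \<le> x" "x \<le> 2"
  shows "x / 3 \<le> sin x"
proof -
  have "x\<^sup>2 \<le> 2\<^sup>2" using assms by (intro power_mono) auto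
  then have "x ^ 3 \<le> 4 * x" using assms mult_right_mono[of "x\<^sup>2" 4 x] by (simp add: power2_eq_square power3_eq_cube)
  moreover have "\<bar>sin x - x\<bar> \<le> x ^ 3 / 6"
    using Maclaurin_sin_bound[of x 3] assms by (simp add: eval_nat_numeral sin_coeff_def)
  ultimately show ?thesis by linarith
qed

lemma norm_sum_e_le:
  assumes "\<And>k::int. \<delta> \<le> \<bar>\<theta> - of_int k\<bar>" "\<delta> > 0"
  shows "norm (\<Sum>n\<in>{1..N}. e (real n * \<theta>)) \<le> 2 / \<delta>"
proof -
  define t where "t = \<theta> - of_int (round \<theta>)"
  have t: "\<bar>t\<bar> \<le> 1 / 2" "\<delta> \<le> \<bar>t\<bar>"
    using assms of_int_round_abs_le[of \<theta>] by (auto simp: t_def abs_minus_commute)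
  have et: "e \<theta> = e t" using e_add[of t "of_int (round \<theta>)"] by (simp add: t_def)
  have "pi * \<bar>t\<bar> / 3 \<le> sin (pi * \<bar>t\<bar>)"
    using t pi_less_4 mult_mono[of pi 4 "\<bar>t\<bar>" "1 / 2"] by (intro sin_ge_third) auto
  also have "\<dots> \<le> \<bar>sin (pi * t)\<bar>" by (cases "t \<ge> 0") auto
  finally have "\<bar>sin (pi * t)\<bar> \<ge> pi * \<bar>t\<bar> / 3" .
  then have "norm (e \<theta> - 1) \<ge> 2 * (pi * \<bar>t\<bar>) / 3" unfolding et norm_e_minus_1 by simp
  moreover have "pi * \<bar>t\<bar> \<ge> 2 * \<delta>"
    using t pi_ge_two assms by (intro mult_mono) auto
  ultimately have ge: "norm (e \<theta> - 1) \<ge> \<delta>" using assms(2) by linarith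
  have "(\<Sum>n\<in>{1..N}. e (real n * \<theta>)) * (e \<theta> - 1) = e \<theta> ^ Suc N - e \<theta>"
    unfolding e_mult_nat by (induction N) (simp_all add: algebra_simps)
  then have "norm (\<Sum>n\<in>{1..N}. e (real n * \<theta>)) * norm (e \<theta> - 1) = norm (e \<theta> ^ Suc N - e \<theta>)"
    by (metis norm_mult)
  also have "\<dots> \<le> norm (e \<theta> ^ Suc N) + norm (e \<theta>)" by (rule norm_triangle_ineq4)
  also have "\<dots> = 2" by (simp add: norm_power norm_mult)
  finally have "norm (\<Sum>n\<in>{1..N}. e (real n * \<theta>)) * norm (e \<theta> - 1) \<le> 2" .
  moreover have "norm (\<Sum>n\<in>{1..N}. e (real n * \<theta>)) * \<delta> \<le> norm (\<Sum>n\<in>{1..N}. e (real n * \<theta>)) * norm (e \<theta> - 1)"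
    using ge by (intro mult_left_mono) auto
  ultimately show ?thesis using assms(2) by (simp add: field_simps)
qed

lemma sum_e_residues:
  assumes "p > 0"
  shows "(\<Sum>a<p. e (of_int k * real a / real p)) = (if int p dvd k then of_nat p else 0)"
proof (cases "int p dvd k")
  case True
  then obtain j where j: "k = int p * j" by auto
  have "e (of_int k * real a / real p) = 1" for a
  proof -
    have "of_int k * real a / real p = of_int (j * int a)" using assms by (simp add: j)
    then show ?thesis by (simp only: e_of_int)
  qed
  then show ?thesis using True by simp
next
  case False
  define \<theta> where "\<theta> = of_int k / real p"
  have pw: "e (of_int k * real a / real p) = e \<theta> ^ a" for a
    by (simp add: e_mult_nat[symmetric] \<theta>_def mult_ac)
  have "e \<theta> \<noteq> 1"
  proof
    assume "e \<theta> = 1"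
    then have "sin (pi * \<theta>) = 0" using norm_e_minus_1[of \<theta>] by simp
    then obtain i :: int where "pi * \<theta> = of_int i * pi" by (auto simp: sin_zero_iff_int2)
    then have "\<theta> = of_int i" by simp
    then have "real_of_int k = of_int (int p * i)" using assms by (simp add: \<theta>_def field_simps)
    then have "k = int p * i" by (simp only: of_int_eq_iff)
    then show False using False by simp
  qed
  moreover have "e \<theta> ^ p = 1"
    using assms by (simp add: e_mult_nat[symmetric] \<theta>_def)
  ultimately show ?thesis using False
    by (simp add: pw geometric_sum)
qed

section \<open>Selberg's local factors, their Fourier expansion and the spacing of the
  frequencies\<close>

definition sieve_weight :: "(nat \<Rightarrow> nat set) \<Rightarrow> nat \<Rightarrow> real" where
  "sieve_weight \<omega> p = real (card (\<omega> p)) / (real p - real (card (\<omega> p)))"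

definition sieve_factor :: "(nat \<Rightarrow> nat set) \<Rightarrow> nat \<Rightarrow> nat \<Rightarrow> real" where
  "sieve_factor \<omega> n p = (if n mod p \<in> \<omega> p then - 1 else sieve_weight \<omega> p)"

text \<open>Both values of the factor are roots of \<open>(X + 1) * (X - g)\<close>; this is the
  relation that the expansion of the square asks for.\<close>

lemma sieve_factor_square:
  "(sieve_factor \<omega> n p)\<^sup>2 = sieve_weight \<omega> p + (sieve_weight \<omega> p - 1) * sieve_factor \<omega> n p"
  by (simp add: sieve_factor_def power2_eq_square algebra_simps)

text \<open>The factor is \<open>g\<close> minus \<open>1 + g\<close> times the indicator of
  \<open>\<omega> p\<close>, whose Fourier coefficients are at most
  \<open>card (\<omega> p) / p\<close>. The identity
  \<open>(1 + g) * card (\<omega> p) / p = g\<close> both bounds the coefficients and makes the one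
  at \<open>a = 0\<close> cancel the constant \<open>g\<close>, so only nontrivial characters
  occur.\<close>

lemma sieve_factor_Fourier:
  assumes \<omega>: "\<omega> p \<subseteq> {..<p}" "card (\<omega> p) < p"
  shows "\<exists>c. (\<forall>a. norm (c a) \<le> sieve_weight \<omega> p) \<and>
    (\<forall>n. complex_of_real (sieve_factor \<omega> n p) = (\<Sum>a\<in>{1..<p}. c a * e (real n * (real a / real p))))"
proof -
  define g where "g = sieve_weight \<omega> p"
  define r where "r = real (card (\<omega> p))"
  have p: "real p > 0" "p > 0" using \<omega> by auto
  have rp: "r < real p" "0 \<le> r" using \<omega> by (auto simp: r_def)
  have g: "g = r / (real p - r)" by (simp add: g_def r_def sieve_weight_def)
  have gr: "(1 + g) * r / real p = g" using rp p by (simp add: g field_simps)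
  have g0: "g \<ge> 0" using rp by (simp add: g)
  have fin: "finite (\<omega> p)" using \<omega> finite_subset by blast
  define c where "c a = - of_real ((1 + g) / real p) * (\<Sum>s\<in>\<omega> p. e (- (real s * (real a / real p))))" for a :: nat
  have "norm (c a) \<le> g" for a
  proof -
    have "norm (c a) \<le> (1 + g) / real p * (\<Sum>s\<in>\<omega> p. 1)"
      unfolding c_def norm_mult norm_minus_cancel norm_of_real using g0 p
      by (intro mult_mono order_trans[OF norm_sum]) (auto simp: abs_if intro!: sum_nonneg)
    also have "\<dots> = g" using gr by (simp add: r_def)
    finally show ?thesis .
  qed
  moreover have "complex_of_real (sieve_factor \<omega> n p) = (\<Sum>a\<in>{1..<p}. c a * e (real n * (real a / real p)))" for n
  proof -
    define b where "b = (if n mod p \<in> \<omega> p then 1 else 0 :: complex)"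
    have iff: "int p dvd int n - int s \<longleftrightarrow> n mod p = s" if "s \<in> \<omega> p" for s
    proof -
      have "s < p" using that \<omega> by auto
      have "int p dvd int n - int s \<longleftrightarrow> int n mod int p = int s mod int p"
        by (simp add: mod_eq_dvd_iff)
      also have "\<dots> \<longleftrightarrow> n mod p = s mod p" by (metis of_nat_eq_iff of_nat_mod)
      finally show ?thesis using \<open>s < p\<close> by simp
    qed
    have "(\<Sum>a<p. c a * e (real n * (real a / real p))) =
      - of_real ((1 + g) / real p) * (\<Sum>a<p. \<Sum>s\<in>\<omega> p. e (of_int (int n - int s) * real a / real p))"
      unfolding c_def sum_distrib_left sum_distrib_right
      by (intro sum.cong refl) (simp add: e_add[symmetric] algebra_simps diff_divide_distrib)
    also have "(\<Sum>a<p. \<Sum>s\<in>\<omega> p. e (of_int (int n - int s) * real a / real p)) =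
       (\<Sum>s\<in>\<omega> p. \<Sum>a<p. e (of_int (int n - int s) * real a / real p))"
      by (rule sum.swap)
    also have "\<dots> = (\<Sum>s\<in>\<omega> p. if n mod p = s then of_nat p else 0)"
      using p iff by (intro sum.cong refl) (simp only: sum_e_residues)
    also have "\<dots> = of_nat p * b"
      using fin by (simp add: b_def sum.delta)
    also have "- of_real ((1 + g) / real p) * (of_nat p * b) = - of_real (1 + g) * b"
      using p by (simp add: field_simps)
    finally have 1: "(\<Sum>a<p. c a * e (real n * (real a / real p))) = - of_real (1 + g) * b" .
    have "{..<p} = insert 0 {1..<p}" using p by auto
    then have "(\<Sum>a<p. c a * e (real n * (real a / real p))) = c 0 + (\<Sum>a\<in>{1..<p}. c a * e (real n * (real a / real p)))"
      by simp
    moreover have "c 0 = - of_real g"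
    proof -
      have "c 0 = of_real (- ((1 + g) * r / real p))" by (simp add: c_def r_def)
      then show ?thesis using gr by simp
    qed
    ultimately show ?thesis using 1
      by (simp add: sieve_factor_def g_def[symmetric] b_def split: if_splits)
  qed
  ultimately show ?thesis unfolding g_def by blast
qed

text \<open>Frequencies with squarefree denominator are kept in partial fractions, the shape in
  which a product of local expansions delivers them. Clearing denominators turns the difference into
  an integer divided by \<open>\<Prod>(A \<union> A')\<close>. At a prime \<open>q\<close> where the
  numerators differ (an absent prime counts as numerator 0) all other terms are divisible by
  \<open>q\<close> and this one is not, so the integer is nonzero. The arbitrary \<open>k\<close>
  makes this a distance modulo one.\<close>

lemma fraction_spacing:
  assumes A: "finite A" "finite A'" "\<And>p. p \<in> A \<union> A' \<Longrightarrow> prime p"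
    and a: "a \<in> PiE A (\<lambda>p. {1..<p})" "a' \<in> PiE A' (\<lambda>p. {1..<p})"
    and ne: "(A, a) \<noteq> (A', a')"
  shows "1 / (real (\<Prod>A) * real (\<Prod>A')) \<le> \<bar>(\<Sum>p\<in>A. real (a p) / real p) - (\<Sum>p\<in>A'. real (a' p) / real p) - of_int k\<bar>"
proof -
  define U where "U = A \<union> A'"
  have finU: "finite U" using A by (simp add: U_def)
  define b where "b p = (if p \<in> A then int (a p) else 0) - (if p \<in> A' then int (a' p) else 0)" for p
  have pos: "p > 0" if "p \<in> U" for p using A that by (auto simp: U_def prime_gt_0_nat)
  have "\<exists>q\<in>U. b q \<noteq> 0"
  proof (rule ccontr)
    assume "\<not> (\<exists>q\<in>U. b q \<noteq> 0)"
    then have z: "b q = 0" if "q \<in> U" for q using that by auto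
    have "A = A'"
    proof (rule ccontr)
      assume "A \<noteq> A'"
      then obtain q where q: "q \<in> U" "q \<in> A \<longleftrightarrow> q \<notin> A'" by (auto simp: U_def)
      have "q \<in> A \<Longrightarrow> a q \<ge> 1" "q \<in> A' \<Longrightarrow> a' q \<ge> 1" using a by (auto simp: PiE_iff)
      then show False using z[OF q(1)] q by (cases "q \<in> A") (auto simp: b_def)
    qed
    moreover have "a = a'"
    proof
      fix q show "a q = a' q"
      proof (cases "q \<in> A")
        case True
        then show ?thesis using z[of q] \<open>A = A'\<close> by (auto simp: b_def U_def)
      next
        case False
        then show ?thesis using PiE_arb[OF a(1)] PiE_arb[OF a(2)] \<open>A = A'\<close> by metis
      qed
    qed
    ultimately show False using ne by simp
  qed
  then obtain q where q: "q \<in> U" "b q \<noteq> 0" by auto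
  have pq: "prime q" using q A by (auto simp: U_def)
  have bq: "\<bar>b q\<bar> < int q"
  proof -
    have "q \<in> A \<Longrightarrow> a q < q" "q \<in> A' \<Longrightarrow> a' q < q" using a by (auto simp: PiE_iff)
    then show ?thesis using pos[OF q(1)] by (auto simp: b_def)
  qed
  define M where "M = \<Prod>U"
  have M: "M > 0" unfolding M_def using pos by (intro prod_pos) auto
  define J where "J = (\<Sum>p\<in>U. int (\<Prod>(U - {p})) * b p) - int M * k"
  define X where "X = (\<Sum>p\<in>A. real (a p) / real p) - (\<Sum>p\<in>A'. real (a' p) / real p) - of_int k"
  have rem: "M = p * \<Prod>(U - {p})" if "p \<in> U" for p
    unfolding M_def using finU that by (rule prod.remove)
  have "X = (\<Sum>p\<in>U. of_int (b p) / real p) - of_int k"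
  proof -
    have "(\<Sum>p\<in>A. real (a p) / real p) = (\<Sum>p\<in>U. if p \<in> A then real (a p) / real p else 0)"
      using finU by (simp add: sum.inter_restrict[symmetric] U_def Int_absorb1)
    moreover have "(\<Sum>p\<in>A'. real (a' p) / real p) = (\<Sum>p\<in>U. if p \<in> A' then real (a' p) / real p else 0)"
      using finU by (simp add: sum.inter_restrict[symmetric] U_def Int_absorb1)
    ultimately show ?thesis unfolding X_def
      by (auto simp: sum_subtractf[symmetric] b_def diff_divide_distrib intro!: sum.cong)
  qed
  then have "real M * X = (\<Sum>p\<in>U. real M * (of_int (b p) / real p)) - real M * of_int k"
    by (simp only: right_diff_distrib sum_distrib_left)
  also have "(\<Sum>p\<in>U. real M * (of_int (b p) / real p)) = (\<Sum>p\<in>U. of_int (int (\<Prod>(U - {p})) * b p))"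
  proof (intro sum.cong refl)
    fix p assume p: "p \<in> U"
    have "real M = real p * real (\<Prod>(U - {p}))" using rem[OF p] by (metis of_nat_mult)
    then show "real M * (of_int (b p) / real p) = of_int (int (\<Prod>(U - {p})) * b p)"
      using pos[OF p] by simp
  qed
  finally have MX: "real M * X = of_int J" by (simp add: J_def)
  have "J \<noteq> 0"
  proof
    assume "J = 0"
    have "int q dvd int (\<Prod>(U - {p})) * b p" if "p \<in> U - {q}" for p
    proof -
      have "q dvd \<Prod>(U - {p})" using finU q that by (intro dvd_prodI) auto
      then show ?thesis by (meson dvd_mult2 int_dvd_int_iff)
    qed
    then have "int q dvd (\<Sum>p\<in>U - {q}. int (\<Prod>(U - {p})) * b p)" by (rule dvd_sum)
    moreover have "int q dvd int M * k" using rem[OF q(1)] by simp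
    moreover have "int (\<Prod>(U - {q})) * b q = int M * k - (\<Sum>p\<in>U - {q}. int (\<Prod>(U - {p})) * b p)"
      using \<open>J = 0\<close> sum.remove[OF finU q(1), of "\<lambda>p. int (\<Prod>(U - {p})) * b p"] by (simp add: J_def)
    ultimately have "int q dvd int (\<Prod>(U - {q})) * b q" by (simp del: of_nat_prod)
    then have "int q dvd int (\<Prod>(U - {q})) \<or> int q dvd b q"
      using pq by (subst prime_dvd_mult_iff[symmetric]) auto
    moreover have "\<not> q dvd \<Prod>(U - {q})"
    proof
      assume "q dvd \<Prod>(U - {q})"
      then obtain p where "p \<in> U - {q}" "q dvd p"
        using pq finU by (auto simp: prime_dvd_prod_iff)
      moreover from this have "prime p" using A by (auto simp: U_def)
      ultimately show False using pq primes_dvd_imp_eq[of q p] by auto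
    qed
    ultimately have "int q dvd b q" by (metis int_dvd_int_iff)
    then show False using bq q dvd_imp_le_int[of "b q" "int q"] by auto
  qed
  then have "\<bar>of_int J :: real\<bar> \<ge> 1" by linarith
  then have "real M * \<bar>X\<bar> \<ge> 1" unfolding MX[symmetric] by (simp add: abs_mult)
  then have 1: "1 / real M \<le> \<bar>X\<bar>" using M by (simp add: field_simps)
  have "M \<le> \<Prod>A * \<Prod>A'"
  proof -
    have "\<Prod>A * \<Prod>A' = M * \<Prod>(A \<inter> A')" unfolding M_def U_def using A by (intro prod.union_inter[symmetric])
    moreover have "\<Prod>(A \<inter> A') > 0" using A by (intro prod_pos) (auto simp: prime_gt_0_nat)
    ultimately show ?thesis by simp
  qed
  then have "real M \<le> real (\<Prod>A) * real (\<Prod>A')" by (metis of_nat_le_iff of_nat_mult)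
  then have "1 / (real (\<Prod>A) * real (\<Prod>A')) \<le> 1 / real M" using M by (intro frac_le) auto
  then show ?thesis using 1 unfolding X_def by linarith
qed

text \<open>A set \<open>A\<close> of primes stands for the squarefree number
  \<open>\<Prod>A\<close>. The weight is left unnormalised: its square divided by
  \<open>sieve_mass\<close> has constant Fourier coefficient 1 and equals \<open>sieve_mass\<close>
  on sifted integers.\<close>

definition sieve_sum :: "(nat \<Rightarrow> nat set) \<Rightarrow> nat set \<Rightarrow> real \<Rightarrow> nat \<Rightarrow> real" where
  "sieve_sum \<omega> P Q n = (\<Sum>A | A \<subseteq> P \<and> real (\<Prod>A) \<le> Q. \<Prod>p\<in>A. sieve_factor \<omega> n p)"

definition sieve_mass :: "(nat \<Rightarrow> nat set) \<Rightarrow> nat set \<Rightarrow> real \<Rightarrow> real" where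
  "sieve_mass \<omega> P Q = (\<Sum>A | A \<subseteq> P \<and> real (\<Prod>A) \<le> Q. \<Prod>p\<in>A. sieve_weight \<omega> p)"

lemma sieve_sum_eq_mass:
  assumes "\<And>p. p \<in> P \<Longrightarrow> n mod p \<notin> \<omega> p"
  shows "sieve_sum \<omega> P Q n = sieve_mass \<omega> P Q"
  unfolding sieve_sum_def sieve_mass_def
  by (intro sum.cong prod.cong) (use assms in \<open>auto simp: sieve_factor_def\<close>)

lemma sieve_mass_ge_1:
  assumes "finite P" "Q \<ge> 1" "\<And>p. p \<in> P \<Longrightarrow> sieve_weight \<omega> p \<ge> 0"
  shows "sieve_mass \<omega> P Q \<ge> 1"
proof -
  have "1 = (\<Sum>A\<in>{{}}. \<Prod>p\<in>A. sieve_weight \<omega> p)" by simp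
  also have "\<dots> \<le> sieve_mass \<omega> P Q"
    unfolding sieve_mass_def using assms by (intro sum_mono2) (auto intro!: prod_nonneg)
  finally show ?thesis .
qed

text \<open>A count of frequencies. At most one of them lies within \<open>1 / (2 * Q ^ 4)\<close>
  of \<open>- \<theta>\<close> modulo one, and only it can contribute as much as \<open>N\<close>.
  Each of the others gives a geometric sum of at most \<open>4 * Q ^ 4\<close>, and there are at
  most \<open>Q ^ 4\<close> frequencies in all. Every coefficient is at most
  \<open>s\<close>.\<close>

lemma sieve_kernel_bound:
  assumes P: "finite P" "\<And>p. p \<in> P \<Longrightarrow> prime p"
    and \<omega>: "\<And>p. p \<in> P \<Longrightarrow> \<omega> p \<subseteq> {..<p} \<and> card (\<omega> p) < p"
    and s: "\<And>p. p \<in> P \<Longrightarrow> 4 * sieve_weight \<omega> p \<le> s" "0 \<le> s" "s \<le> 1"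
    and Q: "Q \<ge> 1"
  shows "norm (\<Sum>n\<in>{1..N}. complex_of_real ((sieve_sum \<omega> P Q n)\<^sup>2 / sieve_mass \<omega> P Q - 1) * e (real n * \<theta>))
           \<le> s * (real N + 4 * Q ^ 8)"
proof -
  define g where "g = sieve_weight \<omega>"
  define QQ where "QQ = {A. A \<subseteq> P \<and> real (\<Prod>A) \<le> Q}"
  define L where "L = sieve_mass \<omega> P Q"
  have pos: "p > 0" if "p \<in> P" for p using P(2)[OF that] by (rule prime_gt_0_nat)
  have prodpos: "\<Prod>A > 0" if "A \<subseteq> P" for A using that pos by (intro prod_pos) auto
  have g: "0 \<le> g p \<and> g p \<le> 1" if "p \<in> P" for p
  proof -
    have "4 * g p \<le> 1" using s(1)[OF that] s(3) by (simp add: g_def)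
    moreover have "0 \<le> g p" using \<omega>[OF that] by (auto simp: g_def sieve_weight_def)
    ultimately show ?thesis by linarith
  qed
  have L: "L \<ge> 1" unfolding L_def using P Q g by (intro sieve_mass_ge_1) (auto simp: g_def)
  have down: "B \<in> QQ" if "A \<in> QQ" "B \<subseteq> A" for A B
  proof -
    have "finite A" using that P finite_subset by (auto simp: QQ_def)
    then have "\<Prod>B \<le> \<Prod>A"
      using that prodpos[of A] by (intro dvd_imp_le prod_dvd_prod_subset) (auto simp: QQ_def)
    then have "real (\<Prod>B) \<le> real (\<Prod>A)" by (rule of_nat_mono)
    then show ?thesis using that unfolding QQ_def by auto
  qed
  define U where "U = {m. m \<subseteq> P \<and> (\<exists>A\<in>QQ. \<exists>B\<in>QQ. m \<subseteq> A \<union> B)}"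
  \<comment> \<open>The coefficients are fixed before \<open>h\<close>, so one family
    \<open>W\<close> serves the sieve factors of every \<open>n\<close>.\<close>
  obtain W where W: "W {} = L" "\<And>m. \<bar>W m\<bar> \<le> 4 ^ card m * L"
    "\<And>h. (\<And>p. p \<in> P \<Longrightarrow> (h p)\<^sup>2 = g p + (g p - 1) * h p) \<Longrightarrow>
       (\<Sum>A\<in>QQ. \<Prod>p\<in>A. h p)\<^sup>2 = (\<Sum>m\<in>U. W m * (\<Prod>p\<in>m. h p))"
    using sieve_square_expansion[OF P(1), of QQ g] down g
    unfolding QQ_def L_def sieve_mass_def U_def g_def by blast
  define Ok where "Ok p c \<longleftrightarrow> (\<forall>a. norm (c a) \<le> g p) \<and>
    (\<forall>n. complex_of_real (sieve_factor \<omega> n p) = (\<Sum>a\<in>{1..<p}. c a * e (real n * (real a / real p))))" for p c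
  have "\<forall>p\<in>P. \<exists>c. Ok p c"
    using sieve_factor_Fourier \<omega> unfolding g_def Ok_def by blast
  then obtain c where c': "\<And>p. p \<in> P \<Longrightarrow> Ok p (c p)" by metis
  have c: "norm (c p a) \<le> g p"
    "complex_of_real (sieve_factor \<omega> n p) = (\<Sum>a\<in>{1..<p}. c p a * e (real n * (real a / real p)))"
    if "p \<in> P" for p a n
    using c'[OF that] unfolding Ok_def by blast+
  have finU: "finite U" using P by (auto simp: U_def)
  define U' where "U' = U - {{}}"
  have fin: "finite m" "m \<subseteq> P" if "m \<in> U'" for m
    using that P finite_subset by (auto simp: U'_def U_def)
  have prodU: "real (\<Prod>m) \<le> Q\<^sup>2" if mU: "m \<in> U" for m
  proof -
    obtain A B where AB: "A \<in> QQ" "B \<in> QQ" "m \<subseteq> A \<union> B" "m \<subseteq> P" using mU unfolding U_def by blast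
    have finAB: "finite A" "finite B" using AB P finite_subset by (auto simp: QQ_def)
    have "\<Prod>m \<le> \<Prod>(A \<union> B)"
      using AB finAB prodpos[of "A \<union> B"] by (intro dvd_imp_le prod_dvd_prod_subset) (auto simp: QQ_def)
    also have "\<dots> \<le> \<Prod>(A \<union> B) * \<Prod>(A \<inter> B)"
    proof -
      have "A \<inter> B \<subseteq> P" using AB by (auto simp: QQ_def)
      then have "\<Prod>(A \<inter> B) > 0" by (rule prodpos)
      then show ?thesis by simp
    qed
    also have "\<dots> = \<Prod>A * \<Prod>B" using finAB by (rule prod.union_inter)
    finally have "real (\<Prod>m) \<le> real (\<Prod>A) * real (\<Prod>B)" by (metis of_nat_le_iff of_nat_mult)
    also have "\<dots> \<le> Q * Q" using AB Q unfolding QQ_def by (intro mult_mono) (auto simp del: of_nat_prod)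
    finally show ?thesis by (simp add: power2_eq_square)
  qed
  define I where "I = (SIGMA m:U'. PiE m (\<lambda>p. {1..<p}))"
  define x where "x i = (\<Sum>p\<in>fst i. real (snd i p) / real p)" for i :: "nat set \<times> (nat \<Rightarrow> nat)"
  define coef where "coef i = complex_of_real (W (fst i) / L) * (\<Prod>p\<in>fst i. c p (snd i p))" for i
  have finI: "finite I" unfolding I_def using finU fin by (intro finite_SigmaI finite_PiE) (auto simp: U'_def)
  have expand: "complex_of_real ((sieve_sum \<omega> P Q n)\<^sup>2 / L - 1) = (\<Sum>i\<in>I. coef i * e (real n * x i))" for n
  proof -
    have "{} \<in> QQ" unfolding QQ_def using Q by auto
    then have "{} \<in> U" unfolding U_def by blast
    have "(sieve_sum \<omega> P Q n)\<^sup>2 = (\<Sum>m\<in>U. W m * (\<Prod>p\<in>m. sieve_factor \<omega> n p))"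
      unfolding sieve_sum_def QQ_def[symmetric] by (intro W(3)) (simp add: sieve_factor_square g_def)
    also have "\<dots> = L + (\<Sum>m\<in>U'. W m * (\<Prod>p\<in>m. sieve_factor \<omega> n p))"
      using sum.remove[OF finU \<open>{} \<in> U\<close>, of "\<lambda>m. W m * (\<Prod>p\<in>m. sieve_factor \<omega> n p)"] W(1) by (simp add: U'_def)
    finally have "(sieve_sum \<omega> P Q n)\<^sup>2 / L - 1 = (\<Sum>m\<in>U'. W m / L * (\<Prod>p\<in>m. sieve_factor \<omega> n p))"
      using L by (simp add: field_simps sum_divide_distrib)
    then have "complex_of_real ((sieve_sum \<omega> P Q n)\<^sup>2 / L - 1) =
        (\<Sum>m\<in>U'. complex_of_real (W m / L) * (\<Prod>p\<in>m. complex_of_real (sieve_factor \<omega> n p)))"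
      by (simp only: of_real_sum of_real_mult of_real_prod)
    also have "\<dots> = (\<Sum>m\<in>U'. \<Sum>a\<in>PiE m (\<lambda>p. {1..<p}). coef (m, a) * e (real n * x (m, a)))"
    proof (intro sum.cong refl)
      fix m assume m: "m \<in> U'"
      have "(\<Prod>p\<in>m. complex_of_real (sieve_factor \<omega> n p)) =
          (\<Prod>p\<in>m. \<Sum>a\<in>{1..<p}. c p a * e (real n * (real a / real p)))"
        using fin[OF m] c(2) by (intro prod.cong) auto
      also have "\<dots> = (\<Sum>a\<in>PiE m (\<lambda>p. {1..<p}). \<Prod>p\<in>m. c p (a p) * e (real n * (real (a p) / real p)))"
        using fin[OF m] by (subst prod_sum_PiE) auto
      also have "\<dots> = (\<Sum>a\<in>PiE m (\<lambda>p. {1..<p}). (\<Prod>p\<in>m. c p (a p)) * e (real n * x (m, a)))"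
        using fin[OF m] by (intro sum.cong refl) (simp add: prod.distrib x_def sum_distrib_left e_sum)
      finally show "complex_of_real (W m / L) * (\<Prod>p\<in>m. complex_of_real (sieve_factor \<omega> n p)) =
          (\<Sum>a\<in>PiE m (\<lambda>p. {1..<p}). coef (m, a) * e (real n * x (m, a)))"
        by (simp add: coef_def sum_distrib_left mult_ac)
    qed
    also have "\<dots> = (\<Sum>i\<in>I. coef i * e (real n * x i))"
      unfolding I_def using finU fin by (subst sum.Sigma) (auto simp: U'_def case_prod_unfold intro!: finite_PiE)
    finally show ?thesis .
  qed
  \<comment> \<open>The factor \<open>4 ^ card m\<close> is spread over the primes of
    \<open>m\<close>. Since \<open>m\<close> is nonempty, one \<open>4 * g q\<close> supplies
    \<open>s\<close>, and the remaining ones are at most 1 because \<open>s \<le> 1\<close>.\<close>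
  have coef: "norm (coef i) \<le> s" if i: "i \<in> I" for i
  proof -
    obtain m a where 1: "i = (m, a)" "m \<in> U'" using i by (auto simp: I_def)
    then obtain q where q: "q \<in> m" by (auto simp: U'_def)
    have "norm (coef i) = \<bar>W m\<bar> / L * (\<Prod>p\<in>m. norm (c p (a p)))"
      using L unfolding 1 coef_def by (simp add: norm_mult norm_divide prod_norm)
    also have "\<dots> \<le> 4 ^ card m * (\<Prod>p\<in>m. g p)"
      using W(2)[of m] L c(1) fin[OF 1(2)] by (intro mult_mono prod_mono) (auto simp: field_simps intro!: prod_nonneg)
    also have "\<dots> = (\<Prod>p\<in>m. 4 * g p)" by (simp add: prod.distrib)
    also have "\<dots> = 4 * g q * (\<Prod>p\<in>m - {q}. 4 * g p)" using fin[OF 1(2)] q by (intro prod.remove) auto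
    also have "\<dots> \<le> s * 1"
    proof (rule mult_mono)
      have g4: "0 \<le> 4 * g p \<and> 4 * g p \<le> 1" if "p \<in> m - {q}" for p
      proof -
        have "p \<in> P" using that fin[OF 1(2)] by auto
        then show ?thesis using g s(1) s(3) unfolding g_def by force
      qed
      show "(\<Prod>p\<in>m - {q}. 4 * g p) \<le> 1" using g4 by (intro prod_le_1)
      show "0 \<le> (\<Prod>p\<in>m - {q}. 4 * g p)" using g4 by (intro prod_nonneg) auto
      show "4 * g q \<le> s" unfolding g_def using fin[OF 1(2)] q by (intro s) auto
    qed (rule s)
    finally show ?thesis by simp
  qed
  define near where "near i \<longleftrightarrow> (\<exists>k::int. \<bar>x i + \<theta> - of_int k\<bar> < 1 / (2 * Q ^ 4))" for i
  have near: "i = j" if i: "i \<in> I" "near i" and j: "j \<in> I" "near j" for i j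
  proof (rule ccontr)
    assume ne: "i \<noteq> j"
    obtain k l :: int where kl: "\<bar>x i + \<theta> - of_int k\<bar> < 1 / (2 * Q ^ 4)" "\<bar>x j + \<theta> - of_int l\<bar> < 1 / (2 * Q ^ 4)"
      using i j by (auto simp: near_def)
    have U: "fst i \<in> U'" "fst j \<in> U'" using i j by (auto simp: I_def)
    have "1 / (real (\<Prod>(fst i)) * real (\<Prod>(fst j))) \<le>
       \<bar>(\<Sum>p\<in>fst i. real (snd i p) / real p) - (\<Sum>p\<in>fst j. real (snd j p) / real p) - of_int (k - l)\<bar>"
    proof (rule fraction_spacing)
      show "snd i \<in> PiE (fst i) (\<lambda>p. {1..<p})" "snd j \<in> PiE (fst j) (\<lambda>p. {1..<p})"
        using i j unfolding I_def by auto
      show "(fst i, snd i) \<noteq> (fst j, snd j)" using ne by simp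
      show "prime p" if "p \<in> fst i \<union> fst j" for p
        using that fin[OF U(1)] fin[OF U(2)] P(2) by blast
    qed (use fin[OF U(1)] fin[OF U(2)] in auto)
    also have "\<dots> = \<bar>(x i + \<theta> - of_int k) - (x j + \<theta> - of_int l)\<bar>" by (simp add: x_def)
    also have "\<dots> < 1 / (2 * Q ^ 4) + 1 / (2 * Q ^ 4)" using kl by linarith
    also have "\<dots> = 1 / (Q\<^sup>2 * Q\<^sup>2)" using Q by (simp add: field_simps)
    also have "\<dots> \<le> 1 / (real (\<Prod>(fst i)) * real (\<Prod>(fst j)))"
    proof -
      have "0 < real (\<Prod>(fst i))" "0 < real (\<Prod>(fst j))"
        using prodpos[OF fin(2)[OF U(1)]] prodpos[OF fin(2)[OF U(2)]] by (simp_all only: of_nat_0_less_iff)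
      moreover have "real (\<Prod>(fst i)) \<le> Q\<^sup>2" "real (\<Prod>(fst j)) \<le> Q\<^sup>2"
        using U by (auto simp: U'_def intro!: prodU simp del: of_nat_prod)
      ultimately show ?thesis by (intro frac_le mult_mono mult_pos_pos) (auto simp del: of_nat_prod)
    qed
    finally show False by simp
  qed
  define E where "E i = (\<Sum>n\<in>{1..N}. e (real n * (x i + \<theta>)))" for i
  have E: "norm (E i) \<le> (if near i then real N else 0) + 4 * Q ^ 4" for i
  proof (cases "near i")
    case True
    have "norm (E i) \<le> (\<Sum>n\<in>{1..N}. 1)" unfolding E_def by (intro order_trans[OF norm_sum] sum_mono) auto
    then show ?thesis using True Q by (simp add: add_increasing2)
  next
    case False
    then have "norm (E i) \<le> 2 / (1 / (2 * Q ^ 4))"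
      unfolding E_def near_def using Q by (intro norm_sum_e_le) (auto simp: not_less)
    then show ?thesis using False by simp
  qed
  \<comment> \<open>Distinct sets of primes have distinct products, all at most
    \<open>Q\<^sup>2\<close>, and each \<open>m\<close> carries at most \<open>\<Prod>m\<close>
    frequencies.\<close>
  have cardI: "real (card I) \<le> Q ^ 4"
  proof -
    have inj: "inj_on Prod U'"
    proof (rule inj_onI)
      fix m m' assume m: "m \<in> U'" "m' \<in> U'" "\<Prod>m = \<Prod>m'"
      have mem: "q \<in> m \<longleftrightarrow> q dvd \<Prod>m" if mq: "m \<in> U'" "q \<in> P" for q m
      proof
        assume "q dvd \<Prod>m"
        then obtain p where "p \<in> m" "q dvd p"
          using fin[OF mq(1)] P(2)[OF mq(2)] by (auto simp: prime_dvd_prod_iff)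
        then show "q \<in> m" using primes_dvd_imp_eq[of q p] P(2) fin[OF mq(1)] mq(2) by auto
      qed (use fin[OF mq(1)] in auto)
      show "m = m'" using mem[OF m(1)] mem[OF m(2)] m(3) fin(2)[OF m(1)] fin(2)[OF m(2)] by auto
    qed
    have "Prod ` U' \<subseteq> {1..nat \<lfloor>Q\<^sup>2\<rfloor>}"
    proof
      fix t assume "t \<in> Prod ` U'"
      then obtain m where m: "m \<in> U'" "t = \<Prod>m" by auto
      have "t > 0" unfolding m(2) by (rule prodpos[OF fin(2)[OF m(1)]])
      moreover have "real t \<le> Q\<^sup>2" unfolding m(2) using m(1) by (intro prodU) (auto simp: U'_def)
      ultimately show "t \<in> {1..nat \<lfloor>Q\<^sup>2\<rfloor>}" by (simp add: le_nat_floor Suc_le_eq)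
    qed
    then have "card (Prod ` U') \<le> card {1..nat \<lfloor>Q\<^sup>2\<rfloor>}" by (intro card_mono) auto
    then have "card U' \<le> nat \<lfloor>Q\<^sup>2\<rfloor>" using inj by (simp add: card_image)
    then have cU: "real (card U') \<le> Q\<^sup>2" by (simp add: le_nat_iff le_floor_iff)
    have "card I = (\<Sum>m\<in>U'. card (PiE m (\<lambda>p. {1..<p})))"
      unfolding I_def using finU fin by (intro card_SigmaI) (auto simp: U'_def intro!: finite_PiE)
    also have "\<dots> = (\<Sum>m\<in>U'. \<Prod>p\<in>m. p - 1)"
      using fin by (intro sum.cong refl) (simp add: card_PiE)
    also have "\<dots> \<le> (\<Sum>m\<in>U'. \<Prod>m)" by (intro sum_mono prod_mono) auto
    finally have "real (card I) \<le> (\<Sum>m\<in>U'. real (\<Prod>m))" by (metis of_nat_le_iff of_nat_sum)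
    also have "\<dots> \<le> (\<Sum>m\<in>U'. Q\<^sup>2)" using prodU by (intro sum_mono) (auto simp: U'_def simp del: of_nat_prod)
    also have "\<dots> \<le> Q\<^sup>2 * Q\<^sup>2" using mult_right_mono[OF cU, of "Q\<^sup>2"] by simp
    finally show ?thesis by simp
  qed
  have "(\<Sum>n\<in>{1..N}. complex_of_real ((sieve_sum \<omega> P Q n)\<^sup>2 / L - 1) * e (real n * \<theta>)) =
      (\<Sum>n\<in>{1..N}. \<Sum>i\<in>I. coef i * e (real n * (x i + \<theta>)))"
    unfolding expand by (intro sum.cong refl) (simp add: sum_distrib_left distrib_left e_add mult_ac)
  also have "\<dots> = (\<Sum>i\<in>I. coef i * E i)"
    unfolding E_def by (subst sum.swap) (simp add: sum_distrib_left)
  finally have "norm (\<Sum>n\<in>{1..N}. complex_of_real ((sieve_sum \<omega> P Q n)\<^sup>2 / L - 1) * e (real n * \<theta>)) = norm (\<Sum>i\<in>I. coef i * E i)"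
    by simp
  also have "\<dots> \<le> (\<Sum>i\<in>I. s * ((if near i then real N else 0) + 4 * Q ^ 4))"
  proof (intro order_trans[OF norm_sum] sum_mono)
    fix i assume "i \<in> I"
    then show "norm (coef i * E i) \<le> s * ((if near i then real N else 0) + 4 * Q ^ 4)"
      unfolding norm_mult using s by (intro mult_mono coef E) auto
  qed
  also have "\<dots> = s * ((\<Sum>i\<in>I. if near i then real N else 0) + real (card I) * (4 * Q ^ 4))"
    by (simp add: sum_distrib_left[symmetric] sum.distrib)
  also have "(\<Sum>i\<in>I. if near i then real N else 0) = real (card {i\<in>I. near i}) * real N"
    using finI by (subst sum.inter_filter[symmetric]) auto
  also have "s * (real (card {i\<in>I. near i}) * real N + real (card I) * (4 * Q ^ 4)) \<le> s * (1 * real N + Q ^ 4 * (4 * Q ^ 4))"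
  proof -
    have "card {i\<in>I. near i} \<le> 1" using near finI by (subst card_le_Suc0_iff_eq[unfolded One_nat_def[symmetric]]) auto
    then show ?thesis using s(2) cardI Q by (intro mult_left_mono add_mono mult_right_mono) auto
  qed
  also have "\<dots> = s * (real N + 4 * Q ^ 8)" by simp
  finally show ?thesis by (simp only: L_def)
qed

section \<open>Level sets\<close>

definition unit_measure :: "real measure" where
  "unit_measure = restrict_space lborel {0..1}"

lemma space_unit_measure [simp]: "space unit_measure = {0..1}"
  by (simp add: unit_measure_def space_restrict_space)

lemma finite_measure_unit: "finite_measure unit_measure"
  by (rule finite_measureI) (simp add: unit_measure_def space_restrict_space emeasure_restrict_space)

lemma measure_unit_space: "measure unit_measure {0..1} = 1"
  by (simp add: unit_measure_def measure_restrict_space)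

lemma borel_measurable_unit: "f \<in> borel_measurable borel \<Longrightarrow> f \<in> borel_measurable unit_measure"
  unfolding unit_measure_def by (intro measurable_restrict_space1) simp

lemma continuous_borel_measurable_unit:
  "continuous_on UNIV f \<Longrightarrow> f \<in> borel_measurable unit_measure"
  by (intro borel_measurable_unit borel_measurable_continuous_onI)

lemma e_measurable_unit [measurable]: "(\<lambda>\<theta>. e (c * \<theta> + d)) \<in> borel_measurable unit_measure"
  by (intro continuous_borel_measurable_unit continuous_intros)

lemma integrable_unit_bounded:
  fixes f :: "real \<Rightarrow> 'a::{banach, second_countable_topology}"
  assumes "f \<in> borel_measurable unit_measure" "\<And>\<theta>. norm (f \<theta>) \<le> B"
  shows "integrable unit_measure f"
  using assms by (intro finite_measure.integrable_const_bound[OF finite_measure_unit, of _ B]) auto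

lemma cnj_measurable [measurable]:
  "f \<in> borel_measurable M \<Longrightarrow> (\<lambda>x. cnj (f x)) \<in> borel_measurable M"
  by (rule borel_measurable_continuous_on[of cnj]) (intro continuous_intros)

lemma integral_e_unit: "(LINT \<theta>|unit_measure. e (of_int k * \<theta>)) = (if k = 0 then 1 else 0)"
proof (cases "k = 0")
  case True
  then show ?thesis by (simp add: measure_unit_space)
next
  case False
  define F where "F \<theta> = e (of_int k * \<theta>) / (2 * of_real pi * \<i> * of_int k)" for \<theta>
  have "(F has_vector_derivative e (of_int k * \<theta>)) (at \<theta> within {0..1})" for \<theta>
  proof -
    have "((\<lambda>z. exp (2 * of_real pi * \<i> * of_int k * z) / (2 * of_real pi * \<i> * of_int k)) has_field_derivative
       exp (2 * of_real pi * \<i> * of_int k * of_real \<theta>)) (at (of_real \<theta>))"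
      using False by (auto intro!: derivative_eq_intros)
    from has_vector_derivative_real_field[OF this]
    show ?thesis unfolding F_def e_def by (simp add: mult_ac has_vector_derivative_at_within)
  qed
  moreover have "continuous_on {0..1} (\<lambda>\<theta>. e (of_int k * \<theta>))" by (intro continuous_intros)
  ultimately have "(LINT \<theta>|lborel. indicator {0..1} \<theta> *\<^sub>R e (of_int k * \<theta>)) = F 1 - F 0"
    by (intro integral_FTC_Icc) auto
  also have "\<dots> = 0" by (simp add: F_def)
  finally show ?thesis using False
    by (simp add: unit_measure_def integral_restrict_space)
qed

lemma norm_integral_unit_le:
  fixes f \<phi> :: "real \<Rightarrow> complex"
  assumes "E \<in> sets unit_measure"
    and f: "f \<in> borel_measurable unit_measure" "\<And>\<theta>. norm (f \<theta>) \<le> indicator E \<theta>"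
    and \<phi>: "\<phi> \<in> borel_measurable unit_measure" "\<And>\<theta>. norm (\<phi> \<theta>) \<le> B"
  shows "norm (LINT \<theta>|unit_measure. f \<theta> * \<phi> \<theta>) \<le> B * measure unit_measure E"
proof -
  have B: "B \<ge> 0" using \<phi>(2)[of 0] norm_ge_zero order_trans by blast
  have le: "norm (f \<theta> * \<phi> \<theta>) \<le> B * indicator E \<theta>" for \<theta>
    using mult_mono[OF f(2) \<phi>(2), of \<theta> \<theta>] B by (simp add: norm_mult mult.commute)
  have 1: "integrable unit_measure (\<lambda>\<theta>. f \<theta> * \<phi> \<theta>)"
    using f(1) \<phi>(1) le B by (intro integrable_unit_bounded[of _ B] order_trans[OF le]) (auto simp: indicator_def)
  have 2: "integrable unit_measure (\<lambda>\<theta>. B * indicator E \<theta>)"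
    using assms(1) B by (intro integrable_unit_bounded[of _ B]) (auto simp: indicator_def)
  have "norm (LINT \<theta>|unit_measure. f \<theta> * \<phi> \<theta>) \<le> (LINT \<theta>|unit_measure. norm (f \<theta> * \<phi> \<theta>))"
    by (rule integral_norm_bound)
  also have "\<dots> \<le> (LINT \<theta>|unit_measure. B * indicator E \<theta>)"
    using 1 2 le by (intro integral_mono integrable_norm) auto
  also have "\<dots> = B * measure unit_measure E"
    using sets.sets_into_space[OF assms(1)] by (simp add: Int_absorb2)
  finally show ?thesis .
qed

text \<open>Split \<open>b = 1 + (b - 1)\<close>. The first part is Bessel's inequality, the squared
  L2 norm of \<open>f\<close> being at most the measure of \<open>E\<close>. The second is a
  quadratic form in \<open>f\<close> with kernel bounded by \<open>\<kappa>\<close>, hence at most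
  \<open>\<kappa>\<close> times the squared L1 norm; for a small set this square is the
  gain.\<close>

lemma weighted_Bessel:
  fixes b :: "nat \<Rightarrow> real" and f :: "real \<Rightarrow> complex"
  assumes E: "E \<in> sets unit_measure"
    and f: "f \<in> borel_measurable unit_measure" "\<And>\<theta>. norm (f \<theta>) \<le> indicator E \<theta>"
    and ker: "\<And>\<theta>. norm (\<Sum>n\<in>{1..N}. complex_of_real (b n - 1) * e (real n * \<theta>)) \<le> \<kappa>"
  defines "F \<equiv> \<lambda>n. LINT \<theta>|unit_measure. f \<theta> * e (real n * \<theta>)"
  shows "(\<Sum>n\<in>{1..N}. b n * (norm (F n))\<^sup>2) \<le> measure unit_measure E + \<kappa> * (measure unit_measure E)\<^sup>2"
proof -
  let ?M = unit_measure
  define m where "m = measure ?M E"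
  have f1: "norm (f \<theta>) \<le> 1" for \<theta> using f(2)[of \<theta>] by (rule order_trans) (auto simp: indicator_def)
  have em: "(\<lambda>\<theta>. e (c * \<theta>)) \<in> borel_measurable ?M" for c using e_measurable_unit[of c 0] by simp
  have int: "integrable ?M (\<lambda>\<theta>. f \<theta> * \<phi> \<theta>)" if "\<phi> \<in> borel_measurable ?M" "\<And>\<theta>. norm (\<phi> \<theta>) \<le> B" for \<phi> B
  proof (rule integrable_unit_bounded)
    show "norm (f \<theta> * \<phi> \<theta>) \<le> 1 * B" for \<theta>
      unfolding norm_mult using f1 that by (intro mult_mono) auto
  qed (use f that in auto)
  have int_e: "integrable ?M (\<lambda>\<theta>. f \<theta> * e (real n * \<theta>))" for n
    by (rule int[of _ 1]) (auto intro: em)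
  have int_ee: "integrable ?M (\<lambda>\<theta>. e (c * \<theta>))" for c
    by (rule integrable_unit_bounded[of _ 1]) (auto intro: em)
  have cnjF: "cnj (F n) = (LINT \<theta>|?M. cnj (f \<theta>) * e (- real n * \<theta>))" for n
  proof -
    have "cnj (F n) = (LINT \<theta>|?M. cnj (f \<theta> * e (real n * \<theta>)))"
      unfolding F_def by (rule Bochner_Integration.integral_cnj[symmetric])
    then show ?thesis by (simp add: cnj_e)
  qed
  have Bessel: "(\<Sum>n\<in>{1..N}. (norm (F n))\<^sup>2) \<le> m"
  proof -
    \<comment> \<open>\<open>F n\<close> is the Fourier coefficient of \<open>f\<close> at
      \<open>- n\<close>, so \<open>G\<close> is the orthogonal projection of \<open>f\<close> to
      the frequencies \<open>- N\<close> up to \<open>- 1\<close>.\<close>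
    define G where "G \<theta> = (\<Sum>n\<in>{1..N}. F n * e (- real n * \<theta>))" for \<theta>
    have Gm: "G \<in> borel_measurable ?M" unfolding G_def by (intro borel_measurable_sum borel_measurable_times em) auto
    have Gb: "norm (G \<theta>) \<le> (\<Sum>n\<in>{1..N}. norm (F n))" for \<theta>
      unfolding G_def by (intro order_trans[OF norm_sum] sum_mono) (auto simp: norm_mult)
    define S where "S = (\<Sum>n\<in>{1..N}. (norm (F n))\<^sup>2)"
    have S: "complex_of_real S = (\<Sum>n\<in>{1..N}. F n * cnj (F n))"
      unfolding S_def by (simp add: complex_norm_square del: of_real_power)
    have fG: "(LINT \<theta>|?M. f \<theta> * cnj (G \<theta>)) = complex_of_real S"
    proof -
      have "(LINT \<theta>|?M. f \<theta> * cnj (G \<theta>)) = (LINT \<theta>|?M. (\<Sum>n\<in>{1..N}. cnj (F n) * (f \<theta> * e (real n * \<theta>))))"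
        unfolding G_def by (intro Bochner_Integration.integral_cong) (auto simp: sum_distrib_left cnj_e mult_ac)
      also have "\<dots> = (\<Sum>n\<in>{1..N}. cnj (F n) * F n)"
        unfolding F_def using int_e by (subst Bochner_Integration.integral_sum) auto
      finally show ?thesis by (simp add: S mult.commute)
    qed
    have GG: "(LINT \<theta>|?M. G \<theta> * cnj (G \<theta>)) = complex_of_real S"
    proof -
      have "(LINT \<theta>|?M. G \<theta> * cnj (G \<theta>)) =
         (LINT \<theta>|?M. (\<Sum>n\<in>{1..N}. \<Sum>l\<in>{1..N}. F n * cnj (F l) * e (of_int (int l - int n) * \<theta>)))"
      proof (intro Bochner_Integration.integral_cong refl)
        fix \<theta>
        have "F n * e (- real n * \<theta>) * cnj (F l * e (- real l * \<theta>)) = F n * cnj (F l) * e (of_int (int l - int n) * \<theta>)" for n l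
        proof -
          have "of_int (int l - int n) * \<theta> = real l * \<theta> + (- real n * \<theta>)" by (simp add: left_diff_distrib)
          then have "e (of_int (int l - int n) * \<theta>) = e (real l * \<theta>) * e (- real n * \<theta>)" by (simp only: e_add)
          then show ?thesis by (simp add: cnj_e)
        qed
        then show "G \<theta> * cnj (G \<theta>) = (\<Sum>n\<in>{1..N}. \<Sum>l\<in>{1..N}. F n * cnj (F l) * e (of_int (int l - int n) * \<theta>))"
          unfolding G_def cnj_sum sum_product by (simp only:)
      qed
      also have "\<dots> = (\<Sum>n\<in>{1..N}. \<Sum>l\<in>{1..N}. F n * cnj (F l) * (if int l - int n = 0 then 1 else 0))"
      proof -
        have i: "integrable ?M (\<lambda>\<theta>. F n * cnj (F l) * e (of_int (int l - int n) * \<theta>))" for n l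
          by (intro integrable_mult_right int_ee)
        show ?thesis
          by (simp only: Bochner_Integration.integral_sum[OF Bochner_Integration.integrable_sum[OF i]]
            Bochner_Integration.integral_sum[OF i] integral_mult_right_zero integral_e_unit)
      qed
      also have "\<dots> = (\<Sum>n\<in>{1..N}. \<Sum>l\<in>{1..N}. if n = l then F n * cnj (F l) else 0)"
        by (intro sum.cong) auto
      also have "\<dots> = complex_of_real S" unfolding S by (intro sum.cong refl) (simp add: sum.delta)
      finally show ?thesis .
    qed
    have intfG: "integrable ?M (\<lambda>\<theta>. f \<theta> * cnj (G \<theta>))"
      using Gm Gb by (intro int[of _ "\<Sum>n\<in>{1..N}. norm (F n)"]) auto
    have intGG: "integrable ?M (\<lambda>\<theta>. G \<theta> * cnj (G \<theta>))"
      using Gm Gb by (intro integrable_unit_bounded[of _ "(\<Sum>n\<in>{1..N}. norm (F n)) * (\<Sum>n\<in>{1..N}. norm (F n))"])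
        (auto simp: norm_mult intro!: mult_mono sum_nonneg)
    have intff: "integrable ?M (\<lambda>\<theta>. (norm (f \<theta>))\<^sup>2)"
      using f f1 by (intro integrable_unit_bounded[of _ 1]) (auto simp: power_le_one)
    have nsq: "(norm (u - v))\<^sup>2 = (norm u)\<^sup>2 - 2 * Re (u * cnj v) + Re (v * cnj v)" for u v :: complex
      unfolding cmod_power2 by (simp add: power2_eq_square algebra_simps)
    have intA: "integrable ?M (\<lambda>\<theta>. 2 * Re (f \<theta> * cnj (G \<theta>)))"
      by (intro integrable_mult_right integrable_Re intfG)
    have intB: "integrable ?M (\<lambda>\<theta>. Re (G \<theta> * cnj (G \<theta>)))"
      by (intro integrable_Re intGG)
    have "0 \<le> (LINT \<theta>|?M. (norm (f \<theta> - G \<theta>))\<^sup>2)" by (rule Bochner_Integration.integral_nonneg) auto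
    also have "\<dots> = (LINT \<theta>|?M. (norm (f \<theta>))\<^sup>2 - 2 * Re (f \<theta> * cnj (G \<theta>)) + Re (G \<theta> * cnj (G \<theta>)))"
      by (simp only: nsq)
    also have "\<dots> = (LINT \<theta>|?M. (norm (f \<theta>))\<^sup>2) - 2 * Re (LINT \<theta>|?M. f \<theta> * cnj (G \<theta>)) + Re (LINT \<theta>|?M. G \<theta> * cnj (G \<theta>))"
      unfolding Bochner_Integration.integral_add[OF Bochner_Integration.integrable_diff[OF intff intA] intB]
        Bochner_Integration.integral_diff[OF intff intA]
      by (simp only: integral_mult_right_zero integral_Re[OF intfG] integral_Re[OF intGG])
    also have "\<dots> = (LINT \<theta>|?M. (norm (f \<theta>))\<^sup>2) - S" by (simp add: fG GG)
    finally have "S \<le> (LINT \<theta>|?M. (norm (f \<theta>))\<^sup>2)" by simp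
    also have "\<dots> \<le> (LINT \<theta>|?M. indicator E \<theta>)"
    proof (intro integral_mono intff)
      show "integrable ?M (\<lambda>\<theta>. indicator E \<theta> :: real)"
        using E by (intro integrable_unit_bounded[of _ 1]) (auto simp: indicator_def)
      show "(norm (f \<theta>))\<^sup>2 \<le> indicator E \<theta>" for \<theta>
        using f(2)[of \<theta>] f1[of \<theta>] by (auto simp: indicator_def power_le_one split: if_splits)
    qed
    also have "\<dots> = m" using sets.sets_into_space[OF E] by (simp add: m_def Int_absorb2)
    finally show ?thesis by (simp add: S_def)
  qed
  text \<open>Written as a double integral of \<open>f(\<theta>) cnj f(\<theta>') \<Sum>\<^sub>n (b n - 1) e(n(\<theta> - \<theta>'))\<close>, but with the integrals
    nested through \<open>H\<close> so that Fubini is not needed.\<close>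
  have kernel: "(\<Sum>n\<in>{1..N}. (b n - 1) * (norm (F n))\<^sup>2) \<le> \<kappa> * m\<^sup>2"
  proof -
    define c where "c n = complex_of_real (b n - 1)" for n
    define H where "H \<theta> = (\<Sum>n\<in>{1..N}. c n * cnj (F n) * e (real n * \<theta>))" for \<theta>
    have H: "norm (H \<theta>) \<le> \<kappa> * m" for \<theta>
    proof -
      have "H \<theta> = (LINT \<theta>'|?M. cnj (f \<theta>') * (\<Sum>n\<in>{1..N}. c n * e (real n * (\<theta> - \<theta>'))))"
      proof -
        have i: "integrable ?M (\<lambda>\<theta>'. cnj (f \<theta>') * e (- real n * \<theta>'))" for n
          using integrable_cnj[OF int_e[of n]] by (simp add: cnj_e)
        have "H \<theta> = (\<Sum>n\<in>{1..N}. LINT \<theta>'|?M. (c n * e (real n * \<theta>)) * (cnj (f \<theta>') * e (- real n * \<theta>')))"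
          unfolding H_def cnjF by (simp only: integral_mult_right_zero) (simp add: mult_ac)
        also have "\<dots> = (LINT \<theta>'|?M. (\<Sum>n\<in>{1..N}. (c n * e (real n * \<theta>)) * (cnj (f \<theta>') * e (- real n * \<theta>'))))"
          using i by (intro Bochner_Integration.integral_sum[symmetric] integrable_mult_right) auto
        also have "\<dots> = (LINT \<theta>'|?M. cnj (f \<theta>') * (\<Sum>n\<in>{1..N}. c n * e (real n * (\<theta> - \<theta>'))))"
          unfolding sum_distrib_left
          by (intro Bochner_Integration.integral_cong refl sum.cong) (simp add: right_diff_distrib e_diff mult_ac)
        finally show ?thesis .
      qed
      also have "norm \<dots> \<le> \<kappa> * measure ?M E"
      proof (rule norm_integral_unit_le[OF E])
        show "(\<lambda>\<theta>'. \<Sum>n\<in>{1..N}. c n * e (real n * (\<theta> - \<theta>'))) \<in> borel_measurable ?M"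
          by (intro continuous_borel_measurable_unit continuous_intros)
        show "norm (\<Sum>n\<in>{1..N}. c n * e (real n * (\<theta> - \<theta>'))) \<le> \<kappa>" for \<theta>'
          unfolding c_def by (rule ker)
      qed (use f in auto)
      finally show ?thesis by (simp add: m_def)
    qed
    have "complex_of_real (\<Sum>n\<in>{1..N}. (b n - 1) * (norm (F n))\<^sup>2) = (\<Sum>n\<in>{1..N}. c n * cnj (F n) * F n)"
      unfolding c_def by (simp add: complex_norm_square mult_ac del: of_real_power)
    also have "\<dots> = (\<Sum>n\<in>{1..N}. LINT \<theta>|?M. (c n * cnj (F n)) * (f \<theta> * e (real n * \<theta>)))"
      unfolding F_def by (simp only: integral_mult_right_zero)
    also have "\<dots> = (LINT \<theta>|?M. (\<Sum>n\<in>{1..N}. (c n * cnj (F n)) * (f \<theta> * e (real n * \<theta>))))"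
      using int_e by (intro Bochner_Integration.integral_sum[symmetric] integrable_mult_right) auto
    also have "\<dots> = (LINT \<theta>|?M. f \<theta> * H \<theta>)"
      unfolding H_def by (intro Bochner_Integration.integral_cong refl) (simp add: sum_distrib_left mult_ac)
    finally have "complex_of_real (\<Sum>n\<in>{1..N}. (b n - 1) * (norm (F n))\<^sup>2) = (LINT \<theta>|?M. f \<theta> * H \<theta>)" .
    moreover have "H \<in> borel_measurable ?M"
      unfolding H_def by (intro continuous_borel_measurable_unit continuous_intros)
    then have "norm (LINT \<theta>|?M. f \<theta> * H \<theta>) \<le> \<kappa> * m * measure ?M E"
      by (rule norm_integral_unit_le[OF E f _ H])
    ultimately have "norm (complex_of_real (\<Sum>n\<in>{1..N}. (b n - 1) * (norm (F n))\<^sup>2)) \<le> \<kappa> * m * m"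
      by (simp only: m_def)
    then have "\<bar>\<Sum>n\<in>{1..N}. (b n - 1) * (norm (F n))\<^sup>2\<bar> \<le> \<kappa> * m * m"
      by (simp only: norm_of_real)
    then show ?thesis by (simp add: power2_eq_square mult.assoc)
  qed
  have "(\<Sum>n\<in>{1..N}. b n * (norm (F n))\<^sup>2) = (\<Sum>n\<in>{1..N}. (norm (F n))\<^sup>2) + (\<Sum>n\<in>{1..N}. (b n - 1) * (norm (F n))\<^sup>2)"
    by (simp add: sum.distrib[symmetric] algebra_simps)
  then show ?thesis using Bessel kernel by (simp add: m_def)
qed

text \<open>Duality. The phase-aligned test function \<open>f\<close> on \<open>E\<close> gives
  \<open>t * m \<le> (\<Sum>n\<in>Y. norm (F n))\<close>. Cauchy-Schwarz over \<open>Y\<close>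
  brings in \<open>card Y\<close> and the squares, to which the weighted Bessel inequality applies
  because \<open>b \<ge> L\<close> on \<open>Y\<close>. One factor \<open>m\<close> then
  cancels.\<close>

lemma level_set_bound:
  fixes b :: "nat \<Rightarrow> real"
  assumes Y: "Y \<subseteq> {1..N}"
    and b: "\<And>n. n \<in> {1..N} \<Longrightarrow> b n \<ge> 0" "\<And>n. n \<in> Y \<Longrightarrow> b n \<ge> L" and L: "L > 0"
    and ker: "\<And>\<theta>. norm (\<Sum>n\<in>{1..N}. complex_of_real (b n - 1) * e (real n * \<theta>)) \<le> \<kappa>"
    and t: "t > 0"
  defines "E \<equiv> {\<theta>\<in>{0..1}. t \<le> norm (\<Sum>n\<in>Y. e (real n * \<theta>))}"
  shows "t\<^sup>2 * measure unit_measure E \<le> real (card Y) / L * (1 + \<kappa> * measure unit_measure E)"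
proof -
  let ?M = unit_measure
  define H where "H \<theta> = (\<Sum>n\<in>Y. e (real n * \<theta>))" for \<theta>
  define m where "m = measure ?M E"
  have m0: "m \<ge> 0" by (simp add: m_def)
  have \<kappa>: "\<kappa> \<ge> 0" using ker[of 0] norm_ge_zero order_trans by blast
  have finY: "finite Y" using Y finite_subset by blast
  have Hm[measurable]: "H \<in> borel_measurable ?M"
    unfolding H_def by (intro continuous_borel_measurable_unit continuous_intros)
  have E: "E \<in> sets ?M"
  proof -
    have "E = {\<theta>\<in>space ?M. t \<le> norm (H \<theta>)}" by (simp add: E_def H_def)
    moreover have "{\<theta>\<in>space ?M. t \<le> norm (H \<theta>)} \<in> sets ?M"
      using Hm by (intro borel_measurable_le) auto
    ultimately show ?thesis by simp
  qed
  \<comment> \<open>Where the sum vanishes the quotient is 0 by the convention on division by zero,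
    so the bound by the indicator holds at every point.\<close>
  define f where "f \<theta> = (indicator E \<theta> * cnj (H \<theta>)) / of_real (norm (H \<theta>))" for \<theta>
  have fm: "f \<in> borel_measurable ?M" unfolding f_def using E by measurable
  have fle: "norm (f \<theta>) \<le> indicator E \<theta>" for \<theta>
    by (auto simp: f_def norm_mult norm_divide indicator_def)
  define F where "F n = (LINT \<theta>|?M. f \<theta> * e (real n * \<theta>))" for n
  have inte: "integrable ?M (\<lambda>\<theta>. f \<theta> * e (real n * \<theta>))" for n
  proof (rule integrable_unit_bounded[of _ 1])
    show "norm (f \<theta> * e (real n * \<theta>)) \<le> 1" for \<theta>
      by (simp add: norm_mult order_trans[OF fle indicator_le_1])
    show "(\<lambda>\<theta>. f \<theta> * e (real n * \<theta>)) \<in> borel_measurable ?M"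
      using fm e_measurable_unit[of "real n" 0] by simp
  qed
  have intH: "integrable ?M (\<lambda>\<theta>. indicator E \<theta> * norm (H \<theta>))"
  proof (rule integrable_unit_bounded[of _ "real (card Y)"])
    show "norm (indicator E \<theta> * norm (H \<theta>)) \<le> real (card Y)" for \<theta>
      unfolding H_def by (auto simp: indicator_def intro!: order_trans[OF norm_sum])
  qed (use E in measurable)
  have "t * m = (LINT \<theta>|?M. t * indicator E \<theta>)"
    using sets.sets_into_space[OF E] by (simp add: m_def Int_absorb2)
  also have "\<dots> \<le> (LINT \<theta>|?M. indicator E \<theta> * norm (H \<theta>))"
  proof (rule integral_mono[OF _ intH])
    show "integrable ?M (\<lambda>\<theta>. t * indicator E \<theta>)"
      using E t by (intro integrable_unit_bounded[of _ t]) (auto simp: indicator_def)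
    show "t * indicator E \<theta> \<le> indicator E \<theta> * norm (H \<theta>)" for \<theta>
      by (auto simp: E_def H_def indicator_def)
  qed
  finally have le1: "t * m \<le> (LINT \<theta>|?M. indicator E \<theta> * norm (H \<theta>))" .
  have "complex_of_real (LINT \<theta>|?M. indicator E \<theta> * norm (H \<theta>)) = (LINT \<theta>|?M. complex_of_real (indicator E \<theta> * norm (H \<theta>)))"
    by (rule integral_complex_of_real[symmetric])
  also have "\<dots> = (LINT \<theta>|?M. (\<Sum>n\<in>Y. f \<theta> * e (real n * \<theta>)))"
  proof (intro Bochner_Integration.integral_cong refl)
    fix \<theta>
    have "complex_of_real (indicator E \<theta> * norm (H \<theta>)) = f \<theta> * H \<theta>"
      unfolding f_def using complex_norm_square[of "H \<theta>"]
      by (cases "H \<theta> = 0") (auto simp: indicator_def field_simps power2_eq_square)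
    then show "complex_of_real (indicator E \<theta> * norm (H \<theta>)) = (\<Sum>n\<in>Y. f \<theta> * e (real n * \<theta>))"
      by (simp add: H_def sum_distrib_left)
  qed
  also have "\<dots> = (\<Sum>n\<in>Y. F n)"
    unfolding F_def using inte by (intro Bochner_Integration.integral_sum) auto
  finally have eq: "complex_of_real (LINT \<theta>|?M. indicator E \<theta> * norm (H \<theta>)) = (\<Sum>n\<in>Y. F n)" .
  have "(LINT \<theta>|?M. indicator E \<theta> * norm (H \<theta>)) \<le> norm (complex_of_real (LINT \<theta>|?M. indicator E \<theta> * norm (H \<theta>)))"
    unfolding norm_of_real by simp
  also have "\<dots> \<le> (\<Sum>n\<in>Y. norm (F n))" unfolding eq by (rule norm_sum)
  finally have le2: "t * m \<le> (\<Sum>n\<in>Y. norm (F n))" using le1 by linarith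
  have "(t * m)\<^sup>2 \<le> (\<Sum>n\<in>Y. 1 * norm (F n))\<^sup>2" using le2 t m0 by (intro power_mono) auto
  also have "\<dots> \<le> (\<Sum>n\<in>Y. 1\<^sup>2) * (\<Sum>n\<in>Y. (norm (F n))\<^sup>2)" by (rule Cauchy_Schwarz_ineq_sum)
  also have "\<dots> \<le> real (card Y) * ((m + \<kappa> * m\<^sup>2) / L)"
  proof -
    have "L * (\<Sum>n\<in>Y. (norm (F n))\<^sup>2) \<le> (\<Sum>n\<in>Y. b n * (norm (F n))\<^sup>2)"
      unfolding sum_distrib_left using b by (intro sum_mono mult_right_mono) auto
    also have "\<dots> \<le> (\<Sum>n\<in>{1..N}. b n * (norm (F n))\<^sup>2)"
      using Y b by (intro sum_mono2) auto
    also have "\<dots> \<le> m + \<kappa> * m\<^sup>2"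
      unfolding m_def F_def by (rule weighted_Bessel[OF E fm fle ker])
    finally have "(\<Sum>n\<in>Y. (norm (F n))\<^sup>2) \<le> (m + \<kappa> * m\<^sup>2) / L" using L by (simp add: field_simps)
    then have "real (card Y) * (\<Sum>n\<in>Y. (norm (F n))\<^sup>2) \<le> real (card Y) * ((m + \<kappa> * m\<^sup>2) / L)"
      by (intro mult_left_mono) auto
    then show ?thesis by simp
  qed
  finally have fin: "t\<^sup>2 * m\<^sup>2 \<le> real (card Y) * ((m + \<kappa> * m\<^sup>2) / L)" by (simp add: power_mult_distrib)
  show ?thesis
  proof (cases "m = 0")
    case True
    then show ?thesis using L by (simp add: m_def)
  next
    case False
    then have "m * (t\<^sup>2 * m) \<le> m * (real (card Y) / L * (1 + \<kappa> * m))"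
      using fin by (simp add: algebra_simps power2_eq_square add_divide_distrib)
    then have "t\<^sup>2 * m \<le> real (card Y) / L * (1 + \<kappa> * m)"
      by (rule mult_left_le_imp_le) (use False m0 in simp)
    then show ?thesis by (simp only: m_def)
  qed
qed

text \<open>At \<open>\<theta> = 0\<close> the kernel bound is the usual upper bound sieve: the sum
  of \<open>b\<close> is at most \<open>N + \<kappa>\<close>.\<close>

lemma card_le_kernel:
  fixes b :: "nat \<Rightarrow> real"
  assumes Y: "Y \<subseteq> {1..N}"
    and b: "\<And>n. n \<in> {1..N} \<Longrightarrow> b n \<ge> 0" "\<And>n. n \<in> Y \<Longrightarrow> b n \<ge> L"
    and ker: "\<And>\<theta>. norm (\<Sum>n\<in>{1..N}. complex_of_real (b n - 1) * e (real n * \<theta>)) \<le> \<kappa>"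
  shows "L * real (card Y) \<le> real N + \<kappa>"
proof -
  have "L * real (card Y) = (\<Sum>n\<in>Y. L)" by simp
  also have "\<dots> \<le> (\<Sum>n\<in>Y. b n)" using b by (intro sum_mono) auto
  also have "\<dots> \<le> (\<Sum>n\<in>{1..N}. b n)" using Y b by (intro sum_mono2) auto
  also have "\<dots> = real N + (\<Sum>n\<in>{1..N}. b n - 1)" by (simp add: sum_subtractf)
  also have "(\<Sum>n\<in>{1..N}. b n - 1) \<le> norm (complex_of_real (\<Sum>n\<in>{1..N}. b n - 1))"
    unfolding norm_of_real by simp
  also have "\<dots> \<le> \<kappa>" using ker[of 0] by (simp add: sum_subtractf)
  finally show ?thesis by simp
qed

text \<open>A weak bound of exponent \<open>q < p\<close> and a uniform bound \<open>B\<close> give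
  a strong bound: the level \<open>B / 2 ^ j\<close> contributes at most a fixed quantity times
  \<open>2 powr ((q - p) * j)\<close>, so the top levels dominate. The factor
  \<open>2 powr q\<close> comes from halving the level in \<open>E j\<close>.\<close>

lemma powr_integral_le_of_level_sets:
  fixes \<phi> :: "real \<Rightarrow> real"
  assumes \<phi>: "\<phi> \<in> borel_measurable unit_measure" "\<And>\<theta>. 0 \<le> \<phi> \<theta>" "\<And>\<theta>. \<phi> \<theta> \<le> B"
    and B: "B > 0" and q: "q < p" "p > 0" and K: "K \<ge> 0"
    and lev: "\<And>t. 0 < t \<Longrightarrow> measure unit_measure {\<theta>\<in>{0..1}. t \<le> \<phi> \<theta>} \<le> K * t powr (- q)"
  shows "(LINT \<theta>|unit_measure. \<phi> \<theta> powr p) \<le> 2 powr q / (1 - 2 powr (q - p)) * K * B powr (p - q)"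
proof -
  let ?M = unit_measure
  define x where "x j = B / 2 ^ j" for j :: nat
  have x: "x j > 0" for j using B by (simp add: x_def)
  define E where "E j = {\<theta>\<in>{0..1}. x j / 2 \<le> \<phi> \<theta>}" for j
  define r where "r = 2 powr (q - p)"
  have r: "0 < r" "r < 1" using q by (auto simp: r_def powr_less_one)
  have E: "E j \<in> sets ?M" for j
  proof -
    have "E j = {\<theta>\<in>space ?M. x j / 2 \<le> \<phi> \<theta>}" by (simp add: E_def)
    moreover have "{\<theta>\<in>space ?M. x j / 2 \<le> \<phi> \<theta>} \<in> sets ?M"
      using \<phi>(1) by (intro borel_measurable_le) auto
    ultimately show ?thesis by simp
  qed
  text \<open>A finite dyadic layer-cake decomposition, with an error that vanishes as \<open>J \<rightarrow> \<infinity>\<close>.\<close>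
  have pw: "\<phi> \<theta> powr p \<le> (\<Sum>j<J. x j powr p * indicator (E j) \<theta>) + x J powr p" if "\<theta> \<in> {0..1}" for J \<theta>
  proof (induction J)
    case 0
    show ?case using \<phi> q by (simp add: x_def powr_mono2)
  next
    case (Suc J)
    show ?case
    proof (cases "\<phi> \<theta> \<le> x (Suc J)")
      case True
      then have "\<phi> \<theta> powr p \<le> x (Suc J) powr p" using \<phi> q by (intro powr_mono2) auto
      then show ?thesis by (intro add_increasing sum_nonneg) auto
    next
      case False
      then have "\<theta> \<in> E J" using that by (auto simp: E_def x_def)
      then show ?thesis using Suc.IH by (simp add: add_increasing2)
    qed
  qed
  have int: "integrable ?M (\<lambda>\<theta>. \<phi> \<theta> powr p)"
  proof (rule integrable_unit_bounded)
    show "(\<lambda>\<theta>. \<phi> \<theta> powr p) \<in> borel_measurable ?M" using \<phi>(1) by measurable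
    show "norm (\<phi> \<theta> powr p) \<le> B powr p" for \<theta> using \<phi>(2,3) q by (simp add: powr_mono2)
  qed
  have tm: "x j powr p * measure ?M (E j) \<le> K * 2 powr q * B powr (p - q) * r ^ j" for j
  proof -
    have "measure ?M (E j) \<le> K * (x j / 2) powr (- q)" unfolding E_def using x[of j] by (intro lev) auto
    then have "x j powr p * measure ?M (E j) \<le> x j powr p * (K * (x j / 2) powr (- q))"
      by (intro mult_left_mono) auto
    also have "\<dots> = K * 2 powr q * x j powr (p - q)"
      using x[of j] by (simp add: powr_divide powr_diff powr_minus field_simps)
    also have "x j powr (p - q) = B powr (p - q) * r ^ j"
    proof -
      have "(2 ^ j) powr (p - q) = (2 powr (p - q)) ^ j"
        by (simp add: powr_realpow[symmetric] powr_powr mult.commute)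
      moreover have "r ^ j = 1 / (2 powr (p - q)) ^ j"
        by (simp add: r_def powr_diff power_divide)
      ultimately show ?thesis using B by (simp add: x_def powr_divide)
    qed
    finally show ?thesis by (simp add: mult_ac)
  qed
  define C where "C = 2 powr q / (1 - r) * K * B powr (p - q)"
  have bound: "(LINT \<theta>|?M. \<phi> \<theta> powr p) \<le> C + x J powr p" for J
  proof -
    have intE: "integrable ?M (\<lambda>\<theta>. x j powr p * indicator (E j) \<theta>)" for j
      using E by (intro integrable_unit_bounded[of _ "x j powr p"]) (auto simp: indicator_def)
    have intc: "integrable ?M (\<lambda>\<theta>. x J powr p)" by (rule integrable_unit_bounded[of _ "x J powr p"]) auto
    have "(LINT \<theta>|?M. \<phi> \<theta> powr p) \<le> (LINT \<theta>|?M. (\<Sum>j<J. x j powr p * indicator (E j) \<theta>) + x J powr p)"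
      using pw int intE intc by (intro integral_mono Bochner_Integration.integrable_add Bochner_Integration.integrable_sum) auto
    also have "\<dots> = (\<Sum>j<J. x j powr p * measure ?M (E j)) + x J powr p"
    proof -
      have "(LINT \<theta>|?M. x j powr p * indicator (E j) \<theta>) = x j powr p * measure ?M (E j)" for j
        using sets.sets_into_space[OF E] by (simp add: Int_absorb2)
      moreover have "(LINT \<theta>|?M. x J powr p) = x J powr p" by (simp add: measure_unit_space)
      moreover have "(LINT \<theta>|?M. (\<Sum>j<J. x j powr p * indicator (E j) \<theta>)) = (\<Sum>j<J. LINT \<theta>|?M. x j powr p * indicator (E j) \<theta>)"
        by (rule Bochner_Integration.integral_sum) (rule intE)
      moreover have "(LINT \<theta>|?M. (\<Sum>j<J. x j powr p * indicator (E j) \<theta>) + x J powr p) =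
          (LINT \<theta>|?M. (\<Sum>j<J. x j powr p * indicator (E j) \<theta>)) + (LINT \<theta>|?M. x J powr p)"
        by (intro Bochner_Integration.integral_add Bochner_Integration.integrable_sum intE intc)
      ultimately show ?thesis by (simp only:)
    qed
    also have "(\<Sum>j<J. x j powr p * measure ?M (E j)) \<le> (\<Sum>j<J. K * 2 powr q * B powr (p - q) * r ^ j)"
      by (intro sum_mono tm)
    also have "\<dots> = K * 2 powr q * B powr (p - q) * (\<Sum>j<J. r ^ j)" by (simp add: sum_distrib_left)
    also have "\<dots> \<le> K * 2 powr q * B powr (p - q) * (1 / (1 - r))"
    proof (intro mult_left_mono)
      have "(\<Sum>j<J. r ^ j) = (1 - r ^ J) / (1 - r)" using r by (simp add: sum_gp_strict)
      also have "\<dots> \<le> 1 / (1 - r)" using r by (intro divide_right_mono) auto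
      finally show "(\<Sum>j<J. r ^ j) \<le> 1 / (1 - r)" .
    qed (use K in auto)
    also have "\<dots> = C" by (simp add: C_def)
    finally show ?thesis by simp
  qed
  have "(\<lambda>J. C + x J powr p) \<longlonglongrightarrow> C + 0"
  proof (intro tendsto_intros)
    have "x \<longlonglongrightarrow> 0" unfolding x_def by (rule LIMSEQ_divide_realpow_zero) simp
    then show "(\<lambda>J. x J powr p) \<longlonglongrightarrow> 0"
      using tendsto_powr'[of x 0 sequentially "\<lambda>_. p" p] q less_imp_le[OF x] by simp
  qed
  then have "(LINT \<theta>|?M. \<phi> \<theta> powr p) \<le> C + 0" by (rule LIMSEQ_le_const) (use bound in auto)
  then show ?thesis by (simp add: C_def r_def)
qed

section \<open>Restriction for sifted sets\<close>

definition sieve_density :: "(nat \<Rightarrow> nat set) \<Rightarrow> nat \<Rightarrow> real" where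
  "sieve_density \<omega> p = 1 - real (card (\<omega> p)) / real p"

text \<open>All that the sieve learns about \<open>F\<close>: the bound \<open>k\<close> is its
  dimension, and \<open>card (\<omega> p) < p\<close> keeps every local density positive. The
  constants below are uniform over all such \<open>\<omega>\<close>.\<close>

definition sieve_dim_le :: "nat \<Rightarrow> (nat \<Rightarrow> nat set) \<Rightarrow> bool" where
  "sieve_dim_le k \<omega> \<longleftrightarrow> (\<forall>p. prime p \<longrightarrow> \<omega> p \<subseteq> {..<p} \<and> card (\<omega> p) < p \<and> card (\<omega> p) \<le> k)"

lemma sieve_density_pos:
  assumes "sieve_dim_le k \<omega>" "prime p"
  shows "sieve_density \<omega> p > 0"
proof -
  have "card (\<omega> p) < p" using assms by (auto simp: sieve_dim_le_def)
  then show ?thesis by (simp add: sieve_density_def)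
qed

lemma sieve_density_ge_inverse:
  assumes "sieve_dim_le k \<omega>" "prime p"
  shows "sieve_density \<omega> p \<ge> 1 / real p"
proof -
  have "card (\<omega> p) < p" using assms by (auto simp: sieve_dim_le_def)
  then have "real (card (\<omega> p)) + 1 \<le> real p" by linarith
  then show ?thesis using prime_gt_0_nat[OF assms(2)] by (simp add: sieve_density_def field_simps)
qed

lemma sieve_density_ge:
  assumes "sieve_dim_le k \<omega>" "prime p"
  shows "sieve_density \<omega> p \<ge> 1 - real k / real p"
proof -
  have "card (\<omega> p) \<le> k" using assms by (auto simp: sieve_dim_le_def)
  then show ?thesis by (simp add: sieve_density_def divide_right_mono)
qed

lemma sieve_density_weight:
  assumes "sieve_dim_le k \<omega>" "prime p"
  shows "1 + sieve_weight \<omega> p = inverse (sieve_density \<omega> p)"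
proof -
  have "real (card (\<omega> p)) < real p" using assms by (auto simp: sieve_dim_le_def)
  then show ?thesis by (simp add: sieve_density_def sieve_weight_def field_simps)
qed

lemma sieve_weight_nonneg:
  assumes "sieve_dim_le k \<omega>" "prime p"
  shows "sieve_weight \<omega> p \<ge> 0"
proof -
  have "real (card (\<omega> p)) < real p" using assms by (auto simp: sieve_dim_le_def)
  then show ?thesis by (simp add: sieve_weight_def)
qed

text \<open>One bound has to serve all primes. If \<open>p \<le> k\<close>, the denominator
  \<open>p - card (\<omega> p)\<close> may be as small as 1, and the factor
  \<open>k * (k + 1)\<close> pays for it. If \<open>p > k\<close>, then
  \<open>p \<le> (k + 1) * (p - k)\<close>.\<close>

lemma sieve_weight_le:
  assumes "sieve_dim_le k \<omega>" "prime p"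
  shows "sieve_weight \<omega> p \<le> real k * (real k + 1) / real p"
proof -
  define r where "r = card (\<omega> p)"
  have r: "r + 1 \<le> p" "r \<le> k" using assms by (auto simp: sieve_dim_le_def r_def)
  have p: "real p > 0" using prime_gt_0_nat[OF assms(2)] by simp
  have "r * p \<le> k * (k + 1) * (p - r)"
  proof (cases "p \<le> k")
    case True
    have "r * p \<le> k * (k + 1)" using r True by (intro mult_mono) auto
    also have "\<dots> \<le> k * (k + 1) * (p - r)"
    proof -
      have "1 \<le> p - r" using r by linarith
      from mult_le_mono2[OF this, of "k * (k + 1)"] show ?thesis by simp
    qed
    finally show ?thesis .
  next
    case False
    then obtain j where j: "p = k + 1 + j" using le_Suc_ex[of "k + 1" p] by auto
    have "r * p \<le> k * (k + 1 + j)" using r j by (intro mult_mono) auto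
    also have "\<dots> \<le> k * ((k + 1) * (1 + j))" by (intro mult_le_mono2) (simp add: algebra_simps)
    also have "\<dots> \<le> k * ((k + 1) * (p - r))" using r j by (intro mult_le_mono2) auto
    finally show ?thesis by (simp only: mult.assoc)
  qed
  then have "real (r * p) \<le> real (k * (k + 1) * (p - r))" by (rule of_nat_mono)
  then have "real r * real p \<le> real k * (real k + 1) * (real p - real r)"
  proof -
    have "real (p - r) = real p - real r" using r by (intro of_nat_diff) simp
    then show ?thesis using \<open>real (r * p) \<le> _\<close> by (simp only: of_nat_mult of_nat_add of_nat_1)
  qed
  moreover have "real p - real r > 0" using r by linarith
  ultimately show ?thesis using p unfolding sieve_weight_def r_def[symmetric] by (simp add: field_simps)
qed

text \<open>The inverse densities of the primes up to \<open>z\<close> multiply to at most the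
  exponential of their total weight, and each weight is at most a constant over \<open>p\<close>.
  The actual loss is a power of \<open>ln z\<close>; the cruder \<open>z powr \<epsilon>\<close> is
  affordable because the final exponent exceeds 2.\<close>

lemma sieve_product_tail_le:
  assumes "\<epsilon> > 0"
  shows "\<exists>C\<ge>1. \<forall>\<omega> z D. sieve_dim_le k \<omega> \<longrightarrow> z \<ge> 1 \<longrightarrow>
    (\<Prod>p | prime p \<and> real p \<le> D \<and> z < real p. sieve_density \<omega> p)
      \<le> C * z powr \<epsilon> * (\<Prod>p | prime p \<and> real p \<le> D. sieve_density \<omega> p)"
proof (intro exI conjI allI impI)
  define K where "K = real k * (real k + 1)"
  \<comment> \<open>Makes \<open>2 * K / ln T = \<epsilon> * K / (K + 1) \<le> \<epsilon>\<close>;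
    taking \<open>K + 1\<close> and not \<open>K\<close> keeps \<open>T > 1\<close> also for
    \<open>K = 0\<close>.\<close>
  define T where "T = exp (2 * (K + 1) / \<epsilon>)"
  have K: "K \<ge> 0" by (simp add: K_def)
  have T: "T > 1" using K assms by (simp add: T_def)
  show "1 \<le> exp (K * T)" using K T by simp
  fix \<omega> :: "nat \<Rightarrow> nat set" and z D :: real
  assume \<omega>: "sieve_dim_le k \<omega>" and z: "z \<ge> 1"
  let ?A = "{p. prime p \<and> real p \<le> D \<and> z < real p}" and ?B = "{p. prime p \<and> real p \<le> D \<and> real p \<le> z}"
  have fin: "finite ?A" "finite ?B" by (auto intro: finite_subset[OF _ finite_primes_real_le[of D]])
  have split: "(\<Prod>p | prime p \<and> real p \<le> D. sieve_density \<omega> p) = (\<Prod>p\<in>?A. sieve_density \<omega> p) * (\<Prod>p\<in>?B. sieve_density \<omega> p)"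
  proof -
    have "{p. prime p \<and> real p \<le> D} = ?A \<union> ?B" by auto
    then show ?thesis using fin by (simp only:) (rule prod.union_disjoint, auto)
  qed
  have posA: "(\<Prod>p\<in>?A. sieve_density \<omega> p) \<ge> 0" and posB: "(\<Prod>p\<in>?B. sieve_density \<omega> p) > 0"
    using sieve_density_pos[OF \<omega>] by (auto intro!: prod_nonneg prod_pos less_imp_le)
  have "inverse (\<Prod>p\<in>?B. sieve_density \<omega> p) = (\<Prod>p\<in>?B. 1 + sieve_weight \<omega> p)"
    using sieve_density_weight[OF \<omega>] by (simp add: prod_inversef[symmetric])
  also have "\<dots> \<le> exp (\<Sum>p\<in>?B. sieve_weight \<omega> p)"
    using sieve_weight_nonneg[OF \<omega>] by (intro prod_le_exp_sum) auto
  also have "(\<Sum>p\<in>?B. sieve_weight \<omega> p) \<le> (\<Sum>p\<in>?B. K * (1 / real p))"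
    using sieve_weight_le[OF \<omega>] by (intro sum_mono) (auto simp: K_def)
  also have "\<dots> \<le> (\<Sum>p | prime p \<and> real p \<le> z. K * (1 / real p))"
    using K by (intro sum_mono2) auto
  also have "\<dots> = K * (\<Sum>p | prime p \<and> real p \<le> z. 1 / real p)" by (simp only: sum_distrib_left)
  also have "\<dots> \<le> K * (T + 2 * ln z / ln T)"
    using sum_inverse_prime_le[OF z T] K by (rule mult_left_mono)
  also have "\<dots> \<le> K * T + \<epsilon> * ln z"
  proof -
    have "2 * K * ln z / ln T = K / (K + 1) * (\<epsilon> * ln z)" using K assms by (simp add: T_def field_simps)
    also have "\<dots> \<le> 1 * (\<epsilon> * ln z)" using K assms z by (intro mult_right_mono) auto
    finally show ?thesis by (simp add: algebra_simps)
  qed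
  also have "exp (K * T + \<epsilon> * ln z) = exp (K * T) * z powr \<epsilon>"
    using z by (simp add: exp_add powr_def)
  finally have inv: "inverse (\<Prod>p\<in>?B. sieve_density \<omega> p) \<le> exp (K * T) * z powr \<epsilon>" by simp
  have "(\<Prod>p\<in>?A. sieve_density \<omega> p) = inverse (\<Prod>p\<in>?B. sieve_density \<omega> p) * (\<Prod>p | prime p \<and> real p \<le> D. sieve_density \<omega> p)"
    unfolding split using posB by simp
  also have "\<dots> \<le> exp (K * T) * z powr \<epsilon> * (\<Prod>p | prime p \<and> real p \<le> D. sieve_density \<omega> p)"
    using inv posA posB by (intro mult_right_mono) (auto simp: split)
  finally show "(\<Prod>p\<in>?A. sieve_density \<omega> p) \<le> exp (K * T) * z powr \<epsilon> * (\<Prod>p | prime p \<and> real p \<le> D. sieve_density \<omega> p)" .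
qed

text \<open>The level of the weight is \<open>Q = N\<^bsup>1/40\<^esup>\<close>, and \<open>D = Q\<^bsup>1/(4k)\<^esup>\<close> is small enough for the truncation at
  \<open>Q\<close> to lose at most half of the full Euler product.\<close>

lemma Selberg_sieve:
  fixes z :: real
  assumes k: "k \<ge> 1" and \<omega>: "sieve_dim_le k \<omega>" and z: "z \<ge> (8 * real k)\<^sup>2" and N: "N \<ge> 2"
    and D: "D = real N powr (1 / (160 * real k))"
    and Y: "\<forall>n p. n \<in> Y \<longrightarrow> prime p \<longrightarrow> real p \<le> D \<longrightarrow> n mod p \<notin> \<omega> p"
  shows "\<exists>b L. L > 0 \<and>
    1 / L \<le> 2 * (\<Prod>p | prime p \<and> real p \<le> D \<and> z < real p. sieve_density \<omega> p) \<and>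
    (\<forall>n. b n \<ge> 0) \<and> (\<forall>n\<in>Y. b n \<ge> L) \<and>
    (\<forall>\<theta>. norm (\<Sum>n\<in>{1..N}. complex_of_real (b n - 1) * e (real n * \<theta>)) \<le> 5 * real N / sqrt z)"
proof -
  define P where "P = {p. prime p \<and> real p \<le> D \<and> z < real p}"
  define Q where "Q = real N powr (1 / 40)"
  define L where "L = sieve_mass \<omega> P Q"
  define b where "b n = (sieve_sum \<omega> P Q n)\<^sup>2 / L" for n
  have finP: "finite P" unfolding P_def by (auto intro: finite_subset[OF _ finite_primes_real_le[of D]])
  have prime: "prime p" if "p \<in> P" for p using that by (simp add: P_def)
  have z0: "z > 0" using k z by (auto intro: less_le_trans[rotated])
  have sz: "sqrt z \<ge> 8 * real k" "sqrt z > 0" using z z0 by (auto intro: real_le_rsqrt)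
  have Q: "Q > 1" using N unfolding Q_def by (intro gr_one_powr) auto
  have Q8: "Q ^ 8 \<le> real N"
  proof -
    have "Q ^ 8 = real N powr (8 * (1 / 40))"
      using Q N by (simp add: Q_def powr_realpow[symmetric] powr_powr)
    also have "\<dots> \<le> real N powr 1" using N by (intro powr_mono) auto
    finally show ?thesis by simp
  qed
  have D1: "D \<ge> 1" unfolding D using N by (intro ge_one_powr_ge_zero) auto
  have L1: "L \<ge> 1" unfolding L_def using finP Q sieve_weight_nonneg[OF \<omega> prime] by (intro sieve_mass_ge_1) auto
  \<comment> \<open>\<open>g / (1 + g)\<close> is \<open>card (\<omega> p) / p\<close>, so the mean
    of the logarithm is at most \<open>2 * k * ln D = ln N / 80\<close>, which is half of
    \<open>ln Q = ln N / 40\<close>.\<close>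
  have "(\<Sum>p\<in>P. sieve_weight \<omega> p / (1 + sieve_weight \<omega> p) * ln (real p)) \<le> (\<Sum>p\<in>P. real k * (ln (real p) / real p))"
  proof (rule sum_mono)
    fix p assume "p \<in> P"
    then have p: "prime p" by (rule prime)
    then have p0: "real p \<ge> 1" using prime_ge_1_nat by simp
    have r: "real (card (\<omega> p)) < real p" "real (card (\<omega> p)) \<le> real k" using \<omega> p by (auto simp: sieve_dim_le_def)
    have "sieve_weight \<omega> p / (1 + sieve_weight \<omega> p) = real (card (\<omega> p)) / real p"
      using r p0 by (simp add: sieve_weight_def field_simps)
    also have "\<dots> \<le> real k / real p" using r by (intro divide_right_mono) auto
    finally have "sieve_weight \<omega> p / (1 + sieve_weight \<omega> p) * ln (real p) \<le> real k / real p * ln (real p)"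
      using p0 by (intro mult_right_mono) auto
    then show "sieve_weight \<omega> p / (1 + sieve_weight \<omega> p) * ln (real p) \<le> real k * (ln (real p) / real p)" by simp
  qed
  also have "\<dots> \<le> (\<Sum>p | prime p \<and> real p \<le> D. real k * (ln (real p) / real p))"
    using prime_ge_1_nat by (intro sum_mono2) (auto simp: P_def)
  also have "\<dots> = real k * (\<Sum>p | prime p \<and> real p \<le> D. ln (real p) / real p)" by (simp only: sum_distrib_left)
  also have "\<dots> \<le> real k * (2 * ln D)" using sum_ln_prime_div_le[OF D1] by (intro mult_left_mono) auto
  also have "\<dots> = ln Q / 2" using N k by (simp add: D Q_def ln_powr)
  finally have "(\<Prod>p\<in>P. 1 + sieve_weight \<omega> p) / 2 \<le> L"
    unfolding L_def sieve_mass_def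
    using finP Q sieve_weight_nonneg[OF \<omega> prime] prime_ge_1_nat[OF prime] by (intro truncated_subset_sum_ge) auto
  moreover have "(\<Prod>p\<in>P. 1 + sieve_weight \<omega> p) = inverse (\<Prod>p\<in>P. sieve_density \<omega> p)"
    using sieve_density_weight[OF \<omega> prime] by (simp add: prod_inversef[symmetric])
  moreover have "(\<Prod>p\<in>P. sieve_density \<omega> p) > 0" using sieve_density_pos[OF \<omega> prime] by (intro prod_pos) auto
  ultimately have inv: "1 / L \<le> 2 * (\<Prod>p\<in>P. sieve_density \<omega> p)"
    using L1 by (simp add: field_simps)
  have ker: "norm (\<Sum>n\<in>{1..N}. complex_of_real (b n - 1) * e (real n * \<theta>)) \<le> 5 * real N / sqrt z" for \<theta>
  proof -
    \<comment> \<open>Origin of the lower limit \<open>(8 * k)\<^sup>2\<close> for \<open>z\<close>: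
      from \<open>p > z \<ge> 2 * k\<close> the weight is at most \<open>2 * k / z\<close>, and
      \<open>8 * k / z \<le> 1 / sqrt z\<close> means \<open>8 * k \<le> sqrt z\<close>.\<close>
    have w: "4 * sieve_weight \<omega> p \<le> 1 / sqrt z" if p: "p \<in> P" for p
    proof -
      have r: "real (card (\<omega> p)) \<le> real k" using \<omega> prime[OF p] by (auto simp: sieve_dim_le_def)
      have zp: "z < real p" using p by (simp add: P_def)
      have "sqrt z * sqrt z = z" using z0 by simp
      have zk: "8 * real k * sqrt z \<le> z" using mult_right_mono[OF sz(1), of "sqrt z"] z0 by simp
      have k2: "2 * real k \<le> z"
      proof -
        have "1 \<le> sqrt z" using sz(1) k by linarith
        then have "8 * real k * 1 \<le> 8 * real k * sqrt z" by (intro mult_left_mono) auto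
        then show ?thesis using zk by linarith
      qed
      have "sieve_weight \<omega> p \<le> real k / (z / 2)"
        unfolding sieve_weight_def using r zp k2 z0 by (intro frac_le) auto
      then have "4 * sieve_weight \<omega> p \<le> 8 * real k / z" using z0 by (simp add: field_simps)
      also have "\<dots> \<le> 1 / sqrt z" using zk z0 sz by (simp add: field_simps)
      finally show ?thesis .
    qed
    have "1 \<le> sqrt z" using sz(1) k by linarith
    then have s1: "1 / sqrt z \<le> 1" by simp
    have "norm (\<Sum>n\<in>{1..N}. complex_of_real (b n - 1) * e (real n * \<theta>)) \<le> 1 / sqrt z * (real N + 4 * Q ^ 8)"
      unfolding b_def L_def
    proof (rule sieve_kernel_bound[OF finP prime _ w _ s1])
      show "\<omega> p \<subseteq> {..<p} \<and> card (\<omega> p) < p" if "p \<in> P" for p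
        using \<omega> prime[OF that] by (auto simp: sieve_dim_le_def)
    qed (use Q sz in auto)
    also have "\<dots> \<le> 1 / sqrt z * (real N + 4 * real N)" using Q8 sz by (intro mult_left_mono) auto
    finally show ?thesis by simp
  qed
  show ?thesis
  proof (intro exI[of _ b] exI[of _ L] conjI allI ballI)
    show "b n \<ge> L" if "n \<in> Y" for n
    proof -
      have "sieve_sum \<omega> P Q n = L" unfolding L_def
        using Y that by (intro sieve_sum_eq_mass) (auto simp: P_def)
      then show ?thesis using L1 by (simp add: b_def power2_eq_square)
    qed
    show "b n \<ge> 0" for n using L1 by (simp add: b_def)
    show "1 / L \<le> 2 * (\<Prod>p | prime p \<and> real p \<le> D \<and> z < real p. sieve_density \<omega> p)"
      using inv by (simp add: P_def)
  qed (use L1 ker in auto)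
qed

text \<open>The sieve is set up anew for every level set, so \<open>z\<close> can depend on the very
  measure being estimated; the outcome bounds \<open>N * m\<close> by a small power of itself, up to
  a factor. One \<open>M\<close> comes from \<open>card Y\<close>, the other from
  \<open>N / L\<close>. The \<open>max 1\<close> covers level sets with \<open>N * m\<close> below
  1, where the fixed limit \<open>z0\<close> is enough.\<close>

lemma sifted_set_level_sets:
  assumes k: "k \<ge> 1" and \<epsilon>: "\<epsilon> > 0"
  shows "\<exists>C\<ge>1. \<forall>\<omega> N Y D M. sieve_dim_le k \<omega> \<longrightarrow> N \<ge> 2 \<longrightarrow> Y \<subseteq> {1..N} \<longrightarrow>
    D = real N powr (1 / (160 * real k)) \<longrightarrow>
    (\<forall>n p. n \<in> Y \<longrightarrow> prime p \<longrightarrow> real p \<le> D \<longrightarrow> n mod p \<notin> \<omega> p) \<longrightarrow>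
    M = real N * (\<Prod>p | prime p \<and> real p \<le> D. sieve_density \<omega> p) \<longrightarrow>
    real (card Y) \<le> C * M \<and>
    (\<forall>t>0. t\<^sup>2 * (real N * measure unit_measure {\<theta>\<in>{0..1}. t \<le> norm (\<Sum>n\<in>Y. e (real n * \<theta>))})
       \<le> C * M\<^sup>2 * (max 1 (real N * measure unit_measure {\<theta>\<in>{0..1}. t \<le> norm (\<Sum>n\<in>Y. e (real n * \<theta>))})) powr \<epsilon>)"
proof -
  obtain C where C: "C \<ge> 1" and tail: "\<And>\<omega> z D. sieve_dim_le k \<omega> \<Longrightarrow> z \<ge> 1 \<Longrightarrow>
    (\<Prod>p | prime p \<and> real p \<le> D \<and> z < real p. sieve_density \<omega> p)
      \<le> C * z powr (\<epsilon> / 2) * (\<Prod>p | prime p \<and> real p \<le> D. sieve_density \<omega> p)"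
    using sieve_product_tail_le[of "\<epsilon> / 2" k] \<epsilon> by auto
  define z0 where "z0 = (8 * real k)\<^sup>2"
  have z0: "z0 \<ge> 1" unfolding z0_def using k by (intro one_le_power) auto
  have sz0: "sqrt z0 = 8 * real k" by (simp only: z0_def real_sqrt_abs)
  define A where "A = 2 * C * z0 powr (\<epsilon> / 2)"
  have A: "A \<ge> 1"
  proof -
    have "1 * 1 \<le> (2 * C) * z0 powr (\<epsilon> / 2)"
      using C z0 \<epsilon> by (intro mult_mono) (auto intro: ge_one_powr_ge_zero)
    then show ?thesis by (simp add: A_def)
  qed
  have C1: "12 * A\<^sup>2 \<ge> 1" "6 * A \<le> 12 * A\<^sup>2"
    using A mult_mono[of 1 A 1 A] by (auto simp: power2_eq_square)
  show ?thesis
  proof (rule exI[of _ "12 * A\<^sup>2"], intro conjI allI impI)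
    fix \<omega> :: "nat \<Rightarrow> nat set" and N :: nat and Y :: "nat set" and D M :: real
    assume \<omega>: "sieve_dim_le k \<omega>" and N: "N \<ge> 2" and Y: "Y \<subseteq> {1..N}"
      and D: "D = real N powr (1 / (160 * real k))"
      and sift: "\<forall>n p. n \<in> Y \<longrightarrow> prime p \<longrightarrow> real p \<le> D \<longrightarrow> n mod p \<notin> \<omega> p"
      and M: "M = real N * (\<Prod>p | prime p \<and> real p \<le> D. sieve_density \<omega> p)"
    have M0: "M > 0" unfolding M using N sieve_density_pos[OF \<omega>] by (auto intro!: mult_pos_pos prod_pos)
    have inv: "real N / L \<le> A * (z / z0) powr (\<epsilon> / 2) * M"
      if "L > 0" "z \<ge> z0" "1 / L \<le> 2 * (\<Prod>p | prime p \<and> real p \<le> D \<and> z < real p. sieve_density \<omega> p)" for L z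
    proof -
      have "z \<ge> 1" using that z0 by linarith
      have "1 / L \<le> 2 * (C * z powr (\<epsilon> / 2) * (\<Prod>p | prime p \<and> real p \<le> D. sieve_density \<omega> p))"
        using that(3) tail[OF \<omega> \<open>z \<ge> 1\<close>, of D] by linarith
      then have "real N * (1 / L) \<le> real N * (2 * (C * z powr (\<epsilon> / 2) * (\<Prod>p | prime p \<and> real p \<le> D. sieve_density \<omega> p)))"
        by (intro mult_left_mono) auto
      also have "\<dots> = 2 * C * (z0 * (z / z0)) powr (\<epsilon> / 2) * M" using z0 by (simp add: M)
      also have "(z0 * (z / z0)) powr (\<epsilon> / 2) = z0 powr (\<epsilon> / 2) * (z / z0) powr (\<epsilon> / 2)"
        by (rule powr_mult)
      finally show ?thesis by (simp add: A_def mult_ac)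
    qed
    \<comment> \<open>With the limit \<open>z0\<close> the kernel term is at most
      \<open>5 * N\<close>, whence the constant 6.\<close>
    have card: "real (card Y) \<le> 6 * A * M"
    proof -
      obtain b L where bL: "L > 0 \<and>
        1 / L \<le> 2 * (\<Prod>p | prime p \<and> real p \<le> D \<and> z0 < real p. sieve_density \<omega> p) \<and>
        (\<forall>n. b n \<ge> 0) \<and> (\<forall>n\<in>Y. b n \<ge> L) \<and>
        (\<forall>\<theta>. norm (\<Sum>n\<in>{1..N}. complex_of_real (b n - 1) * e (real n * \<theta>)) \<le> 5 * real N / sqrt z0)"
        using Selberg_sieve[OF k \<omega> eq_refl[OF z0_def[symmetric]] N D sift] by (elim exE)
      have b: "L > 0"
        "1 / L \<le> 2 * (\<Prod>p | prime p \<and> real p \<le> D \<and> z0 < real p. sieve_density \<omega> p)"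
        "\<And>n. b n \<ge> 0" "\<And>n. n \<in> Y \<Longrightarrow> b n \<ge> L"
        "\<And>\<theta>. norm (\<Sum>n\<in>{1..N}. complex_of_real (b n - 1) * e (real n * \<theta>)) \<le> 5 * real N / sqrt z0"
        using bL by blast+
      have "L * real (card Y) \<le> real N + 5 * real N / sqrt z0"
        by (rule card_le_kernel[OF Y b(3,4,5)])
      also have "5 * real N / sqrt z0 \<le> 5 * real N" using k frac_le[of "5 * real N" "5 * real N" 1 "sqrt z0"] by (simp add: sz0)
      finally have "real (card Y) \<le> 6 * (real N / L)" using b(1) by (simp add: field_simps)
      also have "real N / L \<le> A * (z0 / z0) powr (\<epsilon> / 2) * M" by (rule inv[OF b(1) _ b(2)]) simp
      finally show ?thesis using z0 by simp
    qed
    also have "\<dots> \<le> 12 * A\<^sup>2 * M" using C1 M0 by (intro mult_right_mono) auto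
    finally show "real (card Y) \<le> 12 * A\<^sup>2 * M" .
    fix t :: real assume t: "t > 0"
    define m where "m = measure unit_measure {\<theta>\<in>{0..1}. t \<le> norm (\<Sum>n\<in>Y. e (real n * \<theta>))}"
    define R where "R = real N * m"
    have R0: "R \<ge> 0" by (simp add: R_def m_def)
    \<comment> \<open>Gives \<open>sqrt z = 8 * k * max 1 R\<close>, so that
      \<open>\<kappa> * m = 5 * R / sqrt z \<le> 1\<close>. The square is the reason for
      \<open>\<epsilon> / 2\<close> in the tail estimate. \<open>z\<close> may exceed
      \<open>D\<close>; then the sieve uses no prime and its weight is constantly 1.\<close>
    define z where "z = z0 * (max 1 R)\<^sup>2"
    have "1 \<le> (max 1 R)\<^sup>2" by (intro one_le_power) auto
    then have z: "z \<ge> z0" using z0 unfolding z_def by simp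
    have sz: "sqrt z = 8 * real k * max 1 R" by (simp add: z_def real_sqrt_mult sz0)
    obtain b L where bL: "L > 0 \<and>
      1 / L \<le> 2 * (\<Prod>p | prime p \<and> real p \<le> D \<and> z < real p. sieve_density \<omega> p) \<and>
      (\<forall>n. b n \<ge> 0) \<and> (\<forall>n\<in>Y. b n \<ge> L) \<and>
      (\<forall>\<theta>. norm (\<Sum>n\<in>{1..N}. complex_of_real (b n - 1) * e (real n * \<theta>)) \<le> 5 * real N / sqrt z)"
      using Selberg_sieve[OF k \<omega> z[unfolded z0_def] N D sift] by (elim exE)
    have b: "L > 0"
      "1 / L \<le> 2 * (\<Prod>p | prime p \<and> real p \<le> D \<and> z < real p. sieve_density \<omega> p)"
      "\<And>n. b n \<ge> 0" "\<And>n. n \<in> Y \<Longrightarrow> b n \<ge> L"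
      "\<And>\<theta>. norm (\<Sum>n\<in>{1..N}. complex_of_real (b n - 1) * e (real n * \<theta>)) \<le> 5 * real N / sqrt z"
      using bL by blast+
    have "t\<^sup>2 * m \<le> real (card Y) / L * (1 + 5 * real N / sqrt z * m)"
      unfolding m_def by (rule level_set_bound[OF Y b(3,4,1,5) t])
    also have "\<dots> \<le> real (card Y) / L * 2"
    proof (intro mult_left_mono)
      have "5 * real N * m \<le> sqrt z"
      proof -
        have "5 * R \<le> 8 * real k * max 1 R" using k R0 by (intro mult_mono) auto
        then show ?thesis by (simp add: sz R_def)
      qed
      moreover have "sqrt z > 0" using k by (simp add: sz)
      ultimately show "1 + 5 * real N / sqrt z * m \<le> 2" by (simp add: field_simps)
    qed (use b in auto)
    finally have "real N * (t\<^sup>2 * m) \<le> real N * (real (card Y) / L * 2)" by (intro mult_left_mono) auto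
    also have "\<dots> = 2 * real (card Y) * (real N / L)" by simp
    also have "\<dots> \<le> 2 * (6 * A * M) * (A * (z / z0) powr (\<epsilon> / 2) * M)"
      using card inv[OF b(1) z b(2)] b(1) A M0 by (intro mult_mono) auto
    also have "(z / z0) powr (\<epsilon> / 2) = max 1 R powr \<epsilon>"
    proof -
      have "z / z0 = max 1 R powr 2" using z0 by (simp add: z_def)
      then show ?thesis by (simp only: powr_powr) simp
    qed
    also have "2 * (6 * A * M) * (A * max 1 R powr \<epsilon> * M) = 12 * A\<^sup>2 * M\<^sup>2 * max 1 R powr \<epsilon>"
      by (simp add: power2_eq_square)
    finally show "t\<^sup>2 * (real N * measure unit_measure {\<theta>\<in>{0..1}. t \<le> norm (\<Sum>n\<in>Y. e (real n * \<theta>))})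
       \<le> 12 * A\<^sup>2 * M\<^sup>2 * (max 1 (real N * measure unit_measure {\<theta>\<in>{0..1}. t \<le> norm (\<Sum>n\<in>Y. e (real n * \<theta>))})) powr \<epsilon>"
      by (simp add: R_def m_def mult_ac)
  qed (use C1 in auto)
qed

lemma sifted_set_restriction:
  assumes k: "k \<ge> 1" and p: "p > 2"
  shows "\<exists>C>0. \<forall>\<omega> N Y D M. sieve_dim_le k \<omega> \<longrightarrow> N \<ge> 2 \<longrightarrow> Y \<subseteq> {1..N} \<longrightarrow>
    D = real N powr (1 / (160 * real k)) \<longrightarrow>
    (\<forall>n q. n \<in> Y \<longrightarrow> prime q \<longrightarrow> real q \<le> D \<longrightarrow> n mod q \<notin> \<omega> q) \<longrightarrow>
    M = real N * (\<Prod>q | prime q \<and> real q \<le> D. sieve_density \<omega> q) \<longrightarrow>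
    (LINT \<theta>|unit_measure. norm (\<Sum>n\<in>Y. e (real n * \<theta>)) powr p) \<le> C * M powr p / real N"
proof -
  \<comment> \<open>The midpoint of 2 and \<open>p\<close>. With
    \<open>\<epsilon> = 1 - 2 / q\<close>, the inequality
    \<open>R \<le> (C * M / t)\<^sup>2 * R powr \<epsilon>\<close> solves to
    \<open>R \<le> (C * M / t) powr q\<close>.\<close>
  define q where "q = (p + 2) / 2"
  define \<epsilon> where "\<epsilon> = 1 - 2 / q"
  have q: "2 < q" "q < p" using p by (auto simp: q_def)
  have \<epsilon>: "\<epsilon> > 0" using q by (simp add: \<epsilon>_def)
  from sifted_set_level_sets[OF k \<epsilon>] obtain C where C: "C \<ge> 1" and
    lev: "\<forall>\<omega> N Y D M. sieve_dim_le k \<omega> \<longrightarrow> N \<ge> 2 \<longrightarrow> Y \<subseteq> {1..N} \<longrightarrow>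
    D = real N powr (1 / (160 * real k)) \<longrightarrow>
    (\<forall>n p. n \<in> Y \<longrightarrow> prime p \<longrightarrow> real p \<le> D \<longrightarrow> n mod p \<notin> \<omega> p) \<longrightarrow>
    M = real N * (\<Prod>p | prime p \<and> real p \<le> D. sieve_density \<omega> p) \<longrightarrow>
    real (card Y) \<le> C * M \<and>
    (\<forall>t>0. t\<^sup>2 * (real N * measure unit_measure {\<theta>\<in>{0..1}. t \<le> norm (\<Sum>n\<in>Y. e (real n * \<theta>))})
       \<le> C * M\<^sup>2 * (max 1 (real N * measure unit_measure {\<theta>\<in>{0..1}. t \<le> norm (\<Sum>n\<in>Y. e (real n * \<theta>))})) powr \<epsilon>)"
    by (elim exE conjE)
  define c where "c = 2 powr q / (1 - 2 powr (q - p))"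
  have c: "c > 0" using q by (auto simp: c_def powr_less_one)
  show ?thesis
  proof (rule exI[of _ "c * C powr p"], intro conjI allI impI)
    show "0 < c * C powr p" using c C by simp
    fix \<omega> :: "nat \<Rightarrow> nat set" and N :: nat and Y :: "nat set" and D M :: real
    assume \<omega>: "sieve_dim_le k \<omega>" and N: "N \<ge> 2" and Y: "Y \<subseteq> {1..N}"
      and D: "D = real N powr (1 / (160 * real k))"
      and sift: "\<forall>n p. n \<in> Y \<longrightarrow> prime p \<longrightarrow> real p \<le> D \<longrightarrow> n mod p \<notin> \<omega> p"
      and M: "M = real N * (\<Prod>p | prime p \<and> real p \<le> D. sieve_density \<omega> p)"
    have M0: "M > 0" unfolding M using N sieve_density_pos[OF \<omega>] by (auto intro!: mult_pos_pos prod_pos)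
    have N0: "real N > 0" using N by simp
    have CM: "C * M > 0" using C M0 by simp
    define h where "h \<theta> = norm (\<Sum>n\<in>Y. e (real n * \<theta>))" for \<theta>
    define m where "m t = measure unit_measure {\<theta>\<in>{0..1}. t \<le> h \<theta>}" for t
    have cardY: "real (card Y) \<le> C * M"
      and lv: "t\<^sup>2 * (real N * m t) \<le> C * M\<^sup>2 * (max 1 (real N * m t)) powr \<epsilon>" if "t > 0" for t
      using lev[THEN spec, THEN spec, THEN spec, THEN spec, THEN spec, THEN mp, OF \<omega>, THEN mp, OF N,
        THEN mp, OF Y, THEN mp, OF D, THEN mp, OF sift, THEN mp, OF M] that
      unfolding m_def h_def by auto
    have hle: "h \<theta> \<le> C * M" for \<theta>
    proof -
      have "h \<theta> \<le> (\<Sum>n\<in>Y. 1)" unfolding h_def by (intro order_trans[OF norm_sum] sum_mono) auto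
      then show ?thesis using cardY[of 1] by simp
    qed
    have weak: "m t \<le> (C * M) powr q / real N * t powr (- q)" if t: "t > 0" for t
    proof (cases "m t = 0")
      case True
      then show ?thesis by simp
    next
      case False
      define R where "R = real N * m t"
      have R: "R > 0" using False N0 by (simp add: R_def m_def zero_less_measure_iff)
      have tCM: "t \<le> C * M"
      proof (rule ccontr)
        assume "\<not> t \<le> C * M"
        then have "{\<theta>\<in>{0..1}. t \<le> h \<theta>} = {}" using hle by (auto simp: not_le intro: le_less_trans)
        then show False using False unfolding m_def by (simp only: measure_empty)
      qed
      \<comment> \<open>For \<open>R \<le> 1\<close> the right side is at least 1 because
        \<open>t \<le> C * M\<close>, which comes from the trivial bound of the exponential sum by
        \<open>card Y\<close>.\<close>
      have "R \<le> (C * M / t) powr q"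
      proof (cases "R \<le> 1")
        case True
        also have "1 \<le> (C * M / t) powr q" using tCM t q by (intro ge_one_powr_ge_zero) auto
        finally show ?thesis .
      next
        case False
        then have "t\<^sup>2 * R \<le> C * M\<^sup>2 * R powr \<epsilon>" using lv[OF t] by (simp add: R_def[symmetric])
        also have "\<dots> \<le> C\<^sup>2 * M\<^sup>2 * R powr \<epsilon>"
          using C by (intro mult_right_mono) (auto simp: power2_eq_square)
        finally have "R \<le> (C * M / t)\<^sup>2 * R powr \<epsilon>" using t by (simp add: field_simps power_mult_distrib power_divide)
        then have "R / R powr \<epsilon> \<le> (C * M / t)\<^sup>2" using R by (simp add: field_simps)
        moreover have "R / R powr \<epsilon> = R powr (2 / q)" using R by (simp add: \<epsilon>_def powr_diff)
        moreover have "(C * M / t)\<^sup>2 = (C * M / t) powr 2" using CM t by simp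
        ultimately have "R powr (2 / q) \<le> (C * M / t) powr 2" by simp
        then have "(R powr (2 / q)) powr (q / 2) \<le> ((C * M / t) powr 2) powr (q / 2)"
          using q by (intro powr_mono2) auto
        then show ?thesis using R q by (simp add: powr_powr)
      qed
      also have "(C * M / t) powr q = (C * M) powr q * t powr (- q)"
        using CM t by (simp add: powr_divide powr_minus field_simps)
      finally show ?thesis using N0 by (simp add: R_def field_simps)
    qed
    have "(LINT \<theta>|unit_measure. h \<theta> powr p) \<le> c * ((C * M) powr q / real N) * (C * M) powr (p - q)"
      unfolding c_def
    proof (rule powr_integral_le_of_level_sets)
      have "(\<lambda>\<theta>. \<Sum>n\<in>Y. e (real n * \<theta>)) \<in> borel_measurable unit_measure"
        by (intro continuous_borel_measurable_unit continuous_intros)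
      then show "h \<in> borel_measurable unit_measure" unfolding h_def by simp
      show "measure unit_measure {\<theta>\<in>{0..1}. t \<le> h \<theta>} \<le> (C * M) powr q / real N * t powr (- q)" if "t > 0" for t
        using weak[OF that] by (simp add: m_def)
    qed (use hle CM q p in \<open>auto simp: h_def\<close>)
    also have "\<dots> = c * ((C * M) powr q * (C * M) powr (p - q)) / real N" by simp
    also have "(C * M) powr q * (C * M) powr (p - q) = C powr p * M powr p"
      unfolding powr_add[symmetric] using C M0 by (simp add: powr_mult)
    finally show "(LINT \<theta>|unit_measure. norm (\<Sum>n\<in>Y. e (real n * \<theta>)) powr p) \<le> c * C powr p * M powr p / real N"
      by (simp add: h_def mult.assoc)
  qed
qed

section \<open>The singular series and the main theorem\<close>

definition root_residues :: "(int \<Rightarrow> int) \<Rightarrow> nat \<Rightarrow> nat set" where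
  "root_residues F p = {r \<in> {..<p}. int p dvd F (int r)}"

lemma prime_dvd_linear_prod_iff:
  assumes "prime p"
  shows "int p dvd linear_prod k a b n \<longleftrightarrow> (\<exists>j\<in>{1..k}. int p dvd a j * n + b j)"
  using assms by (simp add: linear_prod_def prime_dvd_prod_iff)

lemma dvd_linear_mod_iff: "(p::int) dvd x * (n mod p) + y \<longleftrightarrow> p dvd x * n + y"
proof -
  have "x * n = x * (p * (n div p)) + x * (n mod p)" by (metis distrib_left mult_div_mod_eq)
  then have "x * n + y = (x * (n mod p) + y) + p * (x * (n div p))" by (simp only: mult_ac add_ac)
  then show ?thesis by (simp only: dvd_add_left_iff[OF dvd_triv_left])
qed

lemma dvd_linear_prod_mod_iff:
  assumes "prime p"
  shows "int p dvd linear_prod k a b (n mod int p) \<longleftrightarrow> int p dvd linear_prod k a b n"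
  using assms by (simp add: prime_dvd_linear_prod_iff dvd_linear_mod_iff)

lemma mod_in_root_residues_iff:
  assumes "prime p"
  shows "n mod p \<in> root_residues (linear_prod k a b) p \<longleftrightarrow> int p dvd linear_prod k a b (int n)"
  using assms dvd_linear_prod_mod_iff[OF assms, of k a b "int n"] prime_gt_0_nat[OF assms]
  by (auto simp: root_residues_def zmod_int)

lemma local_density_eq_sieve_density:
  assumes p: "prime p"
  shows "local_density F p = sieve_density (root_residues F) p"
proof -
  let ?S = "{0..<int p}"
  have "{n \<in> ?S. gcd (int p) (F n) = 1} = ?S - {n \<in> ?S. int p dvd F n}"
  proof -
    have "gcd (int p) x = 1 \<longleftrightarrow> \<not> int p dvd x" for x
    proof
      assume "gcd (int p) x = 1"
      then show "\<not> int p dvd x" using prime_gt_1_nat[OF p] by (auto simp: gcd_proj1_iff)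
    next
      assume "\<not> int p dvd x"
      then have "coprime (int p) x" using p by (intro prime_imp_coprime) auto
      then show "gcd (int p) x = 1" by simp
    qed
    then have iff: "gcd (int p) (F n) = 1 \<longleftrightarrow> \<not> int p dvd F n" for n .
    show ?thesis unfolding iff by blast
  qed
  moreover have "{n \<in> ?S. int p dvd F n} = int ` root_residues F p"
  proof (intro equalityI subsetI)
    fix n assume n: "n \<in> {n \<in> ?S. int p dvd F n}"
    then have "n = int (nat n)" "nat n \<in> root_residues F p" by (auto simp: root_residues_def)
    then show "n \<in> int ` root_residues F p" by blast
  qed (auto simp: root_residues_def)
  ultimately have "card {n \<in> ?S. gcd (int p) (F n) = 1} = card (?S - int ` root_residues F p)" by simp
  also have "\<dots> = p - card (root_residues F p)"
    by (subst card_Diff_subset) (auto simp: root_residues_def card_image)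
  finally have "card {n \<in> ?S. gcd (int p) (F n) = 1} = p - card (root_residues F p)" .
  moreover have "card (root_residues F p) \<le> p"
    using card_mono[of "{..<p}" "root_residues F p"] by (auto simp: root_residues_def)
  ultimately show ?thesis using prime_gt_0_nat[OF p]
    by (simp add: local_density_def sieve_density_def of_nat_diff field_simps)
qed

text \<open>If one form had two roots modulo \<open>p\<close>, then \<open>p\<close> would divide
  \<open>a j\<close> and hence \<open>b j\<close>, and every residue would be a root of the product;
  positivity of the local density at \<open>p\<close> excludes this. So each form contributes at
  most one root, also when \<open>p\<close> divides \<open>a j\<close>.\<close>

lemma sieve_dim_le_root_residues:
  assumes pos: "\<forall>q\<ge>1. local_density (linear_prod k a b) q > 0"
  shows "sieve_dim_le k (root_residues (linear_prod k a b))"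
  unfolding sieve_dim_le_def
proof (intro allI impI conjI)
  fix p :: nat assume p: "prime p"
  let ?\<omega> = "root_residues (linear_prod k a b)"
  show "?\<omega> p \<subseteq> {..<p}" by (auto simp: root_residues_def)
  have "sieve_density ?\<omega> p > 0"
    using pos prime_ge_1_nat[OF p] local_density_eq_sieve_density[OF p, of "linear_prod k a b"] by auto
  then show lt: "card (?\<omega> p) < p" using prime_gt_0_nat[OF p] by (simp add: sieve_density_def)
  have one: "card {r\<in>{..<p}. int p dvd a j * int r + b j} \<le> 1" if j: "j \<in> {1..k}" for j
  proof (rule ccontr)
    assume "\<not> card {r\<in>{..<p}. int p dvd a j * int r + b j} \<le> 1"
    then obtain r s where rs: "r < p" "s < p" "r \<noteq> s" "int p dvd a j * int r + b j" "int p dvd a j * int s + b j"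
      by (subst (asm) card_le_Suc0_iff_eq[unfolded One_nat_def[symmetric]]) auto
    have "int p dvd (a j * int r + b j) - (a j * int s + b j)" using rs by (intro dvd_diff) auto
    then have "int p dvd a j * (int r - int s)" by (simp add: algebra_simps)
    then have "int p dvd a j \<or> int p dvd int r - int s" using p by (subst (asm) prime_dvd_mult_iff) auto
    moreover have "\<not> int p dvd int r - int s"
    proof
      assume "int p dvd int r - int s"
      then have "int p \<le> \<bar>int r - int s\<bar>" using rs dvd_imp_le_int[of "int r - int s" "int p"] by auto
      then show False using rs by linarith
    qed
    ultimately have pa: "int p dvd a j" by simp
    then have "int p dvd b j" using rs(4) by (metis dvd_add_right_iff dvd_mult2)
    then have "int p dvd a j * n + b j" for n using pa by auto
    then have "int p dvd linear_prod k a b n" for n using j unfolding prime_dvd_linear_prod_iff[OF p] by blast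
    then have "?\<omega> p = {..<p}" by (auto simp: root_residues_def)
    then show False using lt by simp
  qed
  have "?\<omega> p \<subseteq> (\<Union>j\<in>{1..k}. {r\<in>{..<p}. int p dvd a j * int r + b j})"
    by (auto simp: root_residues_def prime_dvd_linear_prod_iff[OF p])
  then have "card (?\<omega> p) \<le> card (\<Union>j\<in>{1..k}. {r\<in>{..<p}. int p dvd a j * int r + b j})"
    by (intro card_mono) auto
  also have "\<dots> \<le> (\<Sum>j\<in>{1..k}. card {r\<in>{..<p}. int p dvd a j * int r + b j})"
    by (intro card_UN_le) auto
  also have "\<dots> \<le> (\<Sum>j\<in>{1..k}. 1)" using one by (intro sum_mono) auto
  finally show "card (?\<omega> p) \<le> k" by simp
qed

text \<open>Each form has a root since \<open>a j\<close> is invertible modulo \<open>p\<close>. A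
  common root \<open>r\<close> of two forms would make \<open>p\<close> divide \<open>a i * (a j * r
  + b j) - a j * (a i * r + b i) = a i * b j - a j * b i\<close>, a factor of the
  discriminant.\<close>

lemma card_root_residues_ge:
  assumes p: "prime p" and a: "\<And>j. j \<in> {1..k} \<Longrightarrow> \<not> int p dvd a j"
    and disc: "\<not> int p dvd discriminant k a b"
  shows "k \<le> card (root_residues (linear_prod k a b) p)"
proof -
  have "\<exists>r<p. int p dvd a j * int r + b j" if j: "j \<in> {1..k}" for j
  proof -
    have "coprime (int p) (a j)" using p a[OF j] by (intro prime_imp_coprime) auto
    then have "gcd (a j) (int p) = 1" by (simp add: gcd.commute coprime_iff_gcd_eq_1)
    then obtain u v where uv: "u * a j + v * int p = 1" using bezout_int[of "a j" "int p"] by auto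
    define r where "r = nat ((- b j * u) mod int p)"
    have r: "int r = (- b j * u) mod int p" using prime_gt_0_nat[OF p] by (simp add: r_def)
    have "a j * (- b j * u) + b j = b j * (1 - u * a j)" by (simp add: algebra_simps)
    also have "1 - u * a j = v * int p" using uv by linarith
    finally have "int p dvd a j * (- b j * u) + b j" by simp
    then have "int p dvd a j * int r + b j" unfolding r by (simp only: dvd_linear_mod_iff)
    moreover have "int r < int p" unfolding r using prime_gt_0_nat[OF p] by (intro pos_mod_bound) simp
    then have "r < p" by simp
    ultimately show ?thesis by blast
  qed
  then obtain r where r: "\<And>j. j \<in> {1..k} \<Longrightarrow> r j < p \<and> int p dvd a j * int (r j) + b j" by metis
  have neq: "r i \<noteq> r j" if ij: "i \<in> {1..k}" "j \<in> {1..k}" "i < j" for i j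
  proof
    assume eq: "r i = r j"
    have "int p dvd a i * (a j * int (r j) + b j) - a j * (a i * int (r i) + b i)"
      using r ij by (intro dvd_diff dvd_mult) auto
    then have "int p dvd a i * b j - a j * b i" by (simp add: eq algebra_simps)
    moreover have "a i * b j - a j * b i dvd discriminant k a b"
    proof -
      have "finite {(i, j). 1 \<le> i \<and> i < j \<and> j \<le> k}"
        by (rule finite_subset[of _ "{1..k} \<times> {1..k}"]) auto
      then have "(case (i, j) of (i, j) \<Rightarrow> a i * b j - a j * b i) dvd discriminant k a b"
        unfolding discriminant_def using ij by (intro dvd_prodI) auto
      then show ?thesis by simp
    qed
    ultimately show False using disc dvd_trans by blast
  qed
  have "inj_on r {1..k}"
    by (rule inj_onI) (metis neq linorder_neqE_nat)
  then have "k = card (r ` {1..k})" by (simp add: card_image)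
  also have "\<dots> \<le> card (root_residues (linear_prod k a b) p)"
  proof (rule card_mono)
    show "r ` {1..k} \<subseteq> root_residues (linear_prod k a b) p"
      using r unfolding root_residues_def prime_dvd_linear_prod_iff[OF p] by blast
  qed (simp add: root_residues_def)
  finally show ?thesis .
qed

section \<open>Euler factors of the singular series\<close>

definition series_factor :: "nat \<Rightarrow> (nat \<Rightarrow> nat set) \<Rightarrow> nat \<Rightarrow> real" where
  "series_factor k \<omega> p = (if prime p then sieve_density \<omega> p * inverse (1 - 1 / real p) ^ k else 1)"

lemma singular_series_eq:
  "singular_series k F = (\<Prod>p. series_factor k (root_residues F) p)"
  unfolding singular_series_def
  by (intro prodinf_cong) (simp add: series_factor_def local_density_eq_sieve_density power_int_minus power_inverse)

lemma inverse_power_ge_1: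
  assumes "prime p"
  shows "inverse (1 - 1 / real p) ^ k \<ge> 1"
proof (rule one_le_power)
  have "real p \<ge> 2" using prime_ge_2_nat[OF assms] by simp
  then show "1 \<le> inverse (1 - 1 / real p)" by (simp add: field_simps)
qed

text \<open>The bound is \<open>(1 - k / p) * (1 + k / p)\<close>, the second factor by Bernoulli's
  inequality. Primes dividing the discriminant are included, as fewer roots only raise the density;
  this keeps the constants independent of \<open>F\<close>.\<close>

lemma series_factor_ge:
  assumes \<omega>: "sieve_dim_le k \<omega>" and p: "prime p" "k < p"
  shows "1 - (real k)\<^sup>2 / (real p)\<^sup>2 \<le> series_factor k \<omega> p"
proof -
  have p2: "real p \<ge> 2" using prime_ge_2_nat[OF p(1)] by simp
  have kp: "real k / real p \<le> 1" using p by simp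
  have "1 + real k / real p \<le> (1 + 1 / real p) ^ k"
    using Bernoulli_inequality[of "1 / real p" k] p2 by (simp add: order_trans[of "-1" 0])
  also have "\<dots> \<le> inverse (1 - 1 / real p) ^ k"
  proof (rule power_mono)
    have "1 - 1 / real p > 0" using p2 by simp
    moreover have "(1 + 1 / real p) * (1 - 1 / real p) \<le> 1" by (simp add: algebra_simps)
    ultimately show "1 + 1 / real p \<le> inverse (1 - 1 / real p)" by (simp add: inverse_eq_divide pos_le_divide_eq)
  qed (use p2 in auto)
  finally have "(1 - real k / real p) * (1 + real k / real p) \<le> sieve_density \<omega> p * inverse (1 - 1 / real p) ^ k"
    using sieve_density_ge[OF \<omega> p(1)] sieve_density_pos[OF \<omega> p(1)] kp by (intro mult_mono) auto
  then show ?thesis using p by (simp add: series_factor_def algebra_simps power2_eq_square)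
qed

lemma series_factor_le_1:
  assumes p: "prime p" and card: "k \<le> card (\<omega> p)"
  shows "series_factor k \<omega> p \<le> 1"
proof -
  have p2: "real p \<ge> 2" using prime_ge_2_nat[OF p] by simp
  have "sieve_density \<omega> p \<le> 1 - real k / real p"
    using card by (simp add: sieve_density_def divide_right_mono)
  also have "\<dots> \<le> (1 - 1 / real p) ^ k"
    using Bernoulli_inequality[of "- 1 / real p" k] p2 by (simp add: field_simps)
  finally have "sieve_density \<omega> p * inverse (1 - 1 / real p) ^ k \<le> (1 - 1 / real p) ^ k * inverse (1 - 1 / real p) ^ k"
    using p2 by (intro mult_right_mono) auto
  also have "\<dots> = 1" using p2 by (simp add: power_mult_distrib[symmetric])
  finally show ?thesis using p by (simp add: series_factor_def)
qed

text \<open>Beyond \<open>B\<close> no prime divides the discriminant or a leading coefficient, so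
  the upper and lower bounds put the factor within \<open>k\<^sup>2 / p\<^sup>2\<close> of 1.
  \<open>B\<close> depends on \<open>F\<close>, but only the fact of convergence is carried on, not
  a rate.\<close>

lemma convergent_prod_series_factor:
  assumes a: "\<forall>j\<in>{1..k}. a j \<noteq> 0" and disc: "discriminant k a b \<noteq> 0"
    and pos: "\<forall>q\<ge>1. local_density (linear_prod k a b) q > 0"
  shows "convergent_prod (series_factor k (root_residues (linear_prod k a b)))"
proof -
  let ?\<omega> = "root_residues (linear_prod k a b)"
  have \<omega>: "sieve_dim_le k ?\<omega>" using pos by (rule sieve_dim_le_root_residues)
  define B where "B = k + nat \<bar>discriminant k a b\<bar> + (\<Sum>j\<in>{1..k}. nat \<bar>a j\<bar>)"
  have ev: "norm (series_factor k ?\<omega> p - 1) \<le> (real k)\<^sup>2 * (1 / (real p)\<^sup>2)" if p: "p > B" for p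
  proof (cases "prime p")
    case True
    have "\<not> int p dvd discriminant k a b"
      using p disc by (auto simp: B_def dest!: dvd_imp_le_int)
    moreover have "\<not> int p dvd a j" if j: "j \<in> {1..k}" for j
    proof
      assume "int p dvd a j"
      then have "int p \<le> \<bar>a j\<bar>" using a j dvd_imp_le_int[of "a j" "int p"] by auto
      moreover have "nat \<bar>a j\<bar> \<le> (\<Sum>j\<in>{1..k}. nat \<bar>a j\<bar>)" using j by (intro member_le_sum) auto
      ultimately show False using p by (simp add: B_def)
    qed
    ultimately have "k \<le> card (?\<omega> p)" by (intro card_root_residues_ge True)
    then have "series_factor k ?\<omega> p \<le> 1" by (intro series_factor_le_1 True)
    moreover have "1 - (real k)\<^sup>2 / (real p)\<^sup>2 \<le> series_factor k ?\<omega> p"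
      using p by (intro series_factor_ge \<omega> True) (simp add: B_def)
    ultimately show ?thesis by simp
  qed (simp add: series_factor_def)
  have "summable (\<lambda>p. norm (series_factor k ?\<omega> p - 1))"
  proof (rule summable_comparison_test_ev)
    show "\<forall>\<^sub>F p in sequentially. norm (norm (series_factor k ?\<omega> p - 1)) \<le> (real k)\<^sup>2 * (1 / (real p)\<^sup>2)"
      using ev by (intro eventually_mono[OF eventually_gt_at_top[of B]]) auto
    show "summable (\<lambda>p. (real k)\<^sup>2 * (1 / (real p)\<^sup>2))"
      using inverse_power_summable[of 2, where 'a = real] by (intro summable_mult) (simp add: inverse_eq_divide)
  qed
  then have "abs_convergent_prod (series_factor k ?\<omega>)" by (simp add: abs_convergent_prod_conv_summable)
  then show ?thesis by (rule abs_convergent_prod_imp_convergent_prod)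
qed

text \<open>All factors lie in \<open>(0, 1]\<close>, so a finite product is at least the infinite
  one, which is positive. The value \<open>1 / k\<close> for \<open>i \<le> k\<close> reflects that
  a positive local density at a prime \<open>p \<le> k\<close> is at least \<open>1 / p\<close>.
  Running over all integers and not only primes merely lowers the constant.\<close>

lemma prod_one_minus_square_ge:
  assumes "k \<ge> 1"
  shows "\<exists>c>0. \<forall>S. finite S \<longrightarrow> c \<le> (\<Prod>i\<in>S. if i \<le> k then 1 / real k else 1 - (real k)\<^sup>2 / (real i)\<^sup>2)"
proof -
  define \<tau> where "\<tau> i = (if i \<le> k then 1 / real k else 1 - (real k)\<^sup>2 / (real i)\<^sup>2)" for i
  have \<tau>: "0 < \<tau> i \<and> \<tau> i \<le> 1" for i
  proof (cases "i \<le> k")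
    case False
    then have "(real k)\<^sup>2 < (real i)\<^sup>2" by (intro power_strict_mono) auto
    then show ?thesis using False by (simp add: \<tau>_def divide_less_eq)
  qed (use assms in \<open>auto simp: \<tau>_def\<close>)
  have "summable (\<lambda>i. norm (\<tau> i - 1))"
  proof (rule summable_comparison_test_ev)
    show "\<forall>\<^sub>F i in sequentially. norm (norm (\<tau> i - 1)) \<le> (real k)\<^sup>2 * (1 / (real i)\<^sup>2)"
      by (rule eventually_mono[OF eventually_gt_at_top[of k]]) (simp add: \<tau>_def)
    show "summable (\<lambda>i. (real k)\<^sup>2 * (1 / (real i)\<^sup>2))"
      using inverse_power_summable[of 2, where 'a = real] by (intro summable_mult) (simp add: inverse_eq_divide)
  qed
  then have "abs_convergent_prod \<tau>" by (simp add: abs_convergent_prod_conv_summable)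
  then have conv: "convergent_prod \<tau>" by (rule abs_convergent_prod_imp_convergent_prod)
  define c where "c = prodinf \<tau>"
  have lim: "(\<lambda>n. \<Prod>i\<le>n. \<tau> i) \<longlonglongrightarrow> c" unfolding c_def by (rule convergent_prod_LIMSEQ[OF conv])
  have "c \<noteq> 0" unfolding c_def using conv \<tau> by (intro prodinf_nonzero) (auto simp: less_imp_neq[THEN not_sym])
  moreover have P0: "0 \<le> (\<Prod>i\<le>n. \<tau> i)" for n using \<tau> by (intro prod_nonneg) (auto intro: less_imp_le)
  then have "c \<ge> 0" by (intro LIMSEQ_le_const[OF lim]) blast
  ultimately have c: "c > 0" by simp
  have dec: "decseq (\<lambda>n. \<Prod>i\<le>n. \<tau> i)"
    using mult_left_le[OF conjunct2[OF \<tau>] P0] by (intro decseq_SucI) simp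
  have "c \<le> (\<Prod>i\<in>S. \<tau> i)" if S: "finite S" for S
  proof -
    obtain n where n: "S \<subseteq> {..n}" using S finite_nat_set_iff_bounded_le[of S] by auto
    have "c \<le> (\<Prod>i\<le>n. \<tau> i)" using decseq_ge[OF dec lim] .
    also have "\<dots> = (\<Prod>i\<in>{..n} - S. \<tau> i) * (\<Prod>i\<in>S. \<tau> i)" using n by (intro prod.subset_diff) auto
    also have "\<dots> \<le> 1 * (\<Prod>i\<in>S. \<tau> i)"
      using \<tau> by (intro mult_right_mono prod_le_1 prod_nonneg) (auto intro: less_imp_le)
    finally show ?thesis by simp
  qed
  then show ?thesis using c unfolding \<tau>_def by blast
qed

text \<open>The primes above \<open>D\<close> contribute at least a constant, first in finite
  products and then in the limit. \<open>D\<close> is left free for two uses: at the sieve limit it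
  compares the density with the series, and at \<open>D = 1\<close>, where no prime occurs, it
  bounds the series itself from below.\<close>

lemma singular_series_ge:
  assumes "k \<ge> 1"
  shows "\<exists>c>0. \<forall>a b D. (\<forall>j\<in>{1..k}. a j \<noteq> 0) \<longrightarrow> discriminant k a b \<noteq> 0 \<longrightarrow>
    (\<forall>q\<ge>1. local_density (linear_prod k a b) q > 0) \<longrightarrow>
    c * (\<Prod>p | prime p \<and> real p \<le> D. series_factor k (root_residues (linear_prod k a b)) p)
      \<le> singular_series k (linear_prod k a b)"
proof -
  obtain c where c: "c > 0"
    "\<And>S. finite S \<Longrightarrow> c \<le> (\<Prod>i\<in>S. if i \<le> k then 1 / real k else 1 - (real k)\<^sup>2 / (real i)\<^sup>2)"
    using prod_one_minus_square_ge[OF assms] by blast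
  show ?thesis
  proof (rule exI[of _ c], intro conjI allI impI)
    fix a b :: "nat \<Rightarrow> int" and D :: real
    assume a: "\<forall>j\<in>{1..k}. a j \<noteq> 0" and disc: "discriminant k a b \<noteq> 0"
      and pos: "\<forall>q\<ge>1. local_density (linear_prod k a b) q > 0"
    define \<omega> where "\<omega> = root_residues (linear_prod k a b)"
    have \<omega>: "sieve_dim_le k \<omega>" unfolding \<omega>_def using pos by (rule sieve_dim_le_root_residues)
    define s where "s = series_factor k \<omega>"
    define \<tau> where "\<tau> i = (if i \<le> k then 1 / real k else 1 - (real k)\<^sup>2 / (real i)\<^sup>2)" for i
    have \<tau>0: "0 \<le> \<tau> i" for i
    proof (cases "i \<le> k")
      case False
      then have "(real k)\<^sup>2 \<le> (real i)\<^sup>2" by (intro power_mono) auto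
      then show ?thesis using False by (simp add: \<tau>_def divide_le_eq)
    qed (auto simp: \<tau>_def)
    have s\<tau>: "\<tau> p \<le> s p" if p: "prime p" for p
    proof (cases "p \<le> k")
      case True
      have "1 / real k * 1 \<le> sieve_density \<omega> p * inverse (1 - 1 / real p) ^ k"
      proof (rule mult_mono)
        have "1 / real k \<le> 1 / real p" using True prime_gt_0_nat[OF p] by (intro divide_left_mono) auto
        then show "1 / real k \<le> sieve_density \<omega> p" using sieve_density_ge_inverse[OF \<omega> p] by linarith
      qed (use inverse_power_ge_1[OF p] sieve_density_pos[OF \<omega> p] in auto)
      then show ?thesis using True p by (simp add: s_def \<tau>_def series_factor_def)
    next
      case False
      then show ?thesis using series_factor_ge[OF \<omega> p] by (simp add: s_def \<tau>_def)
    qed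
    have s0: "0 \<le> s p" if "prime p" for p using s\<tau>[OF that] \<tau>0[of p] by linarith
    let ?P = "{p. prime p \<and> real p \<le> D}"
    have conv: "convergent_prod s" unfolding s_def \<omega>_def using a disc pos by (rule convergent_prod_series_factor)
    have lim: "(\<lambda>n. \<Prod>i\<le>n. s i) \<longlonglongrightarrow> prodinf s" by (rule convergent_prod_LIMSEQ[OF conv])
    have "c * (\<Prod>p\<in>?P. s p) \<le> (\<Prod>i\<le>n. s i)" if n: "n \<ge> nat \<lceil>D\<rceil>" for n
    proof -
      let ?R = "{p. prime p \<and> p \<le> n} - ?P"
      have sub: "?P \<subseteq> {p. prime p \<and> p \<le> n}" 
      proof
        fix p assume p: "p \<in> ?P"
        have "real p \<le> D" using p by simp
        also have "D \<le> real (nat \<lceil>D\<rceil>)" by (rule real_nat_ceiling_ge)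
        also have "\<dots> \<le> real n" using n by (rule of_nat_mono)
        finally show "p \<in> {p. prime p \<and> p \<le> n}" using p by simp
      qed
      have "(\<Prod>i\<le>n. s i) = (\<Prod>p | prime p \<and> p \<le> n. s p)"
        by (rule prod.mono_neutral_right) (auto simp: s_def series_factor_def)
      also have "\<dots> = (\<Prod>p\<in>?R. s p) * (\<Prod>p\<in>?P. s p)"
        using sub by (intro prod.subset_diff) auto
      also have "\<dots> \<ge> c * (\<Prod>p\<in>?P. s p)"
      proof (rule mult_right_mono)
        have "c \<le> (\<Prod>p\<in>?R. \<tau> p)" unfolding \<tau>_def by (rule c(2)) auto
        also have "\<dots> \<le> (\<Prod>p\<in>?R. s p)" using s\<tau> \<tau>0 by (intro prod_mono) auto
        finally show "c \<le> (\<Prod>p\<in>?R. s p)" .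
        show "0 \<le> (\<Prod>p\<in>?P. s p)" using s0 by (intro prod_nonneg) auto
      qed
      finally show ?thesis .
    qed
    then have "c * (\<Prod>p\<in>?P. s p) \<le> prodinf s" by (intro LIMSEQ_le_const[OF lim]) blast
    then show "c * (\<Prod>p | prime p \<and> real p \<le> D. series_factor k (root_residues (linear_prod k a b)) p)
      \<le> singular_series k (linear_prod k a b)"
      by (simp add: s_def \<omega>_def singular_series_eq)
  qed (rule c)
qed

text \<open>The two products of local terms differ by the \<open>k\<close>-th power of the Mertens
  product, which is at least \<open>ln D ^ k\<close>; in the application \<open>ln D\<close> is a
  fixed multiple of \<open>ln N\<close>.\<close>

lemma series_factor_prod_ge:
  assumes \<omega>: "sieve_dim_le k \<omega>" and D: "D \<ge> 1"
  shows "(\<Prod>p | prime p \<and> real p \<le> D. sieve_density \<omega> p) * ln D ^ k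
    \<le> (\<Prod>p | prime p \<and> real p \<le> D. series_factor k \<omega> p)"
proof -
  let ?P = "{p. prime p \<and> real p \<le> D}"
  have "(\<Prod>p\<in>?P. series_factor k \<omega> p) = (\<Prod>p\<in>?P. sieve_density \<omega> p * inverse (1 - 1 / real p) ^ k)"
    by (intro prod.cong) (auto simp: series_factor_def)
  also have "\<dots> = (\<Prod>p\<in>?P. sieve_density \<omega> p) * (\<Prod>p\<in>?P. inverse (1 - 1 / real p)) ^ k"
    by (simp only: prod.distrib prod_power_distrib)
  also have "\<dots> \<ge> (\<Prod>p\<in>?P. sieve_density \<omega> p) * ln D ^ k"
    using D ln_le_prod_primes[OF D] sieve_density_pos[OF \<omega>]
    by (intro mult_left_mono power_mono prod_nonneg) (auto intro: less_imp_le)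
  finally show ?thesis .
qed

text \<open>If all \<open>k\<close> linear factors exceed \<open>D \<ge> 1\<close>, each has at least one prime factor, hence exactly one, so every
  prime factor of the product exceeds \<open>D\<close>.\<close>

lemma product_of_primes_small_factor:
  assumes P: "size P = k" "\<forall>q\<in>#P. prime q" "linear_prod k a b n = prod_mset P"
    and p: "prime p" "real p \<le> D" "int p dvd linear_prod k a b n" and D: "D \<ge> 1"
  shows "\<exists>j\<in>{1..k}. of_int \<bar>a j * n + b j\<bar> \<le> D"
proof (rule ccontr)
  assume "\<not> (\<exists>j\<in>{1..k}. of_int \<bar>a j * n + b j\<bar> \<le> D)"
  then have big: "of_int \<bar>a j * n + b j\<bar> > D" if "j \<in> {1..k}" for j using that by force
  define x where "x j = a j * n + b j" for j
  have x0: "x j \<noteq> 0" "\<not> is_unit (x j)" if "j \<in> {1..k}" for j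
  proof -
    have "real_of_int \<bar>x j\<bar> > 1" using big[OF that] D unfolding x_def by linarith
    then have "\<bar>x j\<bar> > 1" by linarith
    then show "x j \<noteq> 0" "\<not> is_unit (x j)" by auto
  qed
  have "prime_factorization (\<Prod>j\<in>{1..k}. x j) = (\<Sum>j\<in>{1..k}. prime_factorization (x j))"
    using x0 by (intro prime_factorization_prod) auto
  moreover have size_sum: "size (\<Sum>j\<in>{1..k}. prime_factorization (x j)) = (\<Sum>j\<in>{1..k}. size (prime_factorization (x j)))"
    by (induction k) simp_all
  moreover have "prime_factorization (\<Prod>j\<in>{1..k}. x j) = P"
    using P by (simp add: linear_prod_def x_def prime_factorization_prod_mset_primes)
  ultimately have "size P = (\<Sum>j\<in>{1..k}. size (prime_factorization (x j)))" by (simp only: size_sum)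
  then have sum: "(\<Sum>j\<in>{1..k}. size (prime_factorization (x j))) = (\<Sum>j\<in>{1..k}. 1)" using P(1) by simp
  have ge: "1 \<le> size (prime_factorization (x j))" if "j \<in> {1..k}" for j
    using x0[OF that] by (simp add: Suc_le_eq prime_factorization_empty_iff nonempty_has_size[symmetric])
  obtain j where j: "j \<in> {1..k}" "int p dvd x j"
    using p(3) by (auto simp: prime_dvd_linear_prod_iff[OF p(1)] x_def)
  have "size (prime_factorization (x j)) = 1"
    using sum_mono_inv[OF sum[symmetric] ge j(1)] by simp
  then obtain q where q: "prime_factorization (x j) = {#q#}" using size_1_singleton_mset by blast
  \<comment> \<open>\<open>normalize\<close> is the absolute value: a form may be negative at
    \<open>n\<close>, while the primes of \<open>P\<close> are positive.\<close>
  have "normalize (x j) = prod_mset (prime_factorization (x j))"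
    using x0[OF j(1)] by (simp add: prod_mset_prime_factorization)
  then have xq: "\<bar>x j\<bar> = q" by (simp add: q)
  have "int p \<in> prime_factors (x j)" using p(1) j(2) x0[OF j(1)] by (simp add: in_prime_factors_iff)
  then have "int p = q" by (simp add: q)
  then show False using xq big[OF j(1)] p(2) by (simp add: x_def)
qed

lemma card_small_linear_values:
  assumes "x \<noteq> (0::int)" "D \<ge> 0"
  shows "real (card {n::nat. n \<le> N \<and> of_int \<bar>x * int n + y\<bar> \<le> D}) \<le> 2 * D + 1"
proof -
  let ?S = "{n::nat. n \<le> N \<and> of_int \<bar>x * int n + y\<bar> \<le> D}"
  have "(\<lambda>n. x * int n + y) ` ?S \<subseteq> {-\<lfloor>D\<rfloor>..\<lfloor>D\<rfloor>}"
  proof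
    fix t assume "t \<in> (\<lambda>n. x * int n + y) ` ?S"
    then have "\<bar>t\<bar> \<le> \<lfloor>D\<rfloor>" unfolding le_floor_iff by auto
    then show "t \<in> {-\<lfloor>D\<rfloor>..\<lfloor>D\<rfloor>}" by auto
  qed
  then have "card ((\<lambda>n. x * int n + y) ` ?S) \<le> card {-\<lfloor>D\<rfloor>..\<lfloor>D\<rfloor>}" by (intro card_mono) auto
  moreover have "inj_on (\<lambda>n. x * int n + y) ?S" using assms by (auto intro!: inj_onI)
  ultimately have "card ?S \<le> nat (2 * \<lfloor>D\<rfloor> + 1)" by (simp add: card_image)
  then have "real (card ?S) \<le> real (nat (2 * \<lfloor>D\<rfloor> + 1))" by simp
  also have "\<dots> = 2 * of_int \<lfloor>D\<rfloor> + 1" using assms(2) by simp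
  also have "\<dots> \<le> 2 * D + 1" by simp
  finally show ?thesis .
qed

text \<open>\<open>ln y \<le> y\<close> at \<open>y = x powr (1 / (4 * k))\<close>, an exponent
  chosen so that the \<open>k\<close>-th power costs only \<open>x powr (1 / 4)\<close>.\<close>

lemma ln_power_le:
  assumes "k \<ge> 1" "x \<ge> 1"
  shows "ln x ^ k \<le> (4 * real k) ^ k * x powr (1 / 4)"
proof -
  have "ln (x powr (1 / (4 * real k))) \<le> x powr (1 / (4 * real k))"
    using assms by (intro less_imp_le ln_less_self) auto
  then have "ln x \<le> 4 * real k * x powr (1 / (4 * real k))"
    using assms by (simp add: ln_powr field_simps)
  then have "ln x ^ k \<le> (4 * real k * x powr (1 / (4 * real k))) ^ k"
    using assms by (intro power_mono) auto
  also have "\<dots> = (4 * real k) ^ k * x powr (1 / 4)"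
    using assms by (simp add: power_mult_distrib powr_realpow[symmetric] powr_powr)
  finally show ?thesis .
qed

theorem theorem1p1:
  fixes k :: nat and p :: real
  assumes "k \<ge> 1" and "p > 2"
  shows "\<exists>C::real. C > 0 \<and>
    (\<forall>(a :: nat \<Rightarrow> int) (b :: nat \<Rightarrow> int) (N :: nat).
       (\<forall>j\<in>{1..k}. a j \<noteq> 0) \<longrightarrow>
       discriminant k a b \<noteq> 0 \<longrightarrow>
       (\<forall>q\<ge>1. local_density (linear_prod k a b) q > 0) \<longrightarrow>
       N \<ge> 2 \<longrightarrow>
       (\<forall>j\<in>{1..k}. \<bar>a j\<bar> \<le> int N \<and> \<bar>b j\<bar> \<le> int N) \<longrightarrow>
       Lp_norm_circle p (exp_sum k N (linear_prod k a b))
         \<le> C * singular_series k (linear_prod k a b)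
             * real N powr (1 - 1 / p) * ln (real N) powi (- int k))"
proof -
  obtain C0 where C0: "C0 > 0" and restr: "\<forall>\<omega> N Y D M. sieve_dim_le k \<omega> \<longrightarrow> N \<ge> 2 \<longrightarrow> Y \<subseteq> {1..N} \<longrightarrow>
    D = real N powr (1 / (160 * real k)) \<longrightarrow>
    (\<forall>n q. n \<in> Y \<longrightarrow> prime q \<longrightarrow> real q \<le> D \<longrightarrow> n mod q \<notin> \<omega> q) \<longrightarrow>
    M = real N * (\<Prod>q | prime q \<and> real q \<le> D. sieve_density \<omega> q) \<longrightarrow>
    (LINT \<theta>|unit_measure. norm (\<Sum>n\<in>Y. e (real n * \<theta>)) powr p) \<le> C0 * M powr p / real N"
    using sifted_set_restriction[OF assms] by (elim exE conjE)
  obtain c where c: "c > 0" and sing: "\<forall>a b D. (\<forall>j\<in>{1..k}. a j \<noteq> 0) \<longrightarrow> discriminant k a b \<noteq> 0 \<longrightarrow>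
    (\<forall>q\<ge>1. local_density (linear_prod k a b) q > 0) \<longrightarrow>
    c * (\<Prod>p | prime p \<and> real p \<le> D. series_factor k (root_residues (linear_prod k a b)) p)
      \<le> singular_series k (linear_prod k a b)"
    using singular_series_ge[OF assms(1)] by (elim exE conjE)
  \<comment> \<open>\<open>160 * k\<close> is \<open>ln N / ln D\<close>. In \<open>K2\<close>, the
    factor \<open>3 * k\<close> counts the integers escaping the sieve, in units of
    \<open>D\<close>, and \<open>(4 * k) ^ k\<close> comes from \<open>ln_power_le\<close>. The 4 in
    \<open>K\<close> pays for two crude convexity bounds.\<close>
  define K1 where "K1 = (160 * real k) ^ k / c"
  define K2 where "K2 = 3 * real k * ((4 * real k) ^ k / c)"
  define K where "K = 4 * (C0 powr (1 / p) * K1 + K2)"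
  have Kpos: "K1 > 0" "K2 > 0" "K > 0" using assms c C0 by (auto simp: K1_def K2_def K_def intro!: add_pos_pos mult_pos_pos)
  show ?thesis
  proof (rule exI[of _ K], intro conjI allI impI)
    fix a b :: "nat \<Rightarrow> int" and N :: nat
    assume a: "\<forall>j\<in>{1..k}. a j \<noteq> 0" and disc: "discriminant k a b \<noteq> 0"
      and pos: "\<forall>q\<ge>1. local_density (linear_prod k a b) q > 0" and N: "N \<ge> 2"
    define F where "F = linear_prod k a b"
    define \<omega> where "\<omega> = root_residues F"
    define S where "S = singular_series k F"
    define D where "D = real N powr (1 / (160 * real k))"
    define V where "V = (\<Prod>q | prime q \<and> real q \<le> D. sieve_density \<omega> q)"
    define M where "M = real N * V"
    define \<Lambda> where "\<Lambda> = ln (real N) ^ k"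
    have \<omega>: "sieve_dim_le k \<omega>" unfolding \<omega>_def F_def using pos by (rule sieve_dim_le_root_residues)
    have N0: "real N > 0" "real N \<ge> 1" and lnN: "ln (real N) > 0" using N by auto
    have \<Lambda>: "\<Lambda> > 0" using lnN by (simp add: \<Lambda>_def)
    have D1: "D \<ge> 1" unfolding D_def using N by (intro ge_one_powr_ge_zero) auto
    have V0: "V > 0" unfolding V_def using sieve_density_pos[OF \<omega>] by (intro prod_pos) auto
    have M0: "M > 0" using V0 N0 by (simp add: M_def)
    have lnD: "ln D = ln (real N) / (160 * real k)" using N0 by (simp add: D_def ln_powr)
    have Sge: "c * (\<Prod>p | prime p \<and> real p \<le> D'. series_factor k \<omega> p) \<le> S" for D'
      using sing a disc pos unfolding S_def \<omega>_def F_def by blast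
    have "\<not> (prime q \<and> real q \<le> 1)" for q using prime_gt_1_nat[of q] by auto
    then have none: "{q. prime q \<and> real q \<le> 1} = {}" by blast
    have Sc: "c \<le> S" using Sge[of 1] unfolding none by simp
    have S0: "S > 0" using Sc c by linarith
    have VS: "V \<le> K1 * S / \<Lambda>"
    proof -
      have "c * (V * ln D ^ k) \<le> c * (\<Prod>p | prime p \<and> real p \<le> D. series_factor k \<omega> p)"
        unfolding V_def using c series_factor_prod_ge[OF \<omega> D1] by (intro mult_left_mono) auto
      also have "\<dots> \<le> S" by (rule Sge)
      finally have "c * (V * (\<Lambda> / (160 * real k) ^ k)) \<le> S" by (simp add: lnD \<Lambda>_def power_divide)
      then show ?thesis using c \<Lambda> assms(1) by (simp add: K1_def field_simps)
    qed
    \<comment> \<open>\<open>D\<close> and, up to a constant, \<open>\<Lambda>\<close> are at most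
      \<open>N powr (1 / 4)\<close>, and \<open>N powr (1 / 2) \<le> N powr (1 - 1 / p)\<close>
      since \<open>p > 2\<close>. The singular series can be inserted because
      \<open>S / c \<ge> 1\<close>.\<close>
    have DS: "3 * real k * D \<le> K2 * S * real N powr (1 - 1 / p) / \<Lambda>"
    proof -
      have "D * \<Lambda> \<le> real N powr (1 / 4) * ((4 * real k) ^ k * real N powr (1 / 4))"
        unfolding D_def \<Lambda>_def using N0 lnN assms(1)
        by (intro mult_mono powr_mono ln_power_le) (auto simp: field_simps)
      also have "\<dots> = (4 * real k) ^ k * real N powr (1 / 2)"
        using N0 by (simp add: powr_add[symmetric])
      also have "\<dots> \<le> (4 * real k) ^ k * real N powr (1 - 1 / p)"
        using N0 assms(2) by (intro mult_left_mono powr_mono) (auto simp: field_simps)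
      also have "\<dots> \<le> (4 * real k) ^ k * real N powr (1 - 1 / p) * (S / c)"
      proof -
        have "1 \<le> S / c" using Sc c by simp
        from mult_left_mono[OF this, of "(4 * real k) ^ k * real N powr (1 - 1 / p)"] show ?thesis by simp
      qed
      finally have "3 * real k * (D * \<Lambda>) \<le> 3 * real k * ((4 * real k) ^ k * real N powr (1 - 1 / p) * (S / c))"
        by (intro mult_left_mono) auto
      then have "3 * real k * D * \<Lambda> \<le> K2 * S * real N powr (1 - 1 / p)" by (simp add: K2_def mult_ac)
      then show ?thesis using \<Lambda> by (simp only: pos_le_divide_eq)
    qed
    define X where "X = {n \<in> prime_product_points k F. n \<le> N}"
    define Y where "Y = {n \<in> X. \<forall>q. prime q \<longrightarrow> real q \<le> D \<longrightarrow> \<not> int q dvd F (int n)}"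
    have finX: "finite X" by (rule finite_subset[of _ "{..N}"]) (auto simp: X_def)
    have YX: "Y \<subseteq> X" by (auto simp: Y_def)
    have "Y \<subseteq> {1..N}" by (auto simp: Y_def X_def prime_product_points_def)
    moreover have "\<forall>n q. n \<in> Y \<longrightarrow> prime q \<longrightarrow> real q \<le> D \<longrightarrow> n mod q \<notin> \<omega> q"
      by (auto simp: Y_def \<omega>_def F_def mod_in_root_residues_iff)
    ultimately have intY: "(LINT \<theta>|unit_measure. norm (\<Sum>n\<in>Y. e (real n * \<theta>)) powr p) \<le> C0 * M powr p / real N"
      by (intro restr[THEN spec, THEN spec, THEN spec, THEN spec, THEN spec, THEN mp, OF \<omega>, THEN mp, OF N,
        THEN mp, THEN mp, OF _ D_def, THEN mp, THEN mp, OF _ _ M_def[unfolded V_def]])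
    have cardZ: "real (card (X - Y)) \<le> 3 * real k * D"
    proof -
      define T where "T j = {n::nat. n \<le> N \<and> of_int \<bar>a j * int n + b j\<bar> \<le> D}" for j
      have "X - Y \<subseteq> (\<Union>j\<in>{1..k}. T j)"
      proof
        fix n assume n: "n \<in> X - Y"
        then obtain q where q: "prime q" "real q \<le> D" "int q dvd F (int n)" by (auto simp: Y_def)
        obtain P :: "int multiset" where P: "size P = k" "\<forall>q\<in>#P. prime q" "F (int n) = prod_mset P"
          using n by (auto simp: X_def prime_product_points_def)
        have "\<exists>j\<in>{1..k}. of_int \<bar>a j * int n + b j\<bar> \<le> D"
          using product_of_primes_small_factor[OF P(1,2) P(3)[unfolded F_def] q(1,2) q(3)[unfolded F_def] D1] .
        then show "n \<in> (\<Union>j\<in>{1..k}. T j)" using n by (auto simp: T_def X_def)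
      qed
      moreover have "finite (T j)" for j by (rule finite_subset[of _ "{..N}"]) (auto simp: T_def)
      ultimately have "card (X - Y) \<le> card (\<Union>j\<in>{1..k}. T j)" by (intro card_mono) auto
      also have "\<dots> \<le> (\<Sum>j\<in>{1..k}. card (T j))" by (intro card_UN_le) auto
      finally have "real (card (X - Y)) \<le> (\<Sum>j\<in>{1..k}. real (card (T j)))" by (metis of_nat_le_iff of_nat_sum)
      also have "\<dots> \<le> (\<Sum>j\<in>{1..k}. 2 * D + 1)"
        unfolding T_def using a D1 by (intro sum_mono card_small_linear_values) auto
      also have "\<dots> \<le> real k * (3 * D)" using D1 by (simp add: mult_left_mono)
      finally show ?thesis by simp
    qed
    define H where "H = exp_sum k N F"
    define h where "h \<theta> = norm (\<Sum>n\<in>Y. e (real n * \<theta>))" for \<theta>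
    define E where "E = 3 * real k * D"
    have E0: "E > 0" using D1 assms(1) by (simp add: E_def)
    \<comment> \<open>Chosen so that \<open>U powr p = C0 * M powr p / N\<close>: \<open>U\<close>
      bounds the norm of the sifted part, while \<open>E\<close> bounds the remaining terms
      pointwise.\<close>
    define U where "U = C0 powr (1 / p) * M * real N powr (- 1 / p)"
    have U0: "U > 0" using C0 M0 N0 by (simp add: U_def)
    have Hle: "norm (H \<theta>) \<le> h \<theta> + E" for \<theta>
    proof -
      have "H \<theta> = (\<Sum>n\<in>X - Y. e (real n * \<theta>)) + (\<Sum>n\<in>Y. e (real n * \<theta>))"
        unfolding H_def exp_sum_def X_def[symmetric] using YX finX by (rule sum.subset_diff)
      moreover have "norm (\<Sum>n\<in>X - Y. e (real n * \<theta>)) \<le> (\<Sum>n\<in>X - Y. 1)"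
        by (intro order_trans[OF norm_sum] sum_mono) auto
      ultimately show ?thesis
        using norm_triangle_ineq[of "\<Sum>n\<in>X - Y. e (real n * \<theta>)" "\<Sum>n\<in>Y. e (real n * \<theta>)"] cardZ
        by (simp add: h_def E_def)
    qed
    \<comment> \<open>In place of Minkowski's inequality. This bound and the later
      \<open>U powr p + E powr p \<le> (2 * (U + E)) powr p\<close> each cost a factor 2 in the
      norm.\<close>
    have powle: "(x + y) powr p \<le> 2 powr p * (x powr p + y powr p)" if "x \<ge> 0" "y \<ge> 0" for x y :: real
    proof -
      have "(x + y) powr p \<le> (2 * max x y) powr p" using that assms(2) by (intro powr_mono2) auto
      also have "\<dots> = 2 powr p * max x y powr p" by (rule powr_mult)
      also have "max x y powr p \<le> x powr p + y powr p" by (auto simp: max_def)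
      finally show ?thesis by simp
    qed
    have hb: "h \<theta> \<le> real (card Y)" for \<theta>
    proof -
      have "h \<theta> \<le> (\<Sum>n\<in>Y. 1)" unfolding h_def by (intro order_trans[OF norm_sum] sum_mono) auto
      then show ?thesis by simp
    qed
    have hm: "h \<in> borel_measurable unit_measure"
    proof -
      have "(\<lambda>\<theta>. \<Sum>n\<in>Y. e (real n * \<theta>)) \<in> borel_measurable unit_measure"
        by (intro continuous_borel_measurable_unit continuous_intros)
      then show ?thesis unfolding h_def by simp
    qed
    have Hm: "H \<in> borel_measurable unit_measure"
      unfolding H_def exp_sum_def by (intro continuous_borel_measurable_unit continuous_intros)
    have inth: "integrable unit_measure (\<lambda>\<theta>. h \<theta> powr p)"
    proof (rule integrable_unit_bounded)
      show "(\<lambda>\<theta>. h \<theta> powr p) \<in> borel_measurable unit_measure" using hm by measurable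
      show "norm (h \<theta> powr p) \<le> real (card Y) powr p" for \<theta>
        using hb[of \<theta>] assms(2) by (auto simp: h_def intro!: powr_mono2)
    qed
    have intE: "integrable unit_measure (\<lambda>\<theta>::real. E powr p)" by (rule integrable_unit_bounded[of _ "E powr p"]) auto
    have ptw: "norm (H \<theta>) powr p \<le> 2 powr p * (h \<theta> powr p + E powr p)" for \<theta>
    proof -
      have "norm (H \<theta>) powr p \<le> (h \<theta> + E) powr p" using Hle assms(2) by (intro powr_mono2) auto
      also have "\<dots> \<le> 2 powr p * (h \<theta> powr p + E powr p)" using E0 by (intro powle) (auto simp: h_def)
      finally show ?thesis .
    qed
    have intH: "integrable unit_measure (\<lambda>\<theta>. norm (H \<theta>) powr p)"
    proof (rule integrable_unit_bounded)
      show "(\<lambda>\<theta>. norm (H \<theta>) powr p) \<in> borel_measurable unit_measure" using Hm by measurable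
      show "norm (norm (H \<theta>) powr p) \<le> (real (card Y) + E) powr p" for \<theta>
        using Hle[of \<theta>] hb[of \<theta>] assms(2) by (auto intro!: powr_mono2)
    qed
    have "(LINT \<theta>:{0..1}|lborel. norm (H \<theta>) powr p) = (LINT \<theta>|unit_measure. norm (H \<theta>) powr p)"
      by (simp add: unit_measure_def integral_restrict_space set_lebesgue_integral_def)
    also have "\<dots> \<le> (LINT \<theta>|unit_measure. 2 powr p * (h \<theta> powr p + E powr p))"
      using ptw intH inth intE by (intro integral_mono integrable_mult_right Bochner_Integration.integrable_add) auto
    also have "\<dots> = 2 powr p * ((LINT \<theta>|unit_measure. h \<theta> powr p) + E powr p)"
      using inth intE by (simp add: Bochner_Integration.integral_add measure_unit_space)
    also have "\<dots> \<le> 2 powr p * (U powr p + E powr p)"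
    proof -
      have "U powr p = C0 * M powr p / real N"
      proof -
        have "(C0 powr (1 / p)) powr p = C0" using C0 assms(2) by (simp add: powr_powr)
        moreover have "(real N powr (- 1 / p)) powr p = 1 / real N"
        proof -
          have "(real N powr (- 1 / p)) powr p = real N powr (- 1 / p * p)" by (rule powr_powr)
          also have "- 1 / p * p = - 1" using assms(2) by simp
          finally show ?thesis using N0 by (simp add: powr_minus_divide)
        qed
        ultimately show ?thesis by (simp add: U_def powr_mult)
      qed
      then show ?thesis using intY by (simp add: h_def)
    qed
    also have "\<dots> \<le> 2 powr p * (2 * (U + E)) powr p"
    proof -
      have "U powr p \<le> (U + E) powr p" "E powr p \<le> (U + E) powr p"
        using U0 E0 assms(2) by (auto intro!: powr_mono2)
      moreover have "2 * (U + E) powr p \<le> 2 powr p * (U + E) powr p"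
        using powr_mono[of 1 p 2] assms(2) by (intro mult_right_mono) auto
      moreover have "(2 * (U + E)) powr p = 2 powr p * (U + E) powr p" by (rule powr_mult)
      ultimately have "U powr p + E powr p \<le> (2 * (U + E)) powr p" by linarith
      then show ?thesis by simp
    qed
    also have "\<dots> = (4 * (U + E)) powr p" by (simp add: powr_mult[symmetric])
    finally have int: "(LINT \<theta>:{0..1}|lborel. norm (H \<theta>) powr p) \<le> (4 * (U + E)) powr p" .
    have "Lp_norm_circle p H \<le> ((4 * (U + E)) powr p) powr (1 / p)"
      unfolding Lp_norm_circle_def using int assms(2)
      by (intro powr_mono2) (auto simp: set_lebesgue_integral_def intro!: Bochner_Integration.integral_nonneg)
    also have "\<dots> = 4 * (U + E)" using U0 E0 assms(2) by (simp add: powr_powr)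
    also have "\<dots> \<le> 4 * (C0 powr (1 / p) * (K1 * S / \<Lambda>) * real N powr (1 - 1 / p) + K2 * S * real N powr (1 - 1 / p) / \<Lambda>)"
    proof -
      have "U = C0 powr (1 / p) * V * real N powr (1 - 1 / p)"
        using N0 by (simp add: U_def M_def powr_diff powr_minus field_simps)
      also have "\<dots> \<le> C0 powr (1 / p) * (K1 * S / \<Lambda>) * real N powr (1 - 1 / p)"
        using VS by (intro mult_right_mono mult_left_mono) auto
      finally show ?thesis using DS by (simp add: E_def)
    qed
    also have "\<dots> = K * S * real N powr (1 - 1 / p) * inverse \<Lambda>"
      by (simp add: K_def divide_inverse algebra_simps)
    finally show "Lp_norm_circle p (exp_sum k N (linear_prod k a b))
         \<le> K * singular_series k (linear_prod k a b) * real N powr (1 - 1 / p) * ln (real N) powi (- int k)"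
      by (simp add: H_def F_def S_def \<Lambda>_def power_int_minus)
  qed (rule Kpos)
qed

end
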